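(* Let $G$ be a discrete group, $\mathcal{M}=\{M_t\}_{t\in G}$ a W$^*$-Fell bundle over $G$ and $H$ a normal subgroup of $G$. Write $\mathbb{k}_{\mathrm{w}^*}(\mathcal{M})^H$ for the W$^*$-algebra of fixed points of $\beta^{\mathrm{w}^*}|_H$. Then there exists a W$^*$-isomorphism $$\mu\colon\mathbb{k}_{\mathrm{w}^*}(\dot{\mathcal{M}})\to\mathbb{k}_{\mathrm{w}^*}(\mathcal{M})^H$$ such that $\mu(W^*_{\mathrm r}(\dot{\mathcal{M}}))=W^*_{\mathrm r}(\mathcal{M})$.
   Context: **Fell bundles.** A Fell bundle over a discrete group $G$ is a family $\mathcal{M}=\{M_t\}_{t\in G}$ of complex Banach spaces with associative bilinear multiplications $M_s\times M_t\to M_{st}$ and conjugate-linear involutions $M_t\to M_{t^{-1}}$ such that $\|ab\|\le\|a\|\|b\|$, $(ab)^*=b^*a^*$, $a^{**}=a$, $\|a^*\|=\|a\|$, $\|a^*a\|=\|a\|^2$ and $a^*a\ge 0$ in the C$^*$-algebra $M_e$. A W$^*$-Fell bundle is a Fell bundle in which every fibre $M_t$ is the dual of a Banach space, and involution and left/right multiplication by a fixed element are weak$^*$-continuous on fibres; then $M_e$ is a W$^*$-algebra. A representation of $\mathcal{M}$ on a Hilbert space $X$ is a map $\pi\colon\mathcal{M}\to\mathbb{B}(X)$ that is linear on fibres, multiplicative and $*$-preserving. **Algebras.** For a W$^*$-Fell bundle $\mathcal{M}$ over a discrete group $G$ choose a representation $\pi\colon\mathcal{M}\to\mathbb{B}(X)$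 that is unital and, on each fibre, isometric and weak$^*$-continuous (one always exists; the algebras $\mathbb{k}_{\mathrm{w}^*}(\mathcal{M})$ and $W^*_{\mathrm r}(\mathcal{M})$ defined in this paragraph do not depend on the choice up to canonical isomorphism). $\lambda,\rho$ are the left and right regular representations of $G$ on $\ell^2(G)$: $\lambda_t\delta_s=\delta_{ts}$, $\rho_t\delta_s=\delta_{st^{-1}}$. An operator $T\in\mathbb{B}(X\otimes\ell^2(G))$ has matrix entries $T_{r,s}\in\mathbb{B}(X)$ with $\langle T_{r,s}x,y\rangle=\langle T(x\otimes\delta_s),y\otimes\delta_r\rangle$. The W$^*$-algebra of kernels is $$\mathbb{k}_{\mathrm{w}^*}(\mathcal{M})=\{T\in\mathbb{B}(X\otimes\ell^2(G)) : T_{r,s}\in\pi(M_{rs^{-1}})\ \forall r,s\in G\},$$ with the canonical $G$-action $\beta^{\mathrm{w}^*}_t=\mathrm{Ad}(1\otimes\rho_t)$, i.e. $\beta^{\mathrm{w}^*}_t(T)_{r,s}=T_{rt,st}$. The reduced cross-sectional W$^*$-algebra is $W^*_{\mathrm r}(\mathcal{M})=\overline{\mathrm{span}}^{\mathrm{w}^*}\{\pi(m)\otimes\lambda_t : t\in G,\ m\in M_t\}\subseteq\mathbb{k}_{\mathrm{w}^*}(\mathcal{M})$. **Quotient bundle.** Let $\dot G=G/H$. For $u\in\dot G$, $\dot M_u=\overline{\mathrm{span}}^{\mathrm{w}^*}\{\pi(m)\otimes\lambda_t : t\in u,\ m\in M_t\}\subseteq W^*_{\mathrm r}(\mathcal{M})$.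 Then $\dot{\mathcal{M}}=\{\dot M_u\}_{u\in\dot G}$ (the W$^*$-partial cross-sectional bundle over $\dot G$ derived from $\mathcal{M}$) is a W$^*$-Fell bundle over $\dot G$ with norm, product, involution and weak$^*$-topology inherited from $W^*_{\mathrm r}(\mathcal{M})$. The algebras $\mathbb{k}_{\mathrm{w}^*}(\dot{\mathcal{M}})$ and $W^*_{\mathrm r}(\dot{\mathcal{M}})$ are the W$^*$-algebra of kernels and the reduced cross-sectional W$^*$-algebra of the W$^*$-Fell bundle $\dot{\mathcal{M}}$ over the discrete group $\dot G$. Explicitly, using the inclusions $\dot M_u\subseteq\mathbb{B}(X\otimes\ell^2(G))$ as the representation of $\dot{\mathcal{M}}$, $$\mathbb{k}_{\mathrm{w}^*}(\dot{\mathcal{M}})=\{S\in\mathbb{B}(X\otimes\ell^2(G)\otimes\ell^2(\dot G)) : S_{u,v}\in\dot M_{uv^{-1}}\ \forall u,v\in\dot G\},$$ where the matrix entries $S_{u,v}\in\mathbb{B}(X\otimes\ell^2(G))$ are determined by $\langle S_{u,v}\xi,\eta\rangle=\langle S(\xi\otimes\delta_v),\eta\otimes\delta_u\rangle$ for $\xi,\eta\in X\otimes\ell^2(G)$, and $$W^*_{\mathrm r}(\dot{\mathcal{M}})=\overline{\mathrm{span}}^{\mathrm{w}^*}\{a\otimes\dot\lambda_u : u\in\dot G,\ a\in\dot M_u\}\subseteq\mathbb{k}_{\mathrm{w}^*}(\dot{\mathcal{M}}),$$ where $\dot\lambda$ is the left regular representation of $\dot G$ on $\ell^2(\dot G)$,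 $\dot\lambda_u\delta_v=\delta_{uv}$. *)

theory Defs
  imports "HOL-Analysis.Analysis" "HOL-Algebra.Coset" "HOL-Library.Function_Algebras"
begin

section \<open>Complex vector spaces, Banach spaces and Hilbert spaces\<close>

class complex_vector = ab_group_add +
  fixes scaleC :: "complex \<Rightarrow> 'a \<Rightarrow> 'a" (infixr "*\<^sub>C" 75)
  assumes scaleC_add_right: "c *\<^sub>C (x + y) = c *\<^sub>C x + c *\<^sub>C y"
    and scaleC_add_left: "(c + d) *\<^sub>C x = c *\<^sub>C x + d *\<^sub>C x"
    and scaleC_scaleC: "c *\<^sub>C (d *\<^sub>C x) = (c * d) *\<^sub>C x"
    and scaleC_one: "1 *\<^sub>C x = x"

interpretation complex_vector: vector_space "scaleC :: complex \<Rightarrow> 'a \<Rightarrow> 'a::complex_vector"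
  by unfold_locales (simp_all add: scaleC_add_right scaleC_add_left scaleC_scaleC scaleC_one)

instantiation complex :: complex_vector
begin
definition scaleC_complex_def: "c *\<^sub>C (x::complex) = c * x"
instance by standard (simp_all add: scaleC_complex_def algebra_simps)
end

text \<open>Functions carry the pointwise vector space structure.\<close>

instantiation "fun" :: (type, complex_vector) complex_vector
begin
definition scaleC_fun_def: "c *\<^sub>C f = (\<lambda>x. c *\<^sub>C f x)"
instance
  by standard (simp_all add: scaleC_fun_def plus_fun_def fun_eq_iff
      scaleC_add_right scaleC_add_left scaleC_scaleC scaleC_one)
end

text \<open>
  A space is given by a carrier, which is a linear subspace of the ambient type, together with
  a norm (and an inner product) that is only meaningful on the carrier. This makes it possible to
  speak of families of spaces indexed by group elements and of the spaces $\ell^2(I;V)$.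
\<close>

record 'v cnormed = "'v partial_object" +
  nrm :: "'v \<Rightarrow> real"

locale complex_banach =
  fixes V :: "('v::complex_vector, 'b) cnormed_scheme"
  assumes subspace: "complex_vector.subspace (carrier V)"
    and nrm_nonneg: "x \<in> carrier V \<Longrightarrow> 0 \<le> nrm V x"
    and nrm_eq_0: "x \<in> carrier V \<Longrightarrow> nrm V x = 0 \<longleftrightarrow> x = 0"
    and nrm_triangle: "\<lbrakk>x \<in> carrier V; y \<in> carrier V\<rbrakk> \<Longrightarrow> nrm V (x + y) \<le> nrm V x + nrm V y"
    and nrm_scaleC: "x \<in> carrier V \<Longrightarrow> nrm V (c *\<^sub>C x) = cmod c * nrm V x"
    and complete:
      "\<lbrakk>\<And>n::nat. s n \<in> carrier V;
        \<And>e. e > 0 \<Longrightarrow> \<exists>N. \<forall>m\<ge>N. \<forall>n\<ge>N. nrm V (s m - s n) < e\<rbrakk>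
       \<Longrightarrow> \<exists>l\<in>carrier V. (\<lambda>n. nrm V (s n - l)) \<longlonglongrightarrow> 0"

text \<open>Inner products are linear in the first and conjugate-linear in the second variable.\<close>

record 'v chilb = "'v cnormed" +
  cinner :: "'v \<Rightarrow> 'v \<Rightarrow> complex"

locale complex_hilbert = complex_banach X
  for X :: "('v::complex_vector, 'b) chilb_scheme" +
  assumes cinner_add_left:
      "\<lbrakk>x \<in> carrier X; y \<in> carrier X; z \<in> carrier X\<rbrakk>
       \<Longrightarrow> cinner X (x + y) z = cinner X x z + cinner X y z"
    and cinner_scaleC_left:
      "\<lbrakk>x \<in> carrier X; y \<in> carrier X\<rbrakk> \<Longrightarrow> cinner X (c *\<^sub>C x) y = c * cinner X x y"
    and cinner_commute:
      "\<lbrakk>x \<in> carrier X; y \<in> carrier X\<rbrakk> \<Longrightarrow> cinner X x y = cnj (cinner X y x)"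
    and cinner_self: "x \<in> carrier X \<Longrightarrow> cinner X x x = complex_of_real ((nrm X x)\<^sup>2)"

definition linear_maps_on :: "'v::complex_vector set \<Rightarrow> ('v \<Rightarrow> 'w::complex_vector) \<Rightarrow> bool" where
  "linear_maps_on A T \<longleftrightarrow>
     (\<forall>x\<in>A. \<forall>y\<in>A. T (x + y) = T x + T y) \<and> (\<forall>c. \<forall>x\<in>A. T (c *\<^sub>C x) = c *\<^sub>C T x)"

definition bounded_linear_on ::
    "('v::complex_vector, 'a) cnormed_scheme \<Rightarrow> ('w::complex_vector, 'b) cnormed_scheme
     \<Rightarrow> ('v \<Rightarrow> 'w) \<Rightarrow> bool" where
  "bounded_linear_on V W T \<longleftrightarrow> T \<in> carrier V \<rightarrow> carrier W \<and> linear_maps_on (carrier V) T \<and>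
     (\<exists>B. \<forall>x\<in>carrier V. nrm W (T x) \<le> B * nrm V x)"

definition op_norm ::
    "('v::complex_vector, 'a) cnormed_scheme \<Rightarrow> ('w::complex_vector, 'b) cnormed_scheme
     \<Rightarrow> ('v \<Rightarrow> 'w) \<Rightarrow> real" where
  "op_norm V W T = (SUP x\<in>{x \<in> carrier V. nrm V x \<le> 1}. nrm W (T x))"

definition scalars :: "complex cnormed" where
  "scalars = \<lparr>carrier = UNIV, nrm = cmod\<rparr>"

text \<open>
  \<open>is_dual V F p\<close>: the pairing \<open>p\<close> identifies \<open>V\<close> isometrically with the dual of the Banach
  space \<open>F\<close>, via $m \mapsto p(m,\cdot)$.
\<close>

definition is_dual ::
    "'v::complex_vector cnormed \<Rightarrow> 'f::complex_vector cnormed \<Rightarrow> ('v \<Rightarrow> 'f \<Rightarrow> complex) \<Rightarrow> bool" where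
  "is_dual V F p \<longleftrightarrow> complex_banach F \<and>
     (\<forall>m\<in>carrier V. bounded_linear_on F scalars (p m)) \<and>
     (\<forall>f\<in>carrier F. linear_maps_on (carrier V) (\<lambda>m. p m f)) \<and>
     (\<forall>m\<in>carrier V. op_norm F scalars (p m) = nrm V m) \<and>
     (\<forall>\<phi>. bounded_linear_on F scalars \<phi> \<longrightarrow> (\<exists>m\<in>carrier V. \<forall>f\<in>carrier F. p m f = \<phi> f))"

definition weak_topology :: "'a set \<Rightarrow> ('a \<Rightarrow> complex) set \<Rightarrow> 'a topology" where
  "weak_topology A \<Phi> =
     pullback_topology A (\<lambda>a. \<lambda>\<phi>\<in>\<Phi>. \<phi> a) (product_topology (\<lambda>_. euclidean) \<Phi>)"


section \<open>Operators on a Hilbert space\<close>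

text \<open>
  Operators are functions on the ambient type that vanish off the carrier. This makes their
  extensional equality meaningful, and sums, scalar multiples and compositions of operators are
  simply the pointwise ones and \<open>(\<circ>)\<close>.
\<close>

definition operators :: "('v::complex_vector, 'b) chilb_scheme \<Rightarrow> ('v \<Rightarrow> 'v) set" where
  "operators X = {T. bounded_linear_on X X T \<and> (\<forall>x. x \<notin> carrier X \<longrightarrow> T x = 0)}"

definition id_op :: "('v::complex_vector, 'b) chilb_scheme \<Rightarrow> 'v \<Rightarrow> 'v" where
  "id_op X = (\<lambda>x. if x \<in> carrier X then x else 0)"

definition adj :: "('v::complex_vector, 'b) chilb_scheme \<Rightarrow> ('v \<Rightarrow> 'v) \<Rightarrow> 'v \<Rightarrow> 'v" where
  "adj X T = (THE S. S \<in> operators X \<and>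
     (\<forall>x\<in>carrier X. \<forall>y\<in>carrier X. cinner X (T x) y = cinner X x (S y)))"

definition sq_summable_seqs :: "('v::complex_vector, 'b) chilb_scheme \<Rightarrow> (nat \<Rightarrow> 'v) set" where
  "sq_summable_seqs X = {x. (\<forall>n. x n \<in> carrier X) \<and> summable (\<lambda>n. (nrm X (x n))\<^sup>2)}"

text \<open>
  The weak$^*$-topology of $\mathbb{B}(X)$, as dual of the trace class operators, is the
  ultraweak topology: its continuous functionals are $T \mapsto \sum_n \langle T x_n, y_n\rangle$
  with $\sum_n \|x_n\|^2 < \infty$ and $\sum_n \|y_n\|^2 < \infty$.
\<close>

definition weakstar_op :: "('v::complex_vector, 'b) chilb_scheme \<Rightarrow> ('v \<Rightarrow> 'v) topology" where
  "weakstar_op X = weak_topology (operators X)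
     {(\<lambda>T. \<Sum>n. cinner X (T (x n)) (y n)) | x y. x \<in> sq_summable_seqs X \<and> y \<in> sq_summable_seqs X}"


section \<open>The Hilbert space $X \otimes \ell^2(I)$\<close>

text \<open>
  $X \otimes \ell^2(I)$ is identified with $\ell^2(I;X)$, the elementary tensor
  $x \otimes \delta_s$ being the function \<open>delta s x\<close>.
\<close>

definition ell2 :: "'i set \<Rightarrow> ('v::complex_vector, 'b) chilb_scheme \<Rightarrow> ('i \<Rightarrow> 'v) chilb" where
  "ell2 I X = \<lparr>
     carrier = {f. (\<forall>i\<in>I. f i \<in> carrier X) \<and> (\<forall>i. i \<notin> I \<longrightarrow> f i = 0) \<and>
                   (\<lambda>i. (nrm X (f i))\<^sup>2) summable_on I},
     nrm = (\<lambda>f. sqrt (\<Sum>\<^sub>\<infinity>i\<in>I. (nrm X (f i))\<^sup>2)),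
     cinner = (\<lambda>f g. \<Sum>\<^sub>\<infinity>i\<in>I. cinner X (f i) (g i))\<rparr>"

definition delta :: "'i \<Rightarrow> 'v \<Rightarrow> 'i \<Rightarrow> 'v::zero" where
  "delta s x = (\<lambda>r. if r = s then x else 0)"

text \<open>
  The matrix entry $T_{r,s}$; the lemma \<open>cinner_mat_entry\<close> below is its usual characterization.
\<close>

definition mat_entry ::
    "('v::complex_vector, 'b) chilb_scheme \<Rightarrow> (('i \<Rightarrow> 'v) \<Rightarrow> 'i \<Rightarrow> 'v) \<Rightarrow> 'i \<Rightarrow> 'i \<Rightarrow> 'v \<Rightarrow> 'v" where
  "mat_entry X T r s = (\<lambda>x. if x \<in> carrier X then T (delta s x) r else 0)"

text \<open>
  The operator $T \otimes \lambda_t$ on $X \otimes \ell^2(G)$, where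
  $\lambda_t\delta_s = \delta_{ts}$, and the operator $1 \otimes \rho_t$, where
  $\rho_t\delta_s = \delta_{st^{-1}}$.
\<close>

definition tensor_lambda ::
    "('g, 'c) monoid_scheme \<Rightarrow> ('v::complex_vector, 'b) chilb_scheme
     \<Rightarrow> ('v \<Rightarrow> 'v) \<Rightarrow> 'g \<Rightarrow> ('g \<Rightarrow> 'v) \<Rightarrow> 'g \<Rightarrow> 'v" where
  "tensor_lambda G X T t = (\<lambda>\<xi>. if \<xi> \<in> carrier (ell2 (carrier G) X)
     then (\<lambda>r. if r \<in> carrier G then T (\<xi> (inv\<^bsub>G\<^esub> t \<otimes>\<^bsub>G\<^esub> r)) else 0) else 0)"

definition one_tensor_rho ::
    "('g, 'c) monoid_scheme \<Rightarrow> ('v::complex_vector, 'b) chilb_scheme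
     \<Rightarrow> 'g \<Rightarrow> ('g \<Rightarrow> 'v) \<Rightarrow> 'g \<Rightarrow> 'v" where
  "one_tensor_rho G X t = (\<lambda>\<xi>. if \<xi> \<in> carrier (ell2 (carrier G) X)
     then (\<lambda>r. if r \<in> carrier G then \<xi> (r \<otimes>\<^bsub>G\<^esub> t) else 0) else 0)"

lemma delta_in_ell2:
  assumes "complex_hilbert X" "s \<in> I" "x \<in> carrier X"
  shows "delta s x \<in> carrier (ell2 I X)"
proof -
  interpret complex_hilbert X by fact
  have 0: "0 \<in> carrier X"
    using subspace by (rule complex_vector.subspace_0)
  then have n0: "nrm X 0 = 0"
    using nrm_eq_0 by blast
  have "(\<lambda>i. (nrm X (delta s x i))\<^sup>2) summable_on {s}"
    by simp
  moreover have "(\<lambda>i. (nrm X (delta s x i))\<^sup>2) summable_on I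
      \<longleftrightarrow> (\<lambda>i. (nrm X (delta s x i))\<^sup>2) summable_on {s}"
    by (rule summable_on_cong_neutral) (use assms n0 in \<open>auto simp: delta_def\<close>)
  ultimately show ?thesis
    using assms 0 by (auto simp: ell2_def delta_def)
qed

lemma cinner_mat_entry:
  assumes "complex_hilbert X" "T \<in> operators (ell2 I X)" "r \<in> I" "s \<in> I"
    and "x \<in> carrier X" "y \<in> carrier X"
  shows "cinner X (mat_entry X T r s x) y = cinner (ell2 I X) (T (delta s x)) (delta r y)"
proof -
  interpret complex_hilbert X by fact
  have 0: "0 \<in> carrier X"
    using subspace by (rule complex_vector.subspace_0)
  have z: "cinner X v 0 = 0" if "v \<in> carrier X" for v
    using cinner_scaleC_left[OF 0 that, of 0] cinner_commute[OF that 0] by simp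
  have "T (delta s x) \<in> carrier (ell2 I X)"
    using assms delta_in_ell2[of X s I x] by (auto simp: operators_def bounded_linear_on_def)
  then have T: "T (delta s x) i \<in> carrier X" if "i \<in> I" for i
    using that by (simp add: ell2_def)
  have "(\<Sum>\<^sub>\<infinity>i\<in>I. cinner X (T (delta s x) i) (delta r y i))
      = (\<Sum>\<^sub>\<infinity>i\<in>{r}. cinner X (T (delta s x) i) (delta r y i))"
    by (rule infsum_cong_neutral) (use assms T z in \<open>auto simp: delta_def\<close>)
  then show ?thesis
    using assms by (simp add: ell2_def mat_entry_def delta_def)
qed

lemma tensor_lambda_delta:
  assumes "group G" "complex_hilbert X" "T \<in> operators X" "t \<in> carrier G" "s \<in> carrier G"
    and "x \<in> carrier X"
  shows "tensor_lambda G X T t (delta s x) = delta (t \<otimes>\<^bsub>G\<^esub> s) (T x)"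
proof -
  interpret group G by fact
  interpret complex_hilbert X by fact
  have "0 \<in> carrier X"
    using subspace by (rule complex_vector.subspace_0)
  moreover have "linear_maps_on (carrier X) T"
    using assms(3) by (simp add: operators_def bounded_linear_on_def)
  ultimately have "T (0 *\<^sub>C 0) = 0 *\<^sub>C T 0"
    unfolding linear_maps_on_def by blast
  then have T0: "T 0 = 0" by simp
  have "inv\<^bsub>G\<^esub> t \<otimes>\<^bsub>G\<^esub> r = s \<longleftrightarrow> r = t \<otimes>\<^bsub>G\<^esub> s" if "r \<in> carrier G" for r
    using that assms by (metis inv_solve_left inv_closed)
  then show ?thesis
    using assms delta_in_ell2[of X s "carrier G" x] T0
    by (auto simp: tensor_lambda_def delta_def fun_eq_iff)
qed

lemma one_tensor_rho_delta:
  assumes "group G" "complex_hilbert X" "t \<in> carrier G" "s \<in> carrier G" "x \<in> carrier X"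
  shows "one_tensor_rho G X t (delta s x) = delta (s \<otimes>\<^bsub>G\<^esub> inv\<^bsub>G\<^esub> t) x"
proof -
  interpret group G by fact
  have "r \<otimes>\<^bsub>G\<^esub> t = s \<longleftrightarrow> r = s \<otimes>\<^bsub>G\<^esub> inv\<^bsub>G\<^esub> t" if "r \<in> carrier G" for r
    using that assms by (metis inv_solve_right)
  then show ?thesis
    using assms delta_in_ell2[of X s "carrier G" x]
    by (auto simp: one_tensor_rho_def delta_def fun_eq_iff)
qed


section \<open>Fell bundles\<close>

text \<open>
  The fibres need not be disjoint as sets, hence all operations are indexed by the group elements
  whose fibres they act on: \<open>fmult M s t\<close> is the product $M_s \times M_t \to M_{st}$ and
  \<open>fstar M t\<close> the involution $M_t \to M_{t^{-1}}$.
\<close>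

record ('g, 'm) fell_data =
  fibre :: "'g \<Rightarrow> 'm cnormed"
  fmult :: "'g \<Rightarrow> 'g \<Rightarrow> 'm \<Rightarrow> 'm \<Rightarrow> 'm"
  fstar :: "'g \<Rightarrow> 'm \<Rightarrow> 'm"

abbreviation fib :: "('g, 'm) fell_data \<Rightarrow> 'g \<Rightarrow> 'm set" where
  "fib M t \<equiv> carrier (fibre M t)"

text \<open>An element of the C$^*$-algebra $M_e$ is positive iff it is of the form $b^*b$.\<close>

locale fell_bundle = group G for G :: "('g, 'c) monoid_scheme" (structure) +
  fixes M :: "('g, 'm::complex_vector) fell_data"
  assumes fibre_banach: "t \<in> carrier G \<Longrightarrow> complex_banach (fibre M t)"
    and fmult_closed:
      "\<lbrakk>s \<in> carrier G; t \<in> carrier G; a \<in> fib M s; b \<in> fib M t\<rbrakk> \<Longrightarrow> fmult M s t a b \<in> fib M (s \<otimes> t)"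
    and fmult_linear_right:
      "\<lbrakk>s \<in> carrier G; t \<in> carrier G; a \<in> fib M s\<rbrakk>
       \<Longrightarrow> linear_maps_on (fib M t) (\<lambda>b. fmult M s t a b)"
    and fmult_linear_left:
      "\<lbrakk>s \<in> carrier G; t \<in> carrier G; b \<in> fib M t\<rbrakk>
       \<Longrightarrow> linear_maps_on (fib M s) (\<lambda>a. fmult M s t a b)"
    and fmult_assoc:
      "\<lbrakk>r \<in> carrier G; s \<in> carrier G; t \<in> carrier G; a \<in> fib M r; b \<in> fib M s; c \<in> fib M t\<rbrakk>
       \<Longrightarrow> fmult M (r \<otimes> s) t (fmult M r s a b) c = fmult M r (s \<otimes> t) a (fmult M s t b c)"
    and fstar_closed: "\<lbrakk>t \<in> carrier G; a \<in> fib M t\<rbrakk> \<Longrightarrow> fstar M t a \<in> fib M (inv t)"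
    and fstar_add:
      "\<lbrakk>t \<in> carrier G; a \<in> fib M t; b \<in> fib M t\<rbrakk> \<Longrightarrow> fstar M t (a + b) = fstar M t a + fstar M t b"
    and fstar_scaleC:
      "\<lbrakk>t \<in> carrier G; a \<in> fib M t\<rbrakk> \<Longrightarrow> fstar M t (z *\<^sub>C a) = cnj z *\<^sub>C fstar M t a"
    and nrm_fmult:
      "\<lbrakk>s \<in> carrier G; t \<in> carrier G; a \<in> fib M s; b \<in> fib M t\<rbrakk>
       \<Longrightarrow> nrm (fibre M (s \<otimes> t)) (fmult M s t a b) \<le> nrm (fibre M s) a * nrm (fibre M t) b"
    and fstar_fmult:
      "\<lbrakk>s \<in> carrier G; t \<in> carrier G; a \<in> fib M s; b \<in> fib M t\<rbrakk>
       \<Longrightarrow> fstar M (s \<otimes> t) (fmult M s t a b) = fmult M (inv t) (inv s) (fstar M t b) (fstar M s a)"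
    and fstar_fstar: "\<lbrakk>t \<in> carrier G; a \<in> fib M t\<rbrakk> \<Longrightarrow> fstar M (inv t) (fstar M t a) = a"
    and nrm_fstar:
      "\<lbrakk>t \<in> carrier G; a \<in> fib M t\<rbrakk> \<Longrightarrow> nrm (fibre M (inv t)) (fstar M t a) = nrm (fibre M t) a"
    and cstar_identity:
      "\<lbrakk>t \<in> carrier G; a \<in> fib M t\<rbrakk>
       \<Longrightarrow> nrm (fibre M \<one>) (fmult M (inv t) t (fstar M t a) a) = (nrm (fibre M t) a)\<^sup>2"
    and fstar_fmult_positive:
      "\<lbrakk>t \<in> carrier G; a \<in> fib M t\<rbrakk>
       \<Longrightarrow> \<exists>b\<in>fib M \<one>. fmult M (inv t) t (fstar M t a) a = fmult M \<one> \<one> (fstar M \<one> b) b"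

text \<open>The predual of the fibre over \<open>t\<close> is \<open>F t\<close>, with duality pairing \<open>p t\<close>.\<close>

definition weakstar_fibre ::
    "('g, 'm) fell_data \<Rightarrow> ('g \<Rightarrow> 'f cnormed) \<Rightarrow> ('g \<Rightarrow> 'm \<Rightarrow> 'f \<Rightarrow> complex) \<Rightarrow> 'g \<Rightarrow> 'm topology" where
  "weakstar_fibre M F p t = weak_topology (fib M t) ((\<lambda>f m. p t m f) ` carrier (F t))"

locale wstar_fell_bundle = fell_bundle G M
  for G :: "('g, 'c) monoid_scheme" (structure) and M :: "('g, 'm::complex_vector) fell_data" +
  fixes F :: "'g \<Rightarrow> 'f::complex_vector cnormed"
    and p :: "'g \<Rightarrow> 'm \<Rightarrow> 'f \<Rightarrow> complex"
  assumes fibre_dual: "t \<in> carrier G \<Longrightarrow> is_dual (fibre M t) (F t) (p t)"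
    and fstar_weakstar:
      "t \<in> carrier G
       \<Longrightarrow> continuous_map (weakstar_fibre M F p t) (weakstar_fibre M F p (inv t)) (fstar M t)"
    and fmult_left_weakstar:
      "\<lbrakk>s \<in> carrier G; t \<in> carrier G; a \<in> fib M s\<rbrakk>
       \<Longrightarrow> continuous_map (weakstar_fibre M F p t) (weakstar_fibre M F p (s \<otimes> t))
             (\<lambda>b. fmult M s t a b)"
    and fmult_right_weakstar:
      "\<lbrakk>s \<in> carrier G; t \<in> carrier G; a \<in> fib M s\<rbrakk>
       \<Longrightarrow> continuous_map (weakstar_fibre M F p t) (weakstar_fibre M F p (t \<otimes> s))
             (\<lambda>b. fmult M t s b a)"

text \<open>A representation is given by its restrictions \<open>\<pi> t\<close> to the fibres.\<close>

locale fell_representation = fell_bundle G M + complex_hilbert X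
  for G :: "('g, 'c) monoid_scheme" (structure) and M :: "('g, 'm::complex_vector) fell_data"
    and X :: "'x::complex_vector chilb" +
  fixes \<pi> :: "'g \<Rightarrow> 'm \<Rightarrow> 'x \<Rightarrow> 'x"
  assumes rep_operator: "\<lbrakk>t \<in> carrier G; a \<in> fib M t\<rbrakk> \<Longrightarrow> \<pi> t a \<in> operators X"
    and rep_linear: "t \<in> carrier G \<Longrightarrow> linear_maps_on (fib M t) (\<pi> t)"
    and rep_mult:
      "\<lbrakk>s \<in> carrier G; t \<in> carrier G; a \<in> fib M s; b \<in> fib M t\<rbrakk>
       \<Longrightarrow> \<pi> (s \<otimes> t) (fmult M s t a b) = \<pi> s a \<circ> \<pi> t b"
    and rep_star: "\<lbrakk>t \<in> carrier G; a \<in> fib M t\<rbrakk> \<Longrightarrow> \<pi> (inv t) (fstar M t a) = adj X (\<pi> t a)"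

text \<open>Representations that are unital and, on each fibre, isometric and weak$^*$-continuous.\<close>

locale wstar_representation = wstar_fell_bundle G M F p + fell_representation G M X \<pi>
  for G :: "('g, 'c) monoid_scheme" (structure) and M :: "('g, 'm::complex_vector) fell_data"
    and F :: "'g \<Rightarrow> 'f::complex_vector cnormed" and p :: "'g \<Rightarrow> 'm \<Rightarrow> 'f \<Rightarrow> complex"
    and X :: "'x::complex_vector chilb" and \<pi> :: "'g \<Rightarrow> 'm \<Rightarrow> 'x \<Rightarrow> 'x" +
  assumes rep_unital:
      "\<exists>e\<in>fib M \<one>. (\<forall>a\<in>fib M \<one>. fmult M \<one> \<one> e a = a \<and> fmult M \<one> \<one> a e = a) \<and> \<pi> \<one> e = id_op X"
    and rep_isometric:
      "\<lbrakk>t \<in> carrier G; a \<in> fib M t\<rbrakk> \<Longrightarrow> op_norm X X (\<pi> t a) = nrm (fibre M t) a"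
    and rep_weakstar:
      "t \<in> carrier G \<Longrightarrow> continuous_map (weakstar_fibre M F p t) (weakstar_op X) (\<pi> t)"


section \<open>Kernels, cross-sectional algebras and the quotient bundle\<close>

definition kernel_algebra ::
    "('g, 'c) monoid_scheme \<Rightarrow> ('g, 'm) fell_data \<Rightarrow> 'x::complex_vector chilb
     \<Rightarrow> ('g \<Rightarrow> 'm \<Rightarrow> 'x \<Rightarrow> 'x) \<Rightarrow> (('g \<Rightarrow> 'x) \<Rightarrow> 'g \<Rightarrow> 'x) set" where
  "kernel_algebra G M X \<pi> = {T \<in> operators (ell2 (carrier G) X).
     \<forall>r\<in>carrier G. \<forall>s\<in>carrier G.
       mat_entry X T r s \<in> \<pi> (r \<otimes>\<^bsub>G\<^esub> inv\<^bsub>G\<^esub> s) ` fib M (r \<otimes>\<^bsub>G\<^esub> inv\<^bsub>G\<^esub> s)}"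

definition kernel_action ::
    "('g, 'c) monoid_scheme \<Rightarrow> 'x::complex_vector chilb
     \<Rightarrow> 'g \<Rightarrow> (('g \<Rightarrow> 'x) \<Rightarrow> 'g \<Rightarrow> 'x) \<Rightarrow> ('g \<Rightarrow> 'x) \<Rightarrow> 'g \<Rightarrow> 'x" where
  "kernel_action G X t T =
     one_tensor_rho G X t \<circ> T \<circ> adj (ell2 (carrier G) X) (one_tensor_rho G X t)"

definition kernel_fixed_points ::
    "('g, 'c) monoid_scheme \<Rightarrow> 'g set \<Rightarrow> ('g, 'm) fell_data \<Rightarrow> 'x::complex_vector chilb
     \<Rightarrow> ('g \<Rightarrow> 'm \<Rightarrow> 'x \<Rightarrow> 'x) \<Rightarrow> (('g \<Rightarrow> 'x) \<Rightarrow> 'g \<Rightarrow> 'x) set" where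
  "kernel_fixed_points G H M X \<pi> =
     {T \<in> kernel_algebra G M X \<pi>. \<forall>t\<in>H. kernel_action G X t T = T}"

text \<open>The weak$^*$-closed span of the $\pi(m)\otimes\lambda_t$ with $t \in A$ and $m \in M_t$.\<close>

definition cross_section_closure ::
    "('g, 'c) monoid_scheme \<Rightarrow> ('g, 'm) fell_data \<Rightarrow> 'x::complex_vector chilb
     \<Rightarrow> ('g \<Rightarrow> 'm \<Rightarrow> 'x \<Rightarrow> 'x) \<Rightarrow> 'g set \<Rightarrow> (('g \<Rightarrow> 'x) \<Rightarrow> 'g \<Rightarrow> 'x) set" where
  "cross_section_closure G M X \<pi> A = weakstar_op (ell2 (carrier G) X) closure_of
     complex_vector.span {tensor_lambda G X (\<pi> t m) t | t m. t \<in> A \<and> m \<in> fib M t}"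

definition reduced_wstar_algebra ::
    "('g, 'c) monoid_scheme \<Rightarrow> ('g, 'm) fell_data \<Rightarrow> 'x::complex_vector chilb
     \<Rightarrow> ('g \<Rightarrow> 'm \<Rightarrow> 'x \<Rightarrow> 'x) \<Rightarrow> (('g \<Rightarrow> 'x) \<Rightarrow> 'g \<Rightarrow> 'x) set" where
  "reduced_wstar_algebra G M X \<pi> = cross_section_closure G M X \<pi> (carrier G)"

text \<open>
  The quotient bundle is a bundle over \<open>G Mod H\<close>, whose elements are the cosets of \<open>H\<close>; its fibres
  consist of operators on $X \otimes \ell^2(G)$, on which it is represented by inclusion.
\<close>

definition quotient_bundle ::
    "('g, 'c) monoid_scheme \<Rightarrow> ('g, 'm) fell_data \<Rightarrow> 'x::complex_vector chilb
     \<Rightarrow> ('g \<Rightarrow> 'm \<Rightarrow> 'x \<Rightarrow> 'x) \<Rightarrow> ('g set, ('g \<Rightarrow> 'x) \<Rightarrow> 'g \<Rightarrow> 'x) fell_data" where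
  "quotient_bundle G M X \<pi> = \<lparr>
     fibre = (\<lambda>u. \<lparr>carrier = cross_section_closure G M X \<pi> u,
                   nrm = op_norm (ell2 (carrier G) X) (ell2 (carrier G) X)\<rparr>),
     fmult = (\<lambda>u v a b. a \<circ> b),
     fstar = (\<lambda>u. adj (ell2 (carrier G) X))\<rparr>"

abbreviation inclusion_rep :: "'u \<Rightarrow> ('v \<Rightarrow> 'v) \<Rightarrow> 'v \<Rightarrow> 'v" where
  "inclusion_rep \<equiv> (\<lambda>u a. a)"

text \<open>
  Isomorphisms of weak$^*$-closed $*$-algebras of operators: bijective $*$-homomorphisms that are
  weak$^*$-homeomorphisms. The last property is automatic, but part of the notion.
\<close>

definition wstar_isomorphism ::
    "'v::complex_vector chilb \<Rightarrow> ('v \<Rightarrow> 'v) set \<Rightarrow> 'w::complex_vector chilb \<Rightarrow> ('w \<Rightarrow> 'w) set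
     \<Rightarrow> (('v \<Rightarrow> 'v) \<Rightarrow> ('w \<Rightarrow> 'w)) \<Rightarrow> bool" where
  "wstar_isomorphism K A L B \<mu> \<longleftrightarrow> bij_betw \<mu> A B \<and> linear_maps_on A \<mu> \<and>
     (\<forall>S\<in>A. \<forall>T\<in>A. \<mu> (S \<circ> T) = \<mu> S \<circ> \<mu> T) \<and>
     (\<forall>S\<in>A. \<mu> (adj K S) = adj L (\<mu> S)) \<and>
     homeomorphic_map (subtopology (weakstar_op K) A) (subtopology (weakstar_op L) B) \<mu>"

end

theory Submission
  imports Defs
begin

text \<open>
  Write $K = X \otimes \ell^2(G)$ and $L = K \otimes \ell^2(G/H)$. An operator $S$ on $L$ has entries
  $S_{(u,a),(v,b)} \in \mathbb{B}(X)$ indexed by pairs of a coset and an element of $G$. Choose a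
  representative $t_c$ of each coset $c$, the unit for $H$ itself, and re-index the basis by the permutation
  $(c, r) \mapsto (rH, r t_c^{-1})$ of $G/H \times G$. If $S$ is a kernel of the quotient bundle, then the
  entry of $S$ at $((u,a),(v,b))$ lies in $\pi(M_{ab^{-1}})$, is unchanged when $a$ and $b$ are multiplied on
  the right by the same element of $G$, and vanishes unless $ab^{-1} \in uv^{-1}$. The last two properties
  say exactly that the re-indexed operator is block diagonal with all blocks equal to one operator
  $\mu(S)$ on $K$, namely $\mu(S)_{r,s} = (S_{rH,sH})_{r,s}$. Conversely, if $T$ is a kernel of the bundle
  that is fixed by $H$, then undoing the re-indexing on the amplification $T \otimes 1$ gives a kernel of the
  quotient bundle. So $\mu$ is conjugation by a unitary followed by the inverse of
  $T \mapsto T \otimes 1$, which makes it a $*$-isomorphism and a weak$^*$-homeomorphism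
  (\<open>\<mu>_isomorphism\<close>). It maps a generator $a \otimes \dot\lambda_u$ to $a$; hence it carries the
  reduced algebra of the quotient bundle onto the weak$^*$-closed span of its fibres, and this is the
  reduced algebra of the original bundle (\<open>\<mu>_reduced\<close>).

  The argument uses that the fibre $\dot M_u$, defined as a weak$^*$-closed span, consists of all
  operators on $K$ that have the right entries, are right invariant and are supported on $u$
  (\<open>coset_algebra_eq_closure\<close>). That all members of the closure are of this form requires that each
  $\pi(M_t)$ is weak$^*$-closed, a theorem of Krein-Smulian type on isometric weak$^*$-continuous images
  of dual spaces (\<open>emb_range_closed\<close>). It is derived from the Banach-Alaoglu theorem and an elementary
  minimax principle for compact convex sets (\<open>compact_minimax\<close>), which takes the place of the
  Hahn-Banach theorem. The converse inclusion is a bicommutant argument: an operator with the three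
  properties intertwines the projections onto suitable cyclic subspaces (\<open>strong_approximation\<close>).

  All this rests on elementary Hilbert space theory for spaces given by a carrier: the Riesz
  representation theorem yields adjoints and projections, and $\ell^2(I;X)$ is complete.
\<close>

section \<open>Inner product spaces\<close>

text \<open>Completeness is left out, so that the Cauchy-Schwarz inequality is available for $\ell^2(I;X)$
  before that space is known to be complete.\<close>

locale pre_hilbert =
  fixes X :: "('v::complex_vector, 'b) chilb_scheme"
  assumes carrier_subspace: "complex_vector.subspace (carrier X)"
    and nrm_ge_0: "x \<in> carrier X \<Longrightarrow> 0 \<le> nrm X x"
    and nrm0D: "\<lbrakk>x \<in> carrier X; nrm X x = 0\<rbrakk> \<Longrightarrow> x = 0"
    and ip_add_left:
      "\<lbrakk>x \<in> carrier X; y \<in> carrier X; z \<in> carrier X\<rbrakk>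
       \<Longrightarrow> cinner X (x + y) z = cinner X x z + cinner X y z"
    and ip_scale_left:
      "\<lbrakk>x \<in> carrier X; y \<in> carrier X\<rbrakk> \<Longrightarrow> cinner X (c *\<^sub>C x) y = c * cinner X x y"
    and ip_commute: "\<lbrakk>x \<in> carrier X; y \<in> carrier X\<rbrakk> \<Longrightarrow> cinner X x y = cnj (cinner X y x)"
    and ip_self: "x \<in> carrier X \<Longrightarrow> cinner X x x = complex_of_real ((nrm X x)\<^sup>2)"
begin

lemma zero_in [simp]: "0 \<in> carrier X"
  using carrier_subspace by (rule complex_vector.subspace_0)

lemma add_in [simp]: "\<lbrakk>x \<in> carrier X; y \<in> carrier X\<rbrakk> \<Longrightarrow> x + y \<in> carrier X"
  using carrier_subspace by (rule complex_vector.subspace_add)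

lemma diff_in [simp]: "\<lbrakk>x \<in> carrier X; y \<in> carrier X\<rbrakk> \<Longrightarrow> x - y \<in> carrier X"
  using carrier_subspace by (rule complex_vector.subspace_diff)

lemma scale_in [simp]: "x \<in> carrier X \<Longrightarrow> c *\<^sub>C x \<in> carrier X"
  using carrier_subspace by (rule complex_vector.subspace_scale)

lemma minus_in [simp]: "x \<in> carrier X \<Longrightarrow> - x \<in> carrier X"
  using carrier_subspace by (rule complex_vector.subspace_neg)

lemma ip_minus_left:
  "\<lbrakk>x \<in> carrier X; y \<in> carrier X\<rbrakk> \<Longrightarrow> cinner X (- x) y = - cinner X x y"
  using ip_scale_left[of x y "- 1"] by (simp add: scaleC_one)

lemma ip_diff_left:
  "\<lbrakk>x \<in> carrier X; y \<in> carrier X; z \<in> carrier X\<rbrakk>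
   \<Longrightarrow> cinner X (x - y) z = cinner X x z - cinner X y z"
  using ip_add_left[of x "- y" z] ip_minus_left[of y z] by simp

lemma ip_zero_left [simp]: "x \<in> carrier X \<Longrightarrow> cinner X 0 x = 0"
  using ip_scale_left[of 0 x 0] by simp

lemma ip_zero_right [simp]: "x \<in> carrier X \<Longrightarrow> cinner X x 0 = 0"
  using ip_commute[of x 0] by simp

lemma ip_add_right:
  "\<lbrakk>x \<in> carrier X; y \<in> carrier X; z \<in> carrier X\<rbrakk>
   \<Longrightarrow> cinner X x (y + z) = cinner X x y + cinner X x z"
  using ip_commute[of x "y + z"] ip_commute[of x y] ip_commute[of x z] by (simp add: ip_add_left)

lemma ip_diff_right:
  "\<lbrakk>x \<in> carrier X; y \<in> carrier X; z \<in> carrier X\<rbrakk>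
   \<Longrightarrow> cinner X x (y - z) = cinner X x y - cinner X x z"
  using ip_commute[of x "y - z"] ip_commute[of x y] ip_commute[of x z] by (simp add: ip_diff_left)

lemma ip_scale_right:
  "\<lbrakk>x \<in> carrier X; y \<in> carrier X\<rbrakk> \<Longrightarrow> cinner X x (c *\<^sub>C y) = cnj c * cinner X x y"
  using ip_commute[of x "c *\<^sub>C y"] ip_commute[of x y] by (simp add: ip_scale_left)

lemma nrm_sq: "x \<in> carrier X \<Longrightarrow> (nrm X x)\<^sup>2 = Re (cinner X x x)"
  by (simp add: ip_self)

lemma nrm_eqI: "\<lbrakk>x \<in> carrier X; 0 \<le> c; Re (cinner X x x) = c\<^sup>2\<rbrakk> \<Longrightarrow> nrm X x = c"
  using nrm_sq nrm_ge_0 by (metis power2_eq_imp_eq)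

lemma nrm_zero [simp]: "nrm X 0 = 0"
  by (rule nrm_eqI) simp_all

lemma nrm_scale: "x \<in> carrier X \<Longrightarrow> nrm X (c *\<^sub>C x) = cmod c * nrm X x"
proof (rule nrm_eqI)
  assume x: "x \<in> carrier X"
  have "cinner X (c *\<^sub>C x) (c *\<^sub>C x) = (c * cnj c) * cinner X x x"
    using x by (simp add: ip_scale_left ip_scale_right)
  also have "\<dots> = complex_of_real ((cmod c * nrm X x)\<^sup>2)"
    using x by (simp add: ip_self complex_norm_square[symmetric] power_mult_distrib)
  finally show "Re (cinner X (c *\<^sub>C x) (c *\<^sub>C x)) = (cmod c * nrm X x)\<^sup>2"
    by (metis Re_complex_of_real)
qed (simp_all add: nrm_ge_0)

lemma nrm_minus: "x \<in> carrier X \<Longrightarrow> nrm X (- x) = nrm X x"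
  using nrm_scale[of x "- 1"] by (simp add: scaleC_one)

lemma nrm_diff_commute: "\<lbrakk>x \<in> carrier X; y \<in> carrier X\<rbrakk> \<Longrightarrow> nrm X (x - y) = nrm X (y - x)"
  using nrm_minus[of "x - y"] by simp

lemma nrm_add_sq:
  assumes "x \<in> carrier X" "y \<in> carrier X"
  shows "(nrm X (x + y))\<^sup>2 = (nrm X x)\<^sup>2 + (nrm X y)\<^sup>2 + 2 * Re (cinner X x y)"
proof -
  have "Re (cinner X y x) = Re (cinner X x y)"
    using ip_commute[OF assms] by simp
  then show ?thesis
    using assms by (simp add: nrm_sq ip_add_left ip_add_right)
qed

lemma nrm_diff_sq:
  assumes "x \<in> carrier X" "y \<in> carrier X"
  shows "(nrm X (x - y))\<^sup>2 = (nrm X x)\<^sup>2 + (nrm X y)\<^sup>2 - 2 * Re (cinner X x y)"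
proof -
  have "Re (cinner X y x) = Re (cinner X x y)"
    using ip_commute[OF assms] by simp
  then show ?thesis
    using assms by (simp add: nrm_sq ip_diff_left ip_diff_right)
qed

lemma Re_cauchy_schwarz:
  assumes x: "x \<in> carrier X" and y: "y \<in> carrier X"
  shows "Re (cinner X x y) \<le> nrm X x * nrm X y"
proof (cases "nrm X x = 0 \<or> nrm X y = 0")
  case True
  then have "x = 0 \<or> y = 0" using x y nrm0D by blast
  then show ?thesis using x y by (auto simp: True)
next
  case False
  then have p: "nrm X x > 0" "nrm X y > 0" using x y nrm_ge_0 by (simp_all add: less_le)
  define a where "a = nrm X x"
  define b where "b = nrm X y"
  have "0 \<le> (nrm X (complex_of_real b *\<^sub>C x - complex_of_real a *\<^sub>C y))\<^sup>2" by simp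
  also have "\<dots> = 2 * (a * b)\<^sup>2 - 2 * (a * b) * Re (cinner X x y)"
    using x y p
    by (simp add: nrm_diff_sq nrm_scale ip_scale_left ip_scale_right a_def b_def
        power_mult_distrib mult_ac)
  finally have "(a * b) * Re (cinner X x y) \<le> (a * b) * (a * b)"
    by (simp add: power2_eq_square)
  then show ?thesis
    using p by (simp add: a_def b_def)
qed

lemma cauchy_schwarz:
  assumes x: "x \<in> carrier X" and y: "y \<in> carrier X"
  shows "cmod (cinner X x y) \<le> nrm X x * nrm X y"
proof (cases "cinner X x y = 0")
  case True
  then show ?thesis using nrm_ge_0[OF x] nrm_ge_0[OF y] by simp
next
  case False
  define c where "c = cnj (cinner X x y) / cmod (cinner X x y)"
  have "cmod c = 1" using False by (simp add: c_def norm_divide)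
  have "c * cinner X x y = complex_of_real (cmod (cinner X x y))"
    using False complex_norm_square[of "cinner X x y"]
    by (simp add: c_def field_simps power2_eq_square)
  then have "cmod (cinner X x y) = Re (cinner X (c *\<^sub>C x) y)"
    using x y by (simp add: ip_scale_left)
  also have "\<dots> \<le> nrm X x * nrm X y"
    using Re_cauchy_schwarz[of "c *\<^sub>C x" y] x y \<open>cmod c = 1\<close> by (simp add: nrm_scale)
  finally show ?thesis .
qed

lemma nrm_triangle_ineq:
  assumes x: "x \<in> carrier X" and y: "y \<in> carrier X"
  shows "nrm X (x + y) \<le> nrm X x + nrm X y"
proof (rule power2_le_imp_le)
  show "(nrm X (x + y))\<^sup>2 \<le> (nrm X x + nrm X y)\<^sup>2"
    using Re_cauchy_schwarz[OF x y] x y by (simp add: nrm_add_sq power2_sum)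
qed (simp add: nrm_ge_0 x y)

lemma nrm_diff_triangle:
  assumes "x \<in> carrier X" "y \<in> carrier X" "z \<in> carrier X"
  shows "nrm X (x - z) \<le> nrm X (x - y) + nrm X (y - z)"
  using nrm_triangle_ineq[of "x - y" "y - z"] assms by simp

lemma nrm_add_sq_le:
  assumes "x \<in> carrier X" "y \<in> carrier X"
  shows "(nrm X (x + y))\<^sup>2 \<le> 2 * (nrm X x)\<^sup>2 + 2 * (nrm X y)\<^sup>2"
  using nrm_add_sq[OF assms] nrm_diff_sq[OF assms] zero_le_power2[of "nrm X (x - y)"] by linarith

lemma ip_eq_imp_eq:
  assumes "x \<in> carrier X" "y \<in> carrier X" "\<And>z. z \<in> carrier X \<Longrightarrow> cinner X x z = cinner X y z"
  shows "x = y"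
proof -
  have "(nrm X (x - y))\<^sup>2 = 0"
    using assms by (simp add: nrm_sq ip_diff_left)
  then show ?thesis using assms nrm0D[of "x - y"] by simp
qed

lemma ip_eq_imp_eq_right:
  assumes "x \<in> carrier X" "y \<in> carrier X" "\<And>z. z \<in> carrier X \<Longrightarrow> cinner X z x = cinner X z y"
  shows "x = y"
  using assms by (intro ip_eq_imp_eq) (metis ip_commute)+

lemma complex_hilbertI:
  assumes "\<And>s :: nat \<Rightarrow> 'v. \<lbrakk>\<And>n. s n \<in> carrier X;
        \<And>e. e > 0 \<Longrightarrow> \<exists>N. \<forall>m\<ge>N. \<forall>n\<ge>N. nrm X (s m - s n) < e\<rbrakk>
       \<Longrightarrow> \<exists>l\<in>carrier X. (\<lambda>n. nrm X (s n - l)) \<longlonglongrightarrow> 0"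
  shows "complex_hilbert X"
  by standard
    (use assms in \<open>auto simp: carrier_subspace nrm_ge_0 nrm_scale nrm_triangle_ineq ip_add_left ip_scale_left ip_self
        intro: nrm0D ip_commute\<close>)

end

sublocale complex_hilbert \<subseteq> pre_hilbert
  by standard
    (use nrm_eq_0 in \<open>auto simp: subspace nrm_nonneg cinner_add_left cinner_scaleC_left cinner_self
        intro: cinner_commute\<close>)


section \<open>The Riesz representation theorem, adjoints and projections\<close>

context complex_hilbert
begin

text \<open>Minimise $\|x\|^2 - 2\,\mathrm{Re}\,\varphi(x)$. By the parallelogram law, minimising sequences are
  Cauchy, and the vanishing of the first variation at the minimum is the required identity.\<close>

lemma riesz:
  assumes add: "\<And>x y. \<lbrakk>x \<in> carrier X; y \<in> carrier X\<rbrakk> \<Longrightarrow> \<phi> (x + y) = \<phi> x + \<phi> y"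
    and scl: "\<And>c x. x \<in> carrier X \<Longrightarrow> \<phi> (c *\<^sub>C x) = c * \<phi> x"
    and bd: "\<And>x. x \<in> carrier X \<Longrightarrow> cmod (\<phi> x) \<le> B * nrm X x"
  shows "\<exists>z\<in>carrier X. \<forall>x\<in>carrier X. \<phi> x = cinner X x z"
proof -
  define q where "q x = (nrm X x)\<^sup>2 - 2 * Re (\<phi> x)" for x
  have q_lower: "q x \<ge> - B\<^sup>2" if "x \<in> carrier X" for x
  proof -
    have "Re (\<phi> x) \<le> B * nrm X x"
      using bd[OF that] complex_Re_le_cmod[of "\<phi> x"] by linarith
    moreover have "0 \<le> (nrm X x - B)\<^sup>2" by simp
    ultimately show ?thesis
      unfolding q_def power2_diff by (simp add: mult.commute)
  qed
  define m where "m = Inf (q ` carrier X)"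
  have bdd: "bdd_below (q ` carrier X)"
    using q_lower by (intro bdd_belowI2) auto
  have m_le: "m \<le> q x" if "x \<in> carrier X" for x
    unfolding m_def using bdd that by (rule cINF_lower)
  have "\<exists>x\<in>carrier X. q x < m + 1 / Suc n" for n
  proof -
    have "q ` carrier X \<noteq> {}" using zero_in by blast
    then show ?thesis
      using cInf_less_iff[of "q ` carrier X" "m + 1 / Suc n"] bdd unfolding m_def by auto
  qed
  then obtain s where s: "\<And>n. s n \<in> carrier X" "\<And>n. q (s n) < m + 1 / Suc n"
    by metis
  have close: "(nrm X (x - y))\<^sup>2 \<le> 2 * (q x - m) + 2 * (q y - m)"
    if x: "x \<in> carrier X" and y: "y \<in> carrier X" for x y
  proof -
    define h where "h = (1/2 :: complex) *\<^sub>C (x + y)"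
    have h: "h \<in> carrier X" using x y by (simp add: h_def)
    have "(nrm X h)\<^sup>2 = (1/4) * (nrm X (x + y))\<^sup>2"
      using x y by (simp add: h_def nrm_scale norm_divide power_mult_distrib power_divide)
    moreover have "Re (\<phi> h) = (Re (\<phi> x) + Re (\<phi> y)) / 2"
      using x y by (simp add: h_def scl add)
    ultimately have "q h = (1/4) * (nrm X (x + y))\<^sup>2 - Re (\<phi> x) - Re (\<phi> y)"
      unfolding q_def by argo
    moreover have "(nrm X (x + y))\<^sup>2 = 2 * (nrm X x)\<^sup>2 + 2 * (nrm X y)\<^sup>2 - (nrm X (x - y))\<^sup>2"
      using x y by (simp add: nrm_add_sq nrm_diff_sq)
    ultimately show ?thesis
      using m_le[OF h] unfolding q_def by (simp add: field_simps)
  qed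
  have sd: "(nrm X (s i - s j))\<^sup>2 \<le> 4 * (1 / Suc N)" if "i \<ge> N" "j \<ge> N" for i j N
  proof -
    have "1 / Suc i \<le> (1 / Suc N :: real)" "1 / Suc j \<le> (1 / Suc N :: real)"
      using that by (simp_all add: frac_le)
    then show ?thesis
      using close[OF s(1) s(1), of i j] s(2)[of i] s(2)[of j] by argo
  qed
  have "\<exists>N. \<forall>i\<ge>N. \<forall>j\<ge>N. nrm X (s i - s j) < e" if "e > 0" for e
  proof -
    obtain N where N: "4 / e\<^sup>2 < real N" using reals_Archimedean2 by blast
    have "4 * (1 / Suc N) < e\<^sup>2"
      using N that by (simp add: field_simps) (smt (verit, best) zero_less_power)
    then have "nrm X (s i - s j) < e" if "i \<ge> N" "j \<ge> N" for i j
      using sd[OF that] \<open>e > 0\<close> by (smt (verit) power2_le_imp_le power_mono)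
    then show ?thesis by blast
  qed
  then obtain l where l: "l \<in> carrier X" and lim: "(\<lambda>n. nrm X (s n - l)) \<longlonglongrightarrow> 0"
    using complete[of s] s(1) by blast
  have ql: "q l \<le> m"
  proof (rule LIMSEQ_le_const)
    have Bnn: "0 \<le> \<bar>B\<bar>" by simp
    show "(\<lambda>n. m + 1 / Suc n + (nrm X (s n - l))\<^sup>2 + 2 * nrm X (s n - l) * (nrm X l + \<bar>B\<bar>)) \<longlonglongrightarrow> m"
      by (rule tendsto_eq_intros LIMSEQ_inverse_real_of_nat[unfolded inverse_eq_divide] lim refl)+ simp
    have "q l \<le> m + 1 / Suc n + (nrm X (s n - l))\<^sup>2 + 2 * nrm X (s n - l) * (nrm X l + \<bar>B\<bar>)" for n
    proof -
      define d where "d = s n - l"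
      have d: "d \<in> carrier X" using s l by (simp add: d_def)
      have sn: "s n = l + d" by (simp add: d_def)
      have "q (s n) = q l + (nrm X d)\<^sup>2 + 2 * Re (cinner X l d) - 2 * Re (\<phi> d)"
        unfolding sn q_def using l d by (simp add: nrm_add_sq add)
      moreover have "\<bar>Re (cinner X l d)\<bar> \<le> nrm X l * nrm X d"
        using cauchy_schwarz[OF l d] abs_Re_le_cmod[of "cinner X l d"] by linarith
      moreover have "\<bar>Re (\<phi> d)\<bar> \<le> \<bar>B\<bar> * nrm X d"
        using bd[OF d] abs_Re_le_cmod[of "\<phi> d"] nrm_ge_0[OF d]
        by (smt (verit) mult_right_mono)
      moreover have "2 * nrm X d * (nrm X l + \<bar>B\<bar>) = 2 * (nrm X l * nrm X d) + 2 * (\<bar>B\<bar> * nrm X d)"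
        by (simp add: algebra_simps)
      moreover have "0 \<le> (nrm X d)\<^sup>2" by simp
      ultimately show ?thesis
        using s(2)[of n] unfolding d_def[symmetric] by linarith
    qed
    then show "\<exists>N. \<forall>n\<ge>N. q l \<le> m + 1 / Suc n + (nrm X (s n - l))\<^sup>2 + 2 * nrm X (s n - l) * (nrm X l + \<bar>B\<bar>)"
      by blast
  qed
  have Re_eq: "Re (\<phi> x) \<le> Re (cinner X x l)" if x: "x \<in> carrier X" for x
  proof (rule ccontr)
    define D where "D = Re (\<phi> x) - Re (cinner X x l)"
    assume "\<not> ?thesis"
    then have D: "D > 0" by (simp add: D_def)
    define N where "N = (nrm X x)\<^sup>2 + 1"
    have N: "N > 0" by (simp add: N_def add_nonneg_pos)
    define t where "t = D / N"
    have t: "t > 0" using D N by (simp add: t_def)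
    have cl: "Re (cinner X l x) = Re (cinner X x l)" using ip_commute[OF x l] by simp
    have "q (l + complex_of_real t *\<^sub>C x) = q l + t\<^sup>2 * (nrm X x)\<^sup>2 - 2 * t * D"
      using x l by (simp add: q_def nrm_add_sq add scl nrm_scale ip_scale_right cl
          power_mult_distrib D_def algebra_simps)
    also have "\<dots> \<le> q l + t\<^sup>2 * N - 2 * t * D" by (simp add: N_def algebra_simps)
    also have "\<dots> = q l - t * D"
      using N by (simp add: t_def power2_eq_square)
    also have "\<dots> < q l" using t D by simp
    finally show False
      using m_le[of "l + complex_of_real t *\<^sub>C x"] ql x l by simp
  qed
  have "\<phi> x = cinner X x l" if x: "x \<in> carrier X" for x
  proof -
    have R: "Re (\<phi> (c *\<^sub>C x)) \<le> Re (cinner X (c *\<^sub>C x) l)" for c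
      using Re_eq[of "c *\<^sub>C x"] x by simp
    have "Re (c * \<phi> x) \<le> Re (c * cinner X x l)" for c
      using R[of c] x l by (simp add: scl ip_scale_left)
    from this[of 1] this[of "-1"] this[of \<i>] this[of "- \<i>"]
    show ?thesis by (simp add: complex_eq_iff)
  qed
  with l show ?thesis by blast
qed

end

section \<open>Bounded operators\<close>

context pre_hilbert
begin

lemma op_closed: "\<lbrakk>T \<in> operators X; x \<in> carrier X\<rbrakk> \<Longrightarrow> T x \<in> carrier X"
  by (auto simp: operators_def bounded_linear_on_def)

lemma op_outside: "\<lbrakk>T \<in> operators X; x \<notin> carrier X\<rbrakk> \<Longrightarrow> T x = 0"
  by (auto simp: operators_def)

lemma op_in: "T \<in> operators X \<Longrightarrow> T x \<in> carrier X"
  using op_closed[of T x] op_outside[of T x] zero_in by metis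

lemma op_add: "\<lbrakk>T \<in> operators X; x \<in> carrier X; y \<in> carrier X\<rbrakk> \<Longrightarrow> T (x + y) = T x + T y"
  by (auto simp: operators_def bounded_linear_on_def linear_maps_on_def)

lemma op_scale: "\<lbrakk>T \<in> operators X; x \<in> carrier X\<rbrakk> \<Longrightarrow> T (c *\<^sub>C x) = c *\<^sub>C T x"
  by (auto simp: operators_def bounded_linear_on_def linear_maps_on_def)

lemma op_zero: "T \<in> operators X \<Longrightarrow> T 0 = 0"
  using op_scale[of T 0 0] by simp

lemma op_diff: "\<lbrakk>T \<in> operators X; x \<in> carrier X; y \<in> carrier X\<rbrakk> \<Longrightarrow> T (x - y) = T x - T y"
  using op_add[of T "x - y" y] by simp

lemma op_bound:
  assumes "T \<in> operators X"
  obtains B where "0 \<le> B" "\<And>x. x \<in> carrier X \<Longrightarrow> nrm X (T x) \<le> B * nrm X x"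
proof -
  obtain B where B: "\<And>x. x \<in> carrier X \<Longrightarrow> nrm X (T x) \<le> B * nrm X x"
    using assms by (auto simp: operators_def bounded_linear_on_def)
  have "nrm X (T x) \<le> max B 0 * nrm X x" if "x \<in> carrier X" for x
    using B[OF that] nrm_ge_0[OF that] by (smt (verit) max.cobounded1 mult_right_mono)
  with that[of "max B 0"] show ?thesis by simp
qed

lemma operatorsI:
  assumes "\<And>x. x \<in> carrier X \<Longrightarrow> T x \<in> carrier X"
    and "\<And>x y. \<lbrakk>x \<in> carrier X; y \<in> carrier X\<rbrakk> \<Longrightarrow> T (x + y) = T x + T y"
    and "\<And>c x. x \<in> carrier X \<Longrightarrow> T (c *\<^sub>C x) = c *\<^sub>C T x"
    and "\<And>x. x \<in> carrier X \<Longrightarrow> nrm X (T x) \<le> B * nrm X x"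
    and "\<And>x. x \<notin> carrier X \<Longrightarrow> T x = 0"
  shows "T \<in> operators X"
  unfolding operators_def bounded_linear_on_def linear_maps_on_def
  using assms(1-3,5) by (auto intro!: exI[of _ B] assms(4))

lemma op_eqI:
  assumes "S \<in> operators X" "T \<in> operators X" "\<And>x. x \<in> carrier X \<Longrightarrow> S x = T x"
  shows "S = T"
proof
  fix x show "S x = T x"
    using assms(3)[of x] op_outside[OF assms(1), of x] op_outside[OF assms(2), of x] by metis
qed

lemma op_weak_eqI:
  assumes "S \<in> operators X" "T \<in> operators X"
    "\<And>x y. \<lbrakk>x \<in> carrier X; y \<in> carrier X\<rbrakk> \<Longrightarrow> cinner X (S x) y = cinner X (T x) y"
  shows "S = T"
  using assms by (intro op_eqI ip_eq_imp_eq op_in)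

lemma op_zero_in [simp]: "0 \<in> operators X"
  by (rule operatorsI[where B = 0]) auto

lemma op_plus_in:
  assumes S: "S \<in> operators X" and T: "T \<in> operators X"
  shows "S + T \<in> operators X"
proof -
  obtain B where B: "\<And>x. x \<in> carrier X \<Longrightarrow> nrm X (S x) \<le> B * nrm X x" using op_bound[OF S] by blast
  obtain C where C: "\<And>x. x \<in> carrier X \<Longrightarrow> nrm X (T x) \<le> C * nrm X x" using op_bound[OF T] by blast
  have "nrm X (S x + T x) \<le> (B + C) * nrm X x" if "x \<in> carrier X" for x
    using nrm_triangle_ineq[OF op_in[OF S] op_in[OF T], of x x] B[OF that] C[OF that]
    by (simp add: algebra_simps)
  then show ?thesis
    by (intro operatorsI[where B = "B + C"])
      (simp_all add: op_in[OF S] op_in[OF T] op_add[OF S] op_add[OF T] op_scale[OF S] op_scale[OF T]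
        op_outside[OF S] op_outside[OF T] scaleC_add_right)
qed

lemma op_scaleC_in:
  assumes S: "S \<in> operators X"
  shows "c *\<^sub>C S \<in> operators X"
proof -
  obtain B where B: "\<And>x. x \<in> carrier X \<Longrightarrow> nrm X (S x) \<le> B * nrm X x" using op_bound[OF S] by blast
  have "nrm X (c *\<^sub>C S x) \<le> (cmod c * B) * nrm X x" if "x \<in> carrier X" for x
    using B[OF that] by (simp add: op_in[OF S] nrm_scale mult.assoc mult_left_mono)
  then show ?thesis
    by (intro operatorsI[where B = "cmod c * B"])
      (simp_all add: op_in[OF S] op_add[OF S] op_scale[OF S] op_outside[OF S] scaleC_add_right
        scaleC_fun_def scaleC_scaleC mult.commute)
qed

lemma op_subspace: "complex_vector.subspace (operators X)"
  by (rule complex_vector.subspaceI) (auto simp: op_plus_in op_scaleC_in)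

lemma op_comp_in:
  assumes S: "S \<in> operators X" and T: "T \<in> operators X"
  shows "S \<circ> T \<in> operators X"
proof -
  obtain B where B: "0 \<le> B" "\<And>x. x \<in> carrier X \<Longrightarrow> nrm X (S x) \<le> B * nrm X x"
    using op_bound[OF S] by blast
  obtain C where C: "\<And>x. x \<in> carrier X \<Longrightarrow> nrm X (T x) \<le> C * nrm X x" using op_bound[OF T] by blast
  have "nrm X (S (T x)) \<le> (B * C) * nrm X x" if "x \<in> carrier X" for x
    using B(2)[OF op_in[OF T], of x] mult_left_mono[OF C[OF that] B(1)] by (simp add: mult.assoc)
  then show ?thesis
    by (intro operatorsI[where B = "B * C"])
      (simp_all add: op_in[OF S] op_in[OF T] op_add[OF S] op_add[OF T] op_scale[OF S] op_scale[OF T]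
        op_outside[OF T] op_zero[OF S])
qed

lemma op_norm_bound:
  assumes T: "T \<in> operators X" and x: "x \<in> carrier X"
  shows "nrm X (T x) \<le> op_norm X X T * nrm X x"
proof (cases "x = 0")
  case True
  then show ?thesis using op_zero[OF T] by simp
next
  case False
  then have p: "nrm X x > 0" using nrm0D[OF x] nrm_ge_0[OF x] by (auto simp: less_le)
  obtain B where B: "0 \<le> B" "\<And>x. x \<in> carrier X \<Longrightarrow> nrm X (T x) \<le> B * nrm X x"
    using op_bound[OF T] by blast
  define z where "z = complex_of_real (1 / nrm X x) *\<^sub>C x"
  have z: "z \<in> carrier X" "nrm X z \<le> 1" using x p by (simp_all add: z_def nrm_scale norm_divide)
  have "nrm X (T z) \<le> op_norm X X T"
    unfolding op_norm_def
  proof (rule cSUP_upper)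
    show "bdd_above ((\<lambda>x. nrm X (T x)) ` {x \<in> carrier X. nrm X x \<le> 1})"
    proof (rule bdd_aboveI2)
      fix y assume "y \<in> {x \<in> carrier X. nrm X x \<le> 1}"
      then have "y \<in> carrier X" "nrm X y \<le> 1" by auto
      then show "nrm X (T y) \<le> B" using B(2)[of y] mult_left_mono[OF _ B(1), of "nrm X y" 1] by simp
    qed
  qed (use z in auto)
  moreover have "T z = complex_of_real (1 / nrm X x) *\<^sub>C T x" using x by (simp add: z_def op_scale[OF T])
  ultimately show ?thesis using p by (simp add: op_in[OF T] nrm_scale norm_divide field_simps)
qed

lemma op_norm_leI:
  assumes "\<And>x. \<lbrakk>x \<in> carrier X; nrm X x \<le> 1\<rbrakk> \<Longrightarrow> nrm X (T x) \<le> B"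
  shows "op_norm X X T \<le> B"
  unfolding op_norm_def
proof (rule cSUP_least)
  show "{x \<in> carrier X. nrm X x \<le> 1} \<noteq> {}" using zero_in nrm_zero by (metis (mono_tags, lifting) empty_iff mem_Collect_eq zero_le_one)
qed (use assms in auto)

lemma op_norm_nonneg: "T \<in> operators X \<Longrightarrow> 0 \<le> op_norm X X T"
  unfolding op_norm_def
proof -
  assume T: "T \<in> operators X"
  obtain B where B: "0 \<le> B" "\<And>x. x \<in> carrier X \<Longrightarrow> nrm X (T x) \<le> B * nrm X x"
    using op_bound[OF T] by blast
  have "bdd_above ((\<lambda>x. nrm X (T x)) ` {x \<in> carrier X. nrm X x \<le> 1})"
    proof (rule bdd_aboveI2)
      fix y assume "y \<in> {x \<in> carrier X. nrm X x \<le> 1}"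
      then have "y \<in> carrier X" "nrm X y \<le> 1" by auto
      then show "nrm X (T y) \<le> B" using B(2)[of y] mult_left_mono[OF _ B(1), of "nrm X y" 1] by simp
    qed
  then show "0 \<le> (SUP x\<in>{x \<in> carrier X. nrm X x \<le> 1}. nrm X (T x))"
    using cSUP_upper[of 0 "{x \<in> carrier X. nrm X x \<le> 1}" "\<lambda>x. nrm X (T x)"] op_zero[OF T] by simp
qed

end

context complex_hilbert
begin

text \<open>Each value of the adjoint represents a bounded functional.\<close>

lemma adj_exists:
  assumes T: "T \<in> operators X"
  shows "\<exists>S\<in>operators X. \<forall>x\<in>carrier X. \<forall>y\<in>carrier X. cinner X (T x) y = cinner X x (S y)"
proof -
  obtain B where B: "0 \<le> B" "\<And>x. x \<in> carrier X \<Longrightarrow> nrm X (T x) \<le> B * nrm X x"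
    using op_bound[OF T] by blast
  have "\<exists>z\<in>carrier X. \<forall>x\<in>carrier X. cinner X (T x) y = cinner X x z" if y: "y \<in> carrier X" for y
  proof (rule riesz[where B = "B * nrm X y"])
    fix x assume x: "x \<in> carrier X"
    show "cmod (cinner X (T x) y) \<le> B * nrm X y * nrm X x"
      using cauchy_schwarz[OF op_in[OF T] y, of x] mult_right_mono[OF B(2)[OF x] nrm_ge_0[OF y]]
      by (simp add: mult_ac)
  qed (use y in \<open>simp_all add: op_in[OF T] op_add[OF T] op_scale[OF T] ip_add_left ip_scale_left\<close>)
  then obtain S0 where S0: "\<And>y. y \<in> carrier X \<Longrightarrow> S0 y \<in> carrier X"
    "\<And>x y. \<lbrakk>y \<in> carrier X; x \<in> carrier X\<rbrakk> \<Longrightarrow> cinner X (T x) y = cinner X x (S0 y)"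
    by metis
  define S where "S = (\<lambda>y. if y \<in> carrier X then S0 y else 0)"
  have S: "S y \<in> carrier X" "cinner X (T x) y = cinner X x (S y)"
    if "y \<in> carrier X" "x \<in> carrier X" for x y
    using S0 that by (simp_all add: S_def)
  have "S \<in> operators X"
  proof (rule operatorsI[where B = B])
    show "S x \<in> carrier X" if "x \<in> carrier X" for x using S that by blast
    show "S (x + y) = S x + S y" if "x \<in> carrier X" "y \<in> carrier X" for x y
      using that by (intro ip_eq_imp_eq_right) (simp_all add: S(1) op_in[OF T] ip_add_right flip: S(2))
    show "S (c *\<^sub>C x) = c *\<^sub>C S x" if "x \<in> carrier X" for c x
      using that by (intro ip_eq_imp_eq_right) (simp_all add: S(1) op_in[OF T] ip_scale_right flip: S(2))
    show "S x = 0" if "x \<notin> carrier X" for x using that by (simp add: S_def)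
    fix y assume y: "y \<in> carrier X"
    have Sy: "S y \<in> carrier X" using S y by blast
    have "(nrm X (S y))\<^sup>2 = Re (cinner X (T (S y)) y)"
      using S(2)[OF y Sy] Sy by (simp add: nrm_sq)
    also have "\<dots> \<le> nrm X (T (S y)) * nrm X y"
      using Re_cauchy_schwarz[OF op_in[OF T] y] .
    also have "\<dots> \<le> B * nrm X (S y) * nrm X y"
      using B(2)[OF Sy] nrm_ge_0[OF y] by (rule mult_right_mono)
    finally have "nrm X (S y) * nrm X (S y) \<le> nrm X (S y) * (B * nrm X y)"
      by (simp add: power2_eq_square mult_ac)
    then show "nrm X (S y) \<le> B * nrm X y"
      using nrm_ge_0[OF Sy] B(1) nrm_ge_0[OF y] by (cases "nrm X (S y) = 0") auto
  qed
  with S show ?thesis by blast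
qed

lemma adj_eqI:
  assumes S: "S \<in> operators X"
    and eq: "\<And>x y. \<lbrakk>x \<in> carrier X; y \<in> carrier X\<rbrakk> \<Longrightarrow> cinner X (T x) y = cinner X x (S y)"
  shows "adj X T = S"
  unfolding adj_def
proof (rule the_equality)
  show "S \<in> operators X \<and> (\<forall>x\<in>carrier X. \<forall>y\<in>carrier X. cinner X (T x) y = cinner X x (S y))"
    using S eq by blast
next
  fix S' assume S': "S' \<in> operators X \<and> (\<forall>x\<in>carrier X. \<forall>y\<in>carrier X. cinner X (T x) y = cinner X x (S' y))"
  then show "S' = S"
    using S eq by (intro op_eqI ip_eq_imp_eq_right) (auto intro: op_in)
qed

lemma
  assumes T: "T \<in> operators X"
  shows adj_in [simp]: "adj X T \<in> operators X"
    and adj_ip: "\<lbrakk>x \<in> carrier X; y \<in> carrier X\<rbrakk> \<Longrightarrow> cinner X (T x) y = cinner X x (adj X T y)"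
proof -
  obtain S where S: "S \<in> operators X"
    "\<And>x y. \<lbrakk>x \<in> carrier X; y \<in> carrier X\<rbrakk> \<Longrightarrow> cinner X (T x) y = cinner X x (S y)"
    using adj_exists[OF T] by blast
  have "adj X T = S" using S by (rule adj_eqI)
  with S show "adj X T \<in> operators X"
    "\<lbrakk>x \<in> carrier X; y \<in> carrier X\<rbrakk> \<Longrightarrow> cinner X (T x) y = cinner X x (adj X T y)"
    by simp_all
qed

text \<open>The orthogonal projection of a vector onto a closed subspace represents, on that subspace,
  the functional given by the inner product with the vector.\<close>

lemma projection_exists:
  assumes Y: "complex_vector.subspace Y" "Y \<subseteq> carrier X"
    and closed: "\<And>s l. \<lbrakk>\<And>n::nat. s n \<in> Y; l \<in> carrier X; (\<lambda>n. nrm X (s n - l)) \<longlonglongrightarrow> 0\<rbrakk> \<Longrightarrow> l \<in> Y"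
  shows "\<exists>P. P \<in> operators X \<and> (\<forall>x. P x \<in> Y) \<and> (\<forall>y\<in>Y. P y = y) \<and>
    (\<forall>x\<in>carrier X. \<forall>y\<in>Y. cinner X (x - P x) y = 0) \<and>
    (\<forall>x\<in>carrier X. \<forall>y\<in>carrier X. cinner X (P x) y = cinner X x (P y))"
proof -
  let ?Z = "X\<lparr>carrier := Y\<rparr>"
  interpret Z: pre_hilbert ?Z
    using Y by unfold_locales (auto simp: subset_iff nrm_ge_0 nrm0D ip_add_left ip_scale_left ip_self intro: ip_commute)
  have "complex_hilbert ?Z"
  proof (rule Z.complex_hilbertI)
    fix s :: "nat \<Rightarrow> _"
    assume s: "\<And>n. s n \<in> carrier ?Z"
      and c: "\<And>e. e > 0 \<Longrightarrow> \<exists>N. \<forall>m\<ge>N. \<forall>n\<ge>N. nrm ?Z (s m - s n) < e"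
    have "\<exists>l\<in>carrier X. (\<lambda>n. nrm X (s n - l)) \<longlonglongrightarrow> 0"
      using s c Y(2) by (intro complete) auto
    then show "\<exists>l\<in>carrier ?Z. (\<lambda>n. nrm ?Z (s n - l)) \<longlonglongrightarrow> 0"
      using closed s by auto
  qed
  then interpret Z: complex_hilbert ?Z .
  have "\<exists>z\<in>Y. \<forall>y\<in>Y. cinner X y x = cinner X y z" if x: "x \<in> carrier X" for x
  proof -
    have "\<exists>z\<in>carrier ?Z. \<forall>y\<in>carrier ?Z. cinner X y x = cinner ?Z y z"
    proof (rule Z.riesz[where B = "nrm X x"])
      show "cmod (cinner X y x) \<le> nrm X x * nrm ?Z y" if "y \<in> carrier ?Z" for y
        using cauchy_schwarz[of y x] that x Y by (auto simp: mult.commute)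
    qed (use x Y in \<open>auto simp: subset_iff ip_add_left ip_scale_left\<close>)
    then show ?thesis by simp
  qed
  then obtain P0 where P0: "\<And>x. x \<in> carrier X \<Longrightarrow> P0 x \<in> Y"
    "\<And>x y. \<lbrakk>x \<in> carrier X; y \<in> Y\<rbrakk> \<Longrightarrow> cinner X y x = cinner X y (P0 x)"
    by metis
  define P where "P = (\<lambda>x. if x \<in> carrier X then P0 x else 0)"
  have PY: "P x \<in> Y" for x
    using P0 Z.zero_in by (auto simp: P_def)
  then have PX: "P x \<in> carrier X" for x using Y by blast
  have YX: "y \<in> carrier X" if "y \<in> Y" for y using Y that by blast
  have P: "cinner X y (P x) = cinner X y x" if "x \<in> carrier X" "y \<in> Y" for x y
    using P0 that by (simp add: P_def)
  have orth: "cinner X (x - P x) y = 0" if "x \<in> carrier X" "y \<in> Y" for x y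
    using P[OF that] that YX PX ip_commute[of y x] ip_commute[of y "P x"] by (simp add: ip_diff_left)
  have uniq: "P x = z" if "x \<in> carrier X" "z \<in> Y" "\<And>y. y \<in> Y \<Longrightarrow> cinner X y x = cinner X y z" for x z
    using Z.ip_eq_imp_eq_right[of "P x" z] that P PY by simp
  have sa: "cinner X (P x) y = cinner X x (P y)" if x: "x \<in> carrier X" and y: "y \<in> carrier X" for x y
  proof -
    have "cinner X (P x) y = cinner X (P x) (P y)" using P[OF y PY] by simp
    also have "\<dots> = cinner X x (P y)" using orth[OF x PY, of y] x PX by (simp add: ip_diff_left)
    finally show ?thesis .
  qed
  have "P \<in> operators X"
  proof (rule operatorsI[where B = 1])
    show "P x \<in> carrier X" for x by (rule PX)
    show "P (x + y) = P x + P y" if "x \<in> carrier X" "y \<in> carrier X" for x y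
      using that PX P PY YX Z.add_in[of "P x" "P y"]
      by (intro uniq) (simp_all add: ip_add_right)
    show "P (c *\<^sub>C x) = c *\<^sub>C P x" if "x \<in> carrier X" for x c
      using that PX P PY YX Z.scale_in[of "P x" c]
      by (intro uniq) (simp_all add: ip_scale_right)
    show "P x = 0" if "x \<notin> carrier X" for x using that by (simp add: P_def)
    fix x assume x: "x \<in> carrier X"
    have "(nrm X (P x))\<^sup>2 = Re (cinner X (P x) x)" using P[OF x PY] PX by (simp add: nrm_sq)
    also have "\<dots> \<le> nrm X (P x) * nrm X x" using Re_cauchy_schwarz PX x by blast
    finally show "nrm X (P x) \<le> 1 * nrm X x"
      using nrm_ge_0[OF PX, of x] nrm_ge_0[OF x] by (cases "nrm X (P x) = 0") (auto simp: power2_eq_square)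
  qed
  moreover have "P y = y" if "y \<in> Y" for y using uniq that YX by blast
  ultimately show ?thesis using PY orth sa by (intro exI[of _ P]) simp
qed

end


section \<open>Direct sums of copies of a Hilbert space\<close>

lemma ell2_carrier: "f \<in> carrier (ell2 I X) \<longleftrightarrow>
   (\<forall>i\<in>I. f i \<in> carrier X) \<and> (\<forall>i. i \<notin> I \<longrightarrow> f i = 0) \<and> (\<lambda>i. (nrm X (f i))\<^sup>2) summable_on I"
  by (simp add: ell2_def)

lemma ell2_nrm: "nrm (ell2 I X) f = sqrt (\<Sum>\<^sub>\<infinity>i\<in>I. (nrm X (f i))\<^sup>2)"
  by (simp add: ell2_def)

lemma ell2_nrm_sq: "(nrm (ell2 I X) f)\<^sup>2 = (\<Sum>\<^sub>\<infinity>i\<in>I. (nrm X (f i))\<^sup>2)"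
  by (simp add: ell2_nrm infsum_nonneg)

lemma ell2_cinner: "cinner (ell2 I X) f g = (\<Sum>\<^sub>\<infinity>i\<in>I. cinner X (f i) (g i))"
  by (simp add: ell2_def)

context pre_hilbert
begin

lemma ell2_at: "f \<in> carrier (ell2 I X) \<Longrightarrow> f i \<in> carrier X"
  by (cases "i \<in> I") (auto simp: ell2_carrier)

lemma ell2_outside: "f \<in> carrier (ell2 I X) \<Longrightarrow> i \<notin> I \<Longrightarrow> f i = 0"
  by (simp add: ell2_carrier)

lemma ell2_summable: "f \<in> carrier (ell2 I X) \<Longrightarrow> (\<lambda>i. (nrm X (f i))\<^sup>2) summable_on I"
  by (simp add: ell2_carrier)

lemma ell2I:
  assumes "\<And>i. i \<in> I \<Longrightarrow> f i \<in> carrier X" "\<And>i. i \<notin> I \<Longrightarrow> f i = 0"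
    "(\<lambda>i. (nrm X (f i))\<^sup>2) summable_on I"
  shows "f \<in> carrier (ell2 I X)"
  using assms by (simp add: ell2_carrier)

lemma ell2_ip_abs_summable:
  assumes f: "f \<in> carrier (ell2 I X)" and g: "g \<in> carrier (ell2 I X)"
  shows "(\<lambda>i. norm (cinner X (f i) (g i))) summable_on I"
proof (rule Infinite_Sum.abs_summable_on_comparison_test')
  show "(\<lambda>i. (nrm X (f i))\<^sup>2 + (nrm X (g i))\<^sup>2) summable_on I"
    using f g by (intro summable_on_add ell2_summable)
  fix i
  have "norm (cinner X (f i) (g i)) \<le> nrm X (f i) * nrm X (g i)"
    by (rule cauchy_schwarz[OF ell2_at[OF f] ell2_at[OF g]])
  also have "\<dots> \<le> (nrm X (f i))\<^sup>2 + (nrm X (g i))\<^sup>2"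
    using sum_squares_bound[of "nrm X (f i)" "nrm X (g i)"]
      mult_nonneg_nonneg[OF nrm_ge_0[OF ell2_at[OF f, of i]] nrm_ge_0[OF ell2_at[OF g, of i]]]
    unfolding mult.assoc by linarith
  finally show "norm (cinner X (f i) (g i)) \<le> (nrm X (f i))\<^sup>2 + (nrm X (g i))\<^sup>2" .
qed

lemma ell2_ip_summable:
  "\<lbrakk>f \<in> carrier (ell2 I X); g \<in> carrier (ell2 I X)\<rbrakk> \<Longrightarrow> (\<lambda>i. cinner X (f i) (g i)) summable_on I"
  by (rule Infinite_Sum.abs_summable_summable) (rule ell2_ip_abs_summable)

lemma ell2_add_in:
  assumes f: "f \<in> carrier (ell2 I X)" and g: "g \<in> carrier (ell2 I X)"
  shows "f + g \<in> carrier (ell2 I X)"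
proof (rule ell2I)
  show "(\<lambda>i. (nrm X ((f + g) i))\<^sup>2) summable_on I"
  proof (rule summable_on_comparison_test)
    show "(\<lambda>i. 2 * (nrm X (f i))\<^sup>2 + 2 * (nrm X (g i))\<^sup>2) summable_on I"
      using f g by (intro summable_on_add summable_on_cmult_right ell2_summable)
  qed (simp_all add: ell2_at[OF f] ell2_at[OF g] nrm_add_sq_le)
qed (simp_all add: ell2_at[OF f] ell2_at[OF g] ell2_outside[OF f] ell2_outside[OF g])

lemma ell2_scale_in:
  assumes f: "f \<in> carrier (ell2 I X)"
  shows "c *\<^sub>C f \<in> carrier (ell2 I X)"
proof (rule ell2I)
  show "(\<lambda>i. (nrm X ((c *\<^sub>C f) i))\<^sup>2) summable_on I"
    using summable_on_cmult_right[OF ell2_summable[OF f], of "(cmod c)\<^sup>2"]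
    by (simp add: scaleC_fun_def nrm_scale ell2_at[OF f] power_mult_distrib)
qed (simp_all add: ell2_at[OF f] ell2_outside[OF f] scaleC_fun_def)

lemma ell2_pre_hilbert: "pre_hilbert (ell2 I X)"
proof
  show "complex_vector.subspace (carrier (ell2 I X))"
  proof (rule complex_vector.subspaceI)
    show "0 \<in> carrier (ell2 I X)" by (simp add: ell2_carrier)
  qed (simp_all add: ell2_add_in ell2_scale_in)
  fix f g h and c :: complex
  assume f: "f \<in> carrier (ell2 I X)"
  show "0 \<le> nrm (ell2 I X) f" by (simp add: ell2_nrm infsum_nonneg)
  show "f = 0" if "nrm (ell2 I X) f = 0"
  proof
    fix i
    have z: "(\<Sum>\<^sub>\<infinity>i\<in>I. (nrm X (f i))\<^sup>2) = 0" using that by (simp add: ell2_nrm)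
    have "(nrm X (f i))\<^sup>2 = 0" if "i \<in> I"
      by (rule nonneg_infsum_le_0D[where f = "\<lambda>i. (nrm X (f i))\<^sup>2"]) (use z ell2_summable[OF f] that in auto)
    then show "f i = 0 i"
      using nrm0D[OF ell2_at[OF f]] ell2_outside[OF f] by (cases "i \<in> I") simp_all
  qed
  show "cinner (ell2 I X) f f = complex_of_real ((nrm (ell2 I X) f)\<^sup>2)"
    unfolding ell2_cinner ell2_nrm_sq
    using infsumI[OF has_sum_of_real[OF has_sum_infsum[OF ell2_summable[OF f]]]]
    by (simp add: ip_self ell2_at[OF f] del: of_real_power)
  assume g: "g \<in> carrier (ell2 I X)"
  show "cinner (ell2 I X) (c *\<^sub>C f) g = c * cinner (ell2 I X) f g"
    unfolding ell2_cinner
    by (simp add: scaleC_fun_def ip_scale_left ell2_at[OF f] ell2_at[OF g] infsum_cmult_right')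
  show "cinner (ell2 I X) f g = cnj (cinner (ell2 I X) g f)"
    unfolding ell2_cinner infsum_cnj[symmetric]
    by (intro infsum_cong ip_commute ell2_at[OF f] ell2_at[OF g])
  assume h: "h \<in> carrier (ell2 I X)"
  have "(\<Sum>\<^sub>\<infinity>i\<in>I. cinner X ((f + g) i) (h i)) = (\<Sum>\<^sub>\<infinity>i\<in>I. cinner X (f i) (h i) + cinner X (g i) (h i))"
    by (intro infsum_cong) (simp add: ip_add_left ell2_at[OF f] ell2_at[OF g] ell2_at[OF h])
  also have "\<dots> = (\<Sum>\<^sub>\<infinity>i\<in>I. cinner X (f i) (h i)) + (\<Sum>\<^sub>\<infinity>i\<in>I. cinner X (g i) (h i))"
    using f g h by (intro infsum_add ell2_ip_summable)
  finally show "cinner (ell2 I X) (f + g) h = cinner (ell2 I X) f h + cinner (ell2 I X) g h"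
    unfolding ell2_cinner .
qed

lemma ell2_coord_le:
  assumes f: "f \<in> carrier (ell2 I X)"
  shows "nrm X (f i) \<le> nrm (ell2 I X) f"
proof (cases "i \<in> I")
  case True
  have "(\<Sum>j\<in>{i}. (nrm X (f j))\<^sup>2) \<le> (\<Sum>\<^sub>\<infinity>i\<in>I. (nrm X (f i))\<^sup>2)"
    using True by (intro finite_sum_le_infsum ell2_summable[OF f]) auto
  then show ?thesis
    by (simp add: ell2_nrm real_le_rsqrt)
next
  case False
  then show ?thesis using ell2_outside[OF f] by (simp add: ell2_nrm infsum_nonneg)
qed

end

text \<open>A Cauchy sequence converges in each coordinate. The Cauchy estimates hold for every finite set of
  coordinates, pass to the limit there, and are then uniform over finite sets.\<close>

lemma (in complex_hilbert) ell2_hilbert: "complex_hilbert (ell2 I X)"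
proof -
  interpret E: pre_hilbert "ell2 I X" by (rule ell2_pre_hilbert)
  show ?thesis
  proof (rule E.complex_hilbertI)
    fix s :: "nat \<Rightarrow> _"
    assume s: "\<And>n. s n \<in> carrier (ell2 I X)"
      and c: "\<And>e. e > 0 \<Longrightarrow> \<exists>N. \<forall>m\<ge>N. \<forall>n\<ge>N. nrm (ell2 I X) (s m - s n) < e"
    have "\<exists>l\<in>carrier X. (\<lambda>n. nrm X (s n i - l)) \<longlonglongrightarrow> 0" for i
    proof (rule complete)
      show "s n i \<in> carrier X" for n by (rule ell2_at[OF s])
      fix e :: real assume "e > 0"
      then obtain N where "\<forall>m\<ge>N. \<forall>n\<ge>N. nrm (ell2 I X) (s m - s n) < e" using c by blast
      moreover have "nrm X (s m i - s n i) \<le> nrm (ell2 I X) (s m - s n)" for m n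
        using ell2_coord_le[of "s m - s n" I i] E.diff_in[OF s s] by simp
      ultimately show "\<exists>N. \<forall>m\<ge>N. \<forall>n\<ge>N. nrm X (s m i - s n i) < e" by (meson le_less_trans)
    qed
    then obtain l0 where l0: "\<And>i. l0 i \<in> carrier X" "\<And>i. (\<lambda>n. nrm X (s n i - l0 i)) \<longlonglongrightarrow> 0"
      by metis
    define l where "l = (\<lambda>i. if i \<in> I then l0 i else 0)"
    have l: "l i \<in> carrier X" "(\<lambda>n. nrm X (s n i - l i)) \<longlonglongrightarrow> 0" for i
      using l0[of i] ell2_outside[OF s, of i] by (auto simp: l_def)
    have est: "(\<Sum>i\<in>A. (nrm X (s n i - l i))\<^sup>2) \<le> e\<^sup>2"
      if A: "finite A" "A \<subseteq> I" and e: "e > 0" and N: "\<forall>m\<ge>N. \<forall>n\<ge>N. nrm (ell2 I X) (s m - s n) < e" "n \<ge> N"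
      for A e N n
    proof (rule LIMSEQ_le_const2)
      have "(\<lambda>m. nrm X (s n i - s m i)) \<longlonglongrightarrow> nrm X (s n i - l i)" for i
      proof (rule tendsto_sandwich[where f = "\<lambda>m. nrm X (s n i - l i) - nrm X (s m i - l i)"
            and h = "\<lambda>m. nrm X (s n i - l i) + nrm X (s m i - l i)"])
        show "\<forall>\<^sub>F m in sequentially. nrm X (s n i - l i) - nrm X (s m i - l i) \<le> nrm X (s n i - s m i)"
          using nrm_diff_triangle[of "s n i" "s m i" "l i" for m] l(1) ell2_at[OF s] by (simp add: algebra_simps)
        show "\<forall>\<^sub>F m in sequentially. nrm X (s n i - s m i) \<le> nrm X (s n i - l i) + nrm X (s m i - l i)"
          using nrm_diff_triangle[of "s n i" "l i" "s m i" for m] l(1) ell2_at[OF s]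
            nrm_diff_commute[of "l i" "s m i" for m] by simp
      qed (use tendsto_diff[OF tendsto_const l(2)] tendsto_add[OF tendsto_const l(2)] in auto)
      then show "(\<lambda>m. \<Sum>i\<in>A. (nrm X (s n i - s m i))\<^sup>2) \<longlonglongrightarrow> (\<Sum>i\<in>A. (nrm X (s n i - l i))\<^sup>2)"
        by (intro tendsto_sum tendsto_power)
      have "(\<Sum>i\<in>A. (nrm X (s n i - s m i))\<^sup>2) \<le> e\<^sup>2" if "m \<ge> N" for m
      proof -
        have d: "s n - s m \<in> carrier (ell2 I X)" using s by simp
        have "(\<Sum>i\<in>A. (nrm X ((s n - s m) i))\<^sup>2) \<le> (\<Sum>\<^sub>\<infinity>i\<in>I. (nrm X ((s n - s m) i))\<^sup>2)"
          using A by (intro finite_sum_le_infsum ell2_summable[OF d]) auto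
        also have "\<dots> = (nrm (ell2 I X) (s n - s m))\<^sup>2" by (simp add: ell2_nrm_sq)
        also have "\<dots> \<le> e\<^sup>2" using N that E.nrm_ge_0[OF d] by (intro power_mono) (auto intro: less_imp_le)
        finally show ?thesis by simp
      qed
      then show "\<exists>N. \<forall>m\<ge>N. (\<Sum>i\<in>A. (nrm X (s n i - s m i))\<^sup>2) \<le> e\<^sup>2" by blast
    qed
    have tail: "s n - l \<in> carrier (ell2 I X) \<and> nrm (ell2 I X) (s n - l) \<le> e"
      if e: "e > 0" and N: "\<forall>m\<ge>N. \<forall>n\<ge>N. nrm (ell2 I X) (s m - s n) < e" "n \<ge> N" for e N n
    proof
      have sm: "(\<lambda>i. (nrm X ((s n - l) i))\<^sup>2) summable_on I"
      proof (rule nonneg_bdd_above_summable_on)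
        show "bdd_above (sum (\<lambda>i. (nrm X ((s n - l) i))\<^sup>2) ` {F. F \<subseteq> I \<and> finite F})"
          using est[OF _ _ that] by (intro bdd_aboveI2[where M = "e\<^sup>2"]) auto
      qed simp
      show "s n - l \<in> carrier (ell2 I X)"
        using ell2_outside[OF s]
        by (intro ell2I sm) (simp_all add: ell2_at[OF s] l(1), simp add: l_def)
      have "(\<Sum>\<^sub>\<infinity>i\<in>I. (nrm X ((s n - l) i))\<^sup>2) \<le> e\<^sup>2"
        using est[OF _ _ that] by (intro infsum_le_finite_sums[OF sm]) auto
      then show "nrm (ell2 I X) (s n - l) \<le> e"
        using e by (simp add: ell2_nrm real_le_lsqrt infsum_nonneg)
    qed
    obtain N1 where "\<forall>m\<ge>N1. \<forall>n\<ge>N1. nrm (ell2 I X) (s m - s n) < 1" using c[of 1] by auto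
    then have "s N1 - l \<in> carrier (ell2 I X)" using tail[of 1 N1 N1] by simp
    then have lin: "l \<in> carrier (ell2 I X)" using E.diff_in[OF s, of "s N1 - l" N1] by simp
    have "(\<lambda>n. nrm (ell2 I X) (s n - l)) \<longlonglongrightarrow> 0"
    proof (rule LIMSEQ_I)
      fix r :: real assume "r > 0"
      then obtain N where N: "\<forall>m\<ge>N. \<forall>n\<ge>N. nrm (ell2 I X) (s m - s n) < r / 2" using c[of "r/2"] by auto
      have "norm (nrm (ell2 I X) (s n - l) - 0) < r" if "n \<ge> N" for n
        using tail[OF _ N that] \<open>r > 0\<close> E.nrm_ge_0[of "s n - l"] by auto
      then show "\<exists>N. \<forall>n\<ge>N. norm (nrm (ell2 I X) (s n - l) - 0) < r" by blast
    qed
    with lin show "\<exists>l\<in>carrier (ell2 I X). (\<lambda>n. nrm (ell2 I X) (s n - l)) \<longlonglongrightarrow> 0" by blast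
  qed
qed

lemma scaleC_fun_apply [simp]: "(c *\<^sub>C f) x = c *\<^sub>C f x"
  by (simp add: scaleC_fun_def)

text \<open>The operator $T \otimes 1$ on $X \otimes \ell^2(I)$. With it, the normal functionals on
  $\mathbb{B}(X)$ become the vector functionals $T \mapsto \langle (T \otimes 1)\xi, \eta\rangle$.\<close>

definition ampl :: "'i set \<Rightarrow> ('v::complex_vector, 'b) chilb_scheme \<Rightarrow> ('v \<Rightarrow> 'v) \<Rightarrow> ('i \<Rightarrow> 'v) \<Rightarrow> 'i \<Rightarrow> 'v" where
  "ampl I X T = (\<lambda>\<xi>. if \<xi> \<in> carrier (ell2 I X) then (\<lambda>i. T (\<xi> i)) else 0)"

context pre_hilbert
begin

lemma ampl_at: "f \<in> carrier (ell2 I X) \<Longrightarrow> ampl I X T f i = T (f i)"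
  by (simp add: ampl_def)

lemma ampl_closed:
  assumes T: "T \<in> operators X" and f: "f \<in> carrier (ell2 I X)"
  shows "ampl I X T f \<in> carrier (ell2 I X)"
    and "nrm (ell2 I X) (ampl I X T f) \<le> op_norm X X T * nrm (ell2 I X) f"
proof -
  let ?B = "op_norm X X T"
  have le: "(nrm X (T (f i)))\<^sup>2 \<le> ?B\<^sup>2 * (nrm X (f i))\<^sup>2" for i
    using op_norm_bound[OF T ell2_at[OF f]] nrm_ge_0[OF op_in[OF T]]
    unfolding power_mult_distrib[symmetric] by (intro power_mono)
  have sm: "(\<lambda>i. ?B\<^sup>2 * (nrm X (f i))\<^sup>2) summable_on I"
    by (intro summable_on_cmult_right ell2_summable[OF f])
  have sm': "(\<lambda>i. (nrm X (T (f i)))\<^sup>2) summable_on I"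
    by (rule summable_on_comparison_test[OF sm]) (simp_all add: le)
  show "ampl I X T f \<in> carrier (ell2 I X)"
    by (rule ell2I) (simp_all add: ampl_at[OF f] op_in[OF T] op_zero[OF T] ell2_outside[OF f] sm')
  have "(nrm (ell2 I X) (ampl I X T f))\<^sup>2 \<le> (\<Sum>\<^sub>\<infinity>i\<in>I. ?B\<^sup>2 * (nrm X (f i))\<^sup>2)"
    unfolding ell2_nrm_sq ampl_at[OF f] by (rule infsum_mono[OF sm' sm le])
  also have "\<dots> = (?B * nrm (ell2 I X) f)\<^sup>2"
    by (simp add: ell2_nrm_sq infsum_cmult_right' power_mult_distrib)
  finally show "nrm (ell2 I X) (ampl I X T f) \<le> ?B * nrm (ell2 I X) f"
    by (rule power2_le_imp_le) (simp add: op_norm_nonneg[OF T] ell2_nrm infsum_nonneg)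
qed

lemma ampl_in:
  assumes T: "T \<in> operators X"
  shows "ampl I X T \<in> operators (ell2 I X)"
proof -
  interpret E: pre_hilbert "ell2 I X" by (rule ell2_pre_hilbert)
  show ?thesis
  proof (rule E.operatorsI[where B = "op_norm X X T"])
    fix f g and c :: complex
    assume f: "f \<in> carrier (ell2 I X)"
    show "ampl I X T f \<in> carrier (ell2 I X)"
      "nrm (ell2 I X) (ampl I X T f) \<le> op_norm X X T * nrm (ell2 I X) f"
      using ampl_closed[OF T f] by blast+
    show "ampl I X T (c *\<^sub>C f) = c *\<^sub>C ampl I X T f"
      by (rule ext) (simp add: ampl_at[OF f] ampl_at[OF E.scale_in[OF f]] op_scale[OF T] ell2_at[OF f])
    assume g: "g \<in> carrier (ell2 I X)"
    show "ampl I X T (f + g) = ampl I X T f + ampl I X T g"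
      by (rule ext) (simp add: ampl_at[OF f] ampl_at[OF g] ampl_at[OF E.add_in[OF f g]] op_add[OF T] ell2_at[OF f] ell2_at[OF g])
  qed (simp add: ampl_def)
qed

lemma ampl_comp:
  assumes S: "S \<in> operators X" and T: "T \<in> operators X"
  shows "ampl I X (S \<circ> T) = ampl I X S \<circ> ampl I X T"
proof
  fix f
  interpret E: pre_hilbert "ell2 I X" by (rule ell2_pre_hilbert)
  show "ampl I X (S \<circ> T) f = (ampl I X S \<circ> ampl I X T) f"
    using ampl_closed(1)[OF T, of f] E.zero_in by (auto simp: ampl_def op_zero[OF S])
qed

lemma ampl_ip:
  "f \<in> carrier (ell2 I X) \<Longrightarrow> cinner (ell2 I X) (ampl I X T f) g = (\<Sum>\<^sub>\<infinity>i\<in>I. cinner X (T (f i)) (g i))"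
  by (simp add: ell2_cinner ampl_at)

lemma delta_in: "s \<in> I \<Longrightarrow> x \<in> carrier X \<Longrightarrow> delta s x \<in> carrier (ell2 I X)"
proof (rule ell2I)
  assume "s \<in> I" "x \<in> carrier X"
  have "(\<lambda>i. (nrm X (delta s x i))\<^sup>2) summable_on I \<longleftrightarrow> (\<lambda>i. (nrm X (delta s x i))\<^sup>2) summable_on {s}"
    by (rule summable_on_cong_neutral) (use \<open>s \<in> I\<close> in \<open>auto simp: delta_def\<close>)
  then show "(\<lambda>i. (nrm X (delta s x i))\<^sup>2) summable_on I" by simp
qed (auto simp: delta_def)

lemma delta_nrm:
  assumes "s \<in> I" "x \<in> carrier X"
  shows "nrm (ell2 I X) (delta s x) = nrm X x"
proof -
  have "(\<Sum>\<^sub>\<infinity>i\<in>I. (nrm X (delta s x i))\<^sup>2) = (\<Sum>\<^sub>\<infinity>i\<in>{s}. (nrm X (delta s x i))\<^sup>2)"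
    by (rule infsum_cong_neutral) (use assms in \<open>auto simp: delta_def\<close>)
  then show ?thesis by (simp add: ell2_nrm delta_def nrm_ge_0[OF assms(2)])
qed

lemma delta_ip_right:
  assumes r: "r \<in> I" and y: "y \<in> carrier X" and f: "f \<in> carrier (ell2 I X)"
  shows "cinner (ell2 I X) f (delta r y) = cinner X (f r) y"
proof -
  have "(\<Sum>\<^sub>\<infinity>i\<in>I. cinner X (f i) (delta r y i)) = (\<Sum>\<^sub>\<infinity>i\<in>{r}. cinner X (f i) (delta r y i))"
    by (rule infsum_cong_neutral) (use r ell2_at[OF f] in \<open>auto simp: delta_def\<close>)
  then show ?thesis by (simp add: ell2_cinner delta_def)
qed

lemma delta_ip_left:
  assumes r: "r \<in> I" and y: "y \<in> carrier X" and f: "f \<in> carrier (ell2 I X)"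
  shows "cinner (ell2 I X) (delta r y) f = cinner X y (f r)"
proof -
  have "(\<Sum>\<^sub>\<infinity>i\<in>I. cinner X (delta r y i) (f i)) = (\<Sum>\<^sub>\<infinity>i\<in>{r}. cinner X (delta r y i) (f i))"
    by (rule infsum_cong_neutral) (use r ell2_at[OF f] in \<open>auto simp: delta_def\<close>)
  then show ?thesis by (simp add: ell2_cinner delta_def)
qed

lemma delta_add: "delta s (x + y) = (delta s x + delta s y :: 'i \<Rightarrow> 'v)"
  by (auto simp: delta_def)

lemma delta_scale: "delta s (c *\<^sub>C x) = (c *\<^sub>C delta s x :: 'i \<Rightarrow> 'v)"
  by (auto simp: delta_def scaleC_fun_def)

lemma mat_entry_apply: "x \<in> carrier X \<Longrightarrow> mat_entry X T r s x = T (delta s x) r"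
  by (simp add: mat_entry_def)

lemma mat_entry_in:
  assumes T: "T \<in> operators (ell2 I X)" and s: "s \<in> I"
  shows "mat_entry X T r s \<in> operators X"
proof -
  interpret E: pre_hilbert "ell2 I X" by (rule ell2_pre_hilbert)
  show ?thesis
  proof (rule operatorsI[where B = "op_norm (ell2 I X) (ell2 I X) T"])
    fix x y and c :: complex assume x: "x \<in> carrier X"
    have dx: "delta s x \<in> carrier (ell2 I X)" using s x by (rule delta_in)
    show "mat_entry X T r s x \<in> carrier X"
      using ell2_at[OF E.op_in[OF T]] x by (simp add: mat_entry_apply)
    show "mat_entry X T r s (c *\<^sub>C x) = c *\<^sub>C mat_entry X T r s x"
      using x dx E.op_scale[OF T] by (simp add: mat_entry_apply delta_scale)
    show "nrm X (mat_entry X T r s x) \<le> op_norm (ell2 I X) (ell2 I X) T * nrm X x"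
      using ell2_coord_le[OF E.op_in[OF T], of "delta s x" r] E.op_norm_bound[OF T dx] x s
      by (simp add: mat_entry_apply delta_nrm)
    assume y: "y \<in> carrier X"
    have dy: "delta s y \<in> carrier (ell2 I X)" using s y by (rule delta_in)
    show "mat_entry X T r s (x + y) = mat_entry X T r s x + mat_entry X T r s y"
      using x y dx dy E.op_add[OF T] by (simp add: mat_entry_apply delta_add)
  qed (simp add: mat_entry_def)
qed

text \<open>The identification $\ell^2(I;\ell^2(J;X)) = \ell^2(I \times J;X)$.\<close>

lemma uncurry_in:
  assumes f: "f \<in> carrier (ell2 I (ell2 J X))"
  shows "(\<lambda>(i, j). f i j) \<in> carrier (ell2 (I \<times> J) X)"
proof -
  interpret J: pre_hilbert "ell2 J X" by (rule ell2_pre_hilbert)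
  have fi: "f i \<in> carrier (ell2 J X)" for i by (rule J.ell2_at[OF f])
  show ?thesis
  proof (rule ell2I)
    show "(\<lambda>p. (nrm X (case p of (i, j) \<Rightarrow> f i j))\<^sup>2) summable_on I \<times> J"
    proof (rule summable_on_SigmaI)
      show "((\<lambda>j. (nrm X (case (i, j) of (i, j) \<Rightarrow> f i j))\<^sup>2) has_sum (nrm (ell2 J X) (f i))\<^sup>2) J" for i
        unfolding ell2_nrm_sq using has_sum_infsum[OF ell2_summable[OF fi]] by simp
      show "(\<lambda>i. (nrm (ell2 J X) (f i))\<^sup>2) summable_on I" by (rule J.ell2_summable[OF f])
    qed simp
    show "(case p of (i, j) \<Rightarrow> f i j) = 0" if "p \<notin> I \<times> J" for p
      using that J.ell2_outside[OF f] ell2_outside[OF fi] by (cases p) fastforce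
  qed (auto simp: ell2_at[OF fi])
qed

lemma curry_in:
  assumes f: "f \<in> carrier (ell2 (I \<times> J) X)"
  shows "(\<lambda>i j. f (i, j)) \<in> carrier (ell2 I (ell2 J X))"
proof -
  interpret J: pre_hilbert "ell2 J X" by (rule ell2_pre_hilbert)
  have sm: "(\<lambda>(i, j). (nrm X (f (i, j)))\<^sup>2) summable_on I \<times> J"
    using ell2_summable[OF f] by (simp add: case_prod_unfold)
  have smi: "(\<lambda>j. (nrm X (f (i, j)))\<^sup>2) summable_on J" for i
    using summable_on_SigmaD1[OF sm, of i] ell2_outside[OF f, of "(i, _)"] by (cases "i \<in> I") auto
  have fi: "(\<lambda>j. f (i, j)) \<in> carrier (ell2 J X)" for i
    by (rule ell2I) (auto simp: ell2_at[OF f] smi ell2_outside[OF f])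
  show ?thesis
  proof (rule J.ell2I)
    show "(\<lambda>i. (nrm (ell2 J X) (\<lambda>j. f (i, j)))\<^sup>2) summable_on I"
      unfolding ell2_nrm_sq using summable_on_SigmaD[OF ell2_summable[OF f]] smi by simp
    show "(\<lambda>j. f (i, j)) = 0" if "i \<notin> I" for i
      using that ell2_outside[OF f, of "(i, _)"] by (simp add: fun_eq_iff)
  qed (simp add: fi)
qed

lemma uncurry_ip:
  assumes f: "f \<in> carrier (ell2 I (ell2 J X))" and g: "g \<in> carrier (ell2 I (ell2 J X))"
  shows "cinner (ell2 I (ell2 J X)) f g = cinner (ell2 (I \<times> J) X) (\<lambda>(i, j). f i j) (\<lambda>(i, j). g i j)"
  unfolding ell2_cinner
  using infsum_Sigma_banach[OF ell2_ip_summable[OF uncurry_in[OF f] uncurry_in[OF g]]] by simp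

lemma uncurry_nrm:
  assumes f: "f \<in> carrier (ell2 I (ell2 J X))"
  shows "nrm (ell2 I (ell2 J X)) f = nrm (ell2 (I \<times> J) X) (\<lambda>(i, j). f i j)"
proof -
  interpret J: pre_hilbert "ell2 J X" by (rule ell2_pre_hilbert)
  interpret IJ: pre_hilbert "ell2 I (ell2 J X)" by (rule J.ell2_pre_hilbert)
  interpret P: pre_hilbert "ell2 (I \<times> J) X" by (rule ell2_pre_hilbert)
  show ?thesis
    using IJ.nrm_sq[OF f] P.nrm_sq[OF uncurry_in[OF f]] uncurry_ip[OF f f]
    by (intro IJ.nrm_eqI[OF f]) (simp_all add: P.nrm_ge_0 uncurry_in[OF f])
qed

lemma ell2_permute:
  assumes h: "bij_betw h A B" and f: "f \<in> carrier (ell2 B X)"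
  shows "(\<lambda>a. if a \<in> A then f (h a) else 0) \<in> carrier (ell2 A X)"
proof (rule ell2I)
  have "(\<lambda>a. (nrm X (f (h a)))\<^sup>2) summable_on A"
    using summable_on_reindex_bij_betw[OF h, of "\<lambda>b. (nrm X (f b))\<^sup>2"] ell2_summable[OF f] by simp
  then show "(\<lambda>a. (nrm X (if a \<in> A then f (h a) else 0))\<^sup>2) summable_on A"
    by (rule summable_on_cong[THEN iffD1, rotated]) simp
qed (simp_all add: ell2_at[OF f])

lemma ell2_permute_ip:
  assumes h: "bij_betw h A B"
  shows "cinner (ell2 A X) (\<lambda>a. if a \<in> A then f (h a) else 0) (\<lambda>a. if a \<in> A then g (h a) else 0)
    = cinner (ell2 B X) f g"
proof -
  have "(\<Sum>\<^sub>\<infinity>a\<in>A. cinner X (if a \<in> A then f (h a) else 0) (if a \<in> A then g (h a) else 0))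
      = (\<Sum>\<^sub>\<infinity>a\<in>A. cinner X (f (h a)) (g (h a)))"
    by (rule infsum_cong) simp
  also have "\<dots> = (\<Sum>\<^sub>\<infinity>b\<in>B. cinner X (f b) (g b))"
    by (rule infsum_reindex_bij_betw[OF h])
  finally show ?thesis by (simp add: ell2_cinner)
qed

text \<open>Square-summable families have countable support, so sequences suffice to describe all
  normal functionals.\<close>

lemma ell2_to_sequences:
  assumes x: "x \<in> carrier (ell2 J X)" and y: "y \<in> carrier (ell2 J X)"
  obtains x' y' :: "nat \<Rightarrow> 'v" where "x' \<in> carrier (ell2 UNIV X)" "y' \<in> carrier (ell2 UNIV X)"
    "nrm (ell2 UNIV X) x' = nrm (ell2 J X) x" "nrm (ell2 UNIV X) y' = nrm (ell2 J X) y"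
    "\<And>T. T \<in> operators X \<Longrightarrow>
      cinner (ell2 UNIV X) (ampl UNIV X T x') y' = cinner (ell2 J X) (ampl J X T x) y"
proof -
  define D where "D = {j \<in> J. (nrm X (x j))\<^sup>2 \<noteq> 0} \<union> {j \<in> J. (nrm X (y j))\<^sup>2 \<noteq> 0}"
  have "countable D"
    unfolding D_def using summable_countable_real[OF ell2_summable[OF x]]
      summable_countable_real[OF ell2_summable[OF y]] by (rule countable_Un)
  have DJ: "D \<subseteq> J" by (auto simp: D_def)
  have off: "x j = 0" "y j = 0" if "j \<in> J - D" for j
    using that nrm0D[OF ell2_at[OF x]] nrm0D[OF ell2_at[OF y]] by (auto simp: D_def)
  define h where "h = to_nat_on D"
  have h: "bij_betw h D (h ` D)"
    unfolding h_def using \<open>countable D\<close> by (simp add: inj_on_imp_bij_betw inj_on_to_nat_on)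
  define tr where "tr z = (\<lambda>n. if n \<in> h ` D then z (inv_into D h n) else 0)" for z :: "_ \<Rightarrow> 'v"
  have sums: "(f' has_sum s) UNIV \<longleftrightarrow> (f has_sum s) J"
    if "\<And>j. j \<in> D \<Longrightarrow> f' (h j) = f j" "\<And>n. n \<notin> h ` D \<Longrightarrow> f' n = 0" "\<And>j. j \<in> J - D \<Longrightarrow> f j = 0"
    for f' :: "nat \<Rightarrow> 'z::{topological_comm_monoid_add, t2_space}" and f s
  proof -
    have "(f' has_sum s) UNIV \<longleftrightarrow> (f' has_sum s) (h ` D)"
      using that by (intro has_sum_cong_neutral) auto
    also have "\<dots> \<longleftrightarrow> ((\<lambda>j. f' (h j)) has_sum s) D"
      by (rule has_sum_reindex_bij_betw[OF h, symmetric])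
    also have "\<dots> \<longleftrightarrow> (f has_sum s) D"
      using that by (intro has_sum_cong) auto
    also have "\<dots> \<longleftrightarrow> (f has_sum s) J"
      using that DJ by (intro has_sum_cong_neutral) auto
    finally show ?thesis .
  qed
  have tr_h: "tr z (h j) = z j" if "j \<in> D" for z j
    using that h by (auto simp: tr_def bij_betw_def)
  have tr_off: "tr z n = 0" if "n \<notin> h ` D" for z n
    using that by (simp add: tr_def)
  have tr_sq: "((\<lambda>n. (nrm X (tr z n))\<^sup>2) has_sum s) UNIV \<longleftrightarrow> ((\<lambda>j. (nrm X (z j))\<^sup>2) has_sum s) J"
    if "\<And>j. j \<in> J - D \<Longrightarrow> z j = 0" for z s
    by (rule sums) (simp_all add: tr_h tr_off that)
  have tr_in: "tr z \<in> carrier (ell2 UNIV X) \<and> nrm (ell2 UNIV X) (tr z) = nrm (ell2 J X) z"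
    if z: "z \<in> carrier (ell2 J X)" "\<And>j. j \<in> J - D \<Longrightarrow> z j = 0" for z
  proof
    have hs: "((\<lambda>n. (nrm X (tr z n))\<^sup>2) has_sum (\<Sum>\<^sub>\<infinity>j\<in>J. (nrm X (z j))\<^sup>2)) UNIV"
    proof (rule tr_sq[THEN iffD2])
      show "((\<lambda>j. (nrm X (z j))\<^sup>2) has_sum (\<Sum>\<^sub>\<infinity>j\<in>J. (nrm X (z j))\<^sup>2)) J"
        by (rule has_sum_infsum[OF ell2_summable[OF z(1)]])
    qed (rule z(2))
    show "tr z \<in> carrier (ell2 UNIV X)"
      by (rule ell2I) (use hs in \<open>auto simp: tr_def ell2_at[OF z(1)] dest: has_sum_imp_summable\<close>)
    show "nrm (ell2 UNIV X) (tr z) = nrm (ell2 J X) z"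
      unfolding ell2_nrm infsumI[OF hs] ..
  qed
  show ?thesis
  proof (rule that[of "tr x" "tr y"])
    fix T assume T: "T \<in> operators X"
    have "((\<lambda>n. cinner X (T (tr x n)) (tr y n)) has_sum cinner (ell2 J X) (ampl J X T x) y) UNIV"
    proof (subst sums)
      show "((\<lambda>j. cinner X (T (x j)) (y j)) has_sum cinner (ell2 J X) (ampl J X T x) y) J"
        unfolding ampl_ip[OF x]
        using has_sum_infsum[OF ell2_ip_summable[OF ampl_closed(1)[OF T x] y]] by (simp add: ampl_at[OF x])
    qed (simp_all add: tr_h tr_off off op_zero[OF T])
    then show "cinner (ell2 UNIV X) (ampl UNIV X T (tr x)) (tr y) = cinner (ell2 J X) (ampl J X T x) y"
      using tr_in[OF x off(1)] by (subst ampl_ip) (simp_all add: infsumI)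
  qed (use tr_in x y off in blast)+
qed

end

section \<open>Weak topologies\<close>

lemma topspace_weak_topology [simp]: "topspace (weak_topology A \<Phi>) = A"
  by (auto simp: weak_topology_def topspace_pullback_topology)

lemma continuous_map_weak_topology:
  assumes "\<phi> \<in> \<Phi>"
  shows "continuous_map (weak_topology A \<Phi>) euclidean \<phi>"
proof -
  have "continuous_map (weak_topology A \<Phi>) euclidean ((\<lambda>z. z \<phi>) \<circ> (\<lambda>a. \<lambda>\<phi>\<in>\<Phi>. \<phi> a))"
    unfolding weak_topology_def
    using continuous_map_product_projection[OF assms, of "\<lambda>_. euclidean"] by (rule continuous_map_pullback)
  then show ?thesis using assms by (simp add: o_def)
qed

lemma continuous_map_into_weak_topology:
  assumes "\<And>z. z \<in> topspace Z \<Longrightarrow> f z \<in> A" "\<And>\<phi>. \<phi> \<in> \<Phi> \<Longrightarrow> continuous_map Z euclidean (\<lambda>z. \<phi> (f z))"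
  shows "continuous_map Z (weak_topology A \<Phi>) f"
  unfolding weak_topology_def
  by (rule continuous_map_pullback') (use assms in \<open>auto simp: continuous_map_componentwise\<close>)

text \<open>A neighbourhood in a product topology restricts only finitely many coordinates.\<close>

lemma in_closure_of_weak_topology:
  assumes T: "T \<in> A" and S: "S \<subseteq> A"
    and approx: "\<And>\<Psi> e. \<lbrakk>finite \<Psi>; \<Psi> \<subseteq> \<Phi>; e > 0\<rbrakk> \<Longrightarrow> \<exists>s\<in>S. \<forall>\<phi>\<in>\<Psi>. cmod (\<phi> s - \<phi> T) < e"
  shows "T \<in> weak_topology A \<Phi> closure_of S"
  unfolding in_closure_of
proof (intro conjI allI impI)
  show "T \<in> topspace (weak_topology A \<Phi>)" using T by simp
  fix U assume "T \<in> U \<and> openin (weak_topology A \<Phi>) U"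
  then obtain V where V: "openin (product_topology (\<lambda>_. euclidean) \<Phi>) V"
    and U: "U = (\<lambda>a. \<lambda>\<phi>\<in>\<Phi>. \<phi> a) -` V \<inter> A" and TV: "(\<lambda>\<phi>\<in>\<Phi>. \<phi> T) \<in> V"
    by (auto simp: weak_topology_def openin_pullback_topology)
  note ex = bspec[OF V[unfolded openin_product_topology_alt] TV]
  obtain W where W0: "finite {\<phi> \<in> \<Phi>. W \<phi> \<noteq> topspace (euclidean :: complex topology)} \<and>
      (\<forall>\<phi>\<in>\<Phi>. openin euclidean (W \<phi>)) \<and> (\<lambda>\<phi>\<in>\<Phi>. \<phi> T) \<in> Pi\<^sub>E \<Phi> W \<and> Pi\<^sub>E \<Phi> W \<subseteq> V"
    by (rule exE[OF ex])
  then have W: "finite {\<phi> \<in> \<Phi>. W \<phi> \<noteq> UNIV}" "\<And>\<phi>. \<phi> \<in> \<Phi> \<Longrightarrow> open (W \<phi>)"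
    "(\<lambda>\<phi>\<in>\<Phi>. \<phi> T) \<in> Pi\<^sub>E \<Phi> W" "Pi\<^sub>E \<Phi> W \<subseteq> V"
    by (simp_all add: open_openin[symmetric])
  define \<Psi> where "\<Psi> = {\<phi> \<in> \<Phi>. W \<phi> \<noteq> UNIV}"
  have "\<exists>r>0. ball (\<phi> T) r \<subseteq> W \<phi>" if "\<phi> \<in> \<Phi>" for \<phi>
  proof -
    have "\<phi> T \<in> W \<phi>" using PiE_mem[OF W(3) that] that by simp
    then show ?thesis using openE[OF W(2)[OF that]] by blast
  qed
  then obtain r where r: "\<And>\<phi>. \<phi> \<in> \<Phi> \<Longrightarrow> r \<phi> > 0" "\<And>\<phi>. \<phi> \<in> \<Phi> \<Longrightarrow> ball (\<phi> T) (r \<phi>) \<subseteq> W \<phi>"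
    by metis
  define e where "e = Min (insert 1 (r ` \<Psi>))"
  have fin: "finite \<Psi>" using W(1) by (simp add: \<Psi>_def)
  have "e > 0" unfolding e_def using fin r(1) by (subst Min_gr_iff) (auto simp: \<Psi>_def)
  then obtain s where s: "s \<in> S" "\<And>\<phi>. \<phi> \<in> \<Psi> \<Longrightarrow> cmod (\<phi> s - \<phi> T) < e"
    using approx[OF fin, of e] by (auto simp: \<Psi>_def)
  have "\<phi> s \<in> W \<phi>" if "\<phi> \<in> \<Phi>" for \<phi>
  proof (cases "\<phi> \<in> \<Psi>")
    case True
    then have "e \<le> r \<phi>" unfolding e_def using fin by (intro Min_le) auto
    then have "\<phi> s \<in> ball (\<phi> T) (r \<phi>)" using s(2)[OF True] by (simp add: dist_norm norm_minus_commute)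
    then show ?thesis using r(2)[OF that] by blast
  next
    case False
    then show ?thesis using that by (simp add: \<Psi>_def)
  qed
  then have "(\<lambda>\<phi>\<in>\<Phi>. \<phi> s) \<in> V" using W(4) by auto
  then show "\<exists>y. y \<in> S \<and> y \<in> U" using s(1) S U by auto
qed

context pre_hilbert
begin

lemma topspace_weakstar [simp]: "topspace (weakstar_op X) = operators X"
  by (simp add: weakstar_op_def)

lemma sq_summable_seqs_ell2: "sq_summable_seqs X = carrier (ell2 UNIV X)"
  by (auto simp: sq_summable_seqs_def ell2_carrier summable_on_UNIV_nonneg_real_iff)

lemma normal_functional_seq:
  assumes T: "T \<in> operators X" and x: "x \<in> carrier (ell2 (UNIV :: nat set) X)" and y: "y \<in> carrier (ell2 UNIV X)"
  shows "(\<Sum>n. cinner X (T (x n)) (y n)) = cinner (ell2 UNIV X) (ampl UNIV X T x) y"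
proof -
  have "((\<lambda>n. cinner X (T (x n)) (y n)) has_sum cinner (ell2 UNIV X) (ampl UNIV X T x) y) UNIV"
    unfolding ampl_ip[OF x]
    using has_sum_infsum[OF ell2_ip_summable[OF ampl_closed(1)[OF T x] y]] by (simp add: ampl_at[OF x])
  then show ?thesis by (rule has_sum_imp_sums[THEN sums_unique, symmetric])
qed

lemma weakstar_continuous:
  assumes x: "x \<in> carrier (ell2 J X)" and y: "y \<in> carrier (ell2 J X)"
  shows "continuous_map (weakstar_op X) euclidean (\<lambda>T. cinner (ell2 J X) (ampl J X T x) y)"
proof -
  obtain x' y' where s: "x' \<in> carrier (ell2 (UNIV :: nat set) X)" "y' \<in> carrier (ell2 UNIV X)"
    "\<And>T. T \<in> operators X \<Longrightarrow> cinner (ell2 UNIV X) (ampl UNIV X T x') y' = cinner (ell2 J X) (ampl J X T x) y"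
    using ell2_to_sequences[OF x y] by blast
  have "continuous_map (weakstar_op X) euclidean (\<lambda>T. \<Sum>n. cinner X (T (x' n)) (y' n))"
    unfolding weakstar_op_def by (rule continuous_map_weak_topology) (use s sq_summable_seqs_ell2 in blast)
  then show ?thesis
    by (rule continuous_map_eq) (simp add: normal_functional_seq s)
qed

lemma weakstar_continuousI:
  assumes f: "\<And>z. z \<in> topspace Z \<Longrightarrow> f z \<in> operators X"
    and c: "\<And>x y. \<lbrakk>x \<in> carrier (ell2 (UNIV :: nat set) X); y \<in> carrier (ell2 UNIV X)\<rbrakk>
      \<Longrightarrow> continuous_map Z euclidean (\<lambda>z. cinner (ell2 UNIV X) (ampl UNIV X (f z) x) y)"
  shows "continuous_map Z (weakstar_op X) f"
  unfolding weakstar_op_def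
proof (rule continuous_map_into_weak_topology[OF f])
  fix \<phi> assume "\<phi> \<in> {(\<lambda>T. \<Sum>n. cinner X (T (x n)) (y n)) | x y. x \<in> sq_summable_seqs X \<and> y \<in> sq_summable_seqs X}"
  then obtain x y where \<phi>: "\<phi> = (\<lambda>T. \<Sum>n. cinner X (T (x n)) (y n))"
    and x: "x \<in> carrier (ell2 (UNIV :: nat set) X)" and y: "y \<in> carrier (ell2 UNIV X)"
    unfolding sq_summable_seqs_ell2 by blast
  show "continuous_map Z euclidean (\<lambda>z. \<phi> (f z))"
    unfolding \<phi> by (rule continuous_map_eq[OF c[OF x y]]) (simp add: normal_functional_seq f x y)
qed

lemma in_weakstar_closure:
  assumes T: "T \<in> operators X" and S: "S \<subseteq> operators X"
    and approx: "\<And>\<Psi> e. \<lbrakk>finite \<Psi>; \<Psi> \<subseteq> carrier (ell2 (UNIV :: nat set) X) \<times> carrier (ell2 UNIV X); e > 0\<rbrakk>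
      \<Longrightarrow> \<exists>s\<in>S. \<forall>(x, y)\<in>\<Psi>. cmod (cinner (ell2 UNIV X) (ampl UNIV X s x) y - cinner (ell2 UNIV X) (ampl UNIV X T x) y) < e"
  shows "T \<in> weakstar_op X closure_of S"
  unfolding weakstar_op_def
proof (rule in_closure_of_weak_topology[OF T S])
  let ?E = "carrier (ell2 (UNIV :: nat set) X)"
  let ?f = "\<lambda>(x, y) T. \<Sum>n. cinner X (T (x n)) (y n)"
  fix \<Psi> and e :: real
  assume "finite \<Psi>" "e > 0"
    and sub: "\<Psi> \<subseteq> {(\<lambda>T. \<Sum>n. cinner X (T (x n)) (y n)) | x y. x \<in> sq_summable_seqs X \<and> y \<in> sq_summable_seqs X}"
  have "\<Psi> \<subseteq> ?f ` (?E \<times> ?E)"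
    using sub unfolding sq_summable_seqs_ell2 by fastforce
  then obtain P where P: "P \<subseteq> ?E \<times> ?E" "finite P" "\<Psi> = ?f ` P"
    using \<open>finite \<Psi>\<close> by (meson finite_subset_image)
  obtain s where s: "s \<in> S" "\<forall>(x, y)\<in>P. cmod (cinner (ell2 UNIV X) (ampl UNIV X s x) y
      - cinner (ell2 UNIV X) (ampl UNIV X T x) y) < e"
    using approx[OF P(2,1) \<open>e > 0\<close>] by blast
  have "cmod (\<phi> s - \<phi> T) < e" if \<phi>: "\<phi> \<in> \<Psi>" for \<phi>
  proof -
    obtain q where "q \<in> P" "\<phi> = ?f q" using \<phi> P(3) by blast
    then obtain x y where xy: "(x, y) \<in> P" "\<phi> = ?f (x, y)" by (cases q) blast
    then have "x \<in> ?E" "y \<in> ?E" using P by auto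
    then show ?thesis using s xy S T by (auto simp: normal_functional_seq subset_iff)
  qed
  with s(1) show "\<exists>s\<in>S. \<forall>\<phi>\<in>\<Psi>. cmod (\<phi> s - \<phi> T) < e" by blast
qed

end

lemma continuous_map_compose_continuous:
  assumes "continuous_map Z euclidean f" and "continuous_on UNIV h"
  shows "continuous_map Z euclidean (\<lambda>z. h (f z))"
  using continuous_map_compose[OF assms(1), of euclidean h] assms(2) by (simp add: o_def)

section \<open>A minimax principle\<close>

text \<open>
  Otherwise the sum $\Phi$ of the squares of the negative parts of the $g_i$ has a positive infimum.
  Move from an almost optimal point $a$ towards a point $b$ at which the combination weighted by these
  negative parts is nonnegative: to first order, $\Phi$ decreases by a fixed amount.
\<close>

lemma approximate_minimax:
  fixes g :: "'i \<Rightarrow> 'a \<Rightarrow> real"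
  assumes fin: "finite I"
    and conv: "\<And>a b t. \<lbrakk>a \<in> C; b \<in> C; 0 \<le> t; t \<le> 1\<rbrakk> \<Longrightarrow> \<exists>c\<in>C. \<forall>i\<in>I. g i c = (1 - t) * g i a + t * g i b"
    and bd: "\<And>i a. \<lbrakk>i \<in> I; a \<in> C\<rbrakk> \<Longrightarrow> \<bar>g i a\<bar> \<le> K"
    and wt: "\<And>l. (\<And>i. i \<in> I \<Longrightarrow> 0 \<le> l i) \<Longrightarrow> \<exists>a\<in>C. 0 \<le> (\<Sum>i\<in>I. l i * g i a)"
    and e: "e > 0"
  shows "\<exists>a\<in>C. \<forall>i\<in>I. - e < g i a"
proof (rule ccontr)
  assume neg: "\<not> ?thesis"
  define \<Phi> where "\<Phi> a = (\<Sum>i\<in>I. (min 0 (g i a))\<^sup>2)" for a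
  have \<Phi>_ge: "e\<^sup>2 \<le> \<Phi> a" if "a \<in> C" for a
  proof -
    obtain i where i: "i \<in> I" "g i a \<le> - e" using neg \<open>a \<in> C\<close> by (meson not_less)
    have "e\<^sup>2 \<le> (min 0 (g i a))\<^sup>2"
      using i e power_mono[of e "- g i a" 2] by simp
    also have "\<dots> \<le> \<Phi> a"
      unfolding \<Phi>_def using i fin by (intro member_le_sum) auto
    finally show ?thesis .
  qed
  obtain a0 where a0: "a0 \<in> C" using wt[of "\<lambda>_. 0"] by auto
  define m where "m = Inf (\<Phi> ` C)"
  have bdd: "bdd_below (\<Phi> ` C)" using \<Phi>_ge by (intro bdd_belowI2) auto
  have m_le: "m \<le> \<Phi> a" if "a \<in> C" for a unfolding m_def by (rule cINF_lower[OF bdd that])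
  have "e\<^sup>2 \<le> m" unfolding m_def using a0 \<Phi>_ge by (intro cINF_greatest) auto
  then have m: "m > 0" using e by (smt (verit) zero_less_power)
  define R where "R = real (card I) * (2 * K)\<^sup>2 + 1"
  have R: "R > 0" by (simp add: R_def add_nonneg_pos)
  \<comment> \<open>A step so short that the second-order term, at most \<open>t\<^sup>2 * R\<close>, is dominated by \<open>t * m\<close>.\<close>
  define t where "t = min 1 (m / R)"
  have t: "0 < t" "t \<le> 1" using m R by (simp_all add: t_def)
  have tR: "t * R \<le> m" using R unfolding t_def by (simp add: min_def field_simps)
  obtain a where a: "a \<in> C" "\<Phi> a < m + t * m"
  proof -
    have "m < m + t * m" using t m by simp
    then show ?thesis
      using cInf_less_iff[of "\<Phi> ` C" "m + t * m"] a0 bdd that unfolding m_def by auto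
  qed
  \<comment> \<open>Up to the factor $-2$, the derivatives of \<open>\<Phi>\<close> with respect to the values \<open>g i a\<close>.\<close>
  define l where "l i = - min 0 (g i a)" for i
  have l: "0 \<le> l i" for i by (simp add: l_def)
  obtain b where b: "b \<in> C" "0 \<le> (\<Sum>i\<in>I. l i * g i b)" using wt[of l] l by blast
  obtain c where c: "c \<in> C" "\<And>i. i \<in> I \<Longrightarrow> g i c = (1 - t) * g i a + t * g i b"
    using conv[OF a(1) b(1), of t] t by auto
  define d where "d i = g i b - g i a" for i
  have step: "(min 0 (g i c))\<^sup>2 \<le> (l i)\<^sup>2 - 2 * t * (l i * d i) + t\<^sup>2 * (d i)\<^sup>2" if "i \<in> I" for i
  proof -
    have "g i c - max 0 (g i a) = t * d i - l i"
      unfolding c(2)[OF that] d_def l_def by (simp add: algebra_simps max_def min_def)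
    moreover have "(min 0 (g i c))\<^sup>2 \<le> (g i c - max 0 (g i a))\<^sup>2"
    proof -
      have "\<bar>min 0 (g i c)\<bar> \<le> \<bar>g i c - max 0 (g i a)\<bar>" by linarith
      then show ?thesis by (simp only: abs_le_square_iff)
    qed
    ultimately have "(min 0 (g i c))\<^sup>2 \<le> (t * d i - l i)\<^sup>2" by simp
    also have "\<dots> = (l i)\<^sup>2 - 2 * t * (l i * d i) + t\<^sup>2 * (d i)\<^sup>2"
      by (simp add: power2_eq_square algebra_simps)
    finally show ?thesis .
  qed
  have \<Phi>a: "\<Phi> a = (\<Sum>i\<in>I. (l i)\<^sup>2)" by (simp add: \<Phi>_def l_def)
  have lg: "l i * g i a = - (l i)\<^sup>2" for i
    by (simp add: l_def min_def power2_eq_square)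
  have ld: "\<Phi> a \<le> (\<Sum>i\<in>I. l i * d i)"
    unfolding \<Phi>a d_def right_diff_distrib sum_subtractf lg sum_negf using b(2) by simp
  have "(d i)\<^sup>2 \<le> (2 * K)\<^sup>2" if "i \<in> I" for i
    using bd[OF that a(1)] bd[OF that b(1)] unfolding d_def by (intro power2_le_iff_abs_le[THEN iffD2]) auto
  then have "(\<Sum>i\<in>I. (d i)\<^sup>2) \<le> real (card I) * (2 * K)\<^sup>2" by (rule sum_bounded_above)
  then have dR: "(\<Sum>i\<in>I. (d i)\<^sup>2) \<le> R" by (simp add: R_def)
  have "\<Phi> c \<le> (\<Sum>i\<in>I. (l i)\<^sup>2 - 2 * t * (l i * d i) + t\<^sup>2 * (d i)\<^sup>2)"
    unfolding \<Phi>_def by (rule sum_mono) (rule step)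
  also have "\<dots> = \<Phi> a - 2 * t * (\<Sum>i\<in>I. l i * d i) + t\<^sup>2 * (\<Sum>i\<in>I. (d i)\<^sup>2)"
    by (simp add: \<Phi>a sum.distrib sum_subtractf sum_distrib_left)
  also have "\<dots> \<le> \<Phi> a - 2 * t * \<Phi> a + t\<^sup>2 * R"
  proof -
    have "2 * t * \<Phi> a \<le> 2 * t * (\<Sum>i\<in>I. l i * d i)" using ld t by (intro mult_left_mono) auto
    moreover have "t\<^sup>2 * (\<Sum>i\<in>I. (d i)\<^sup>2) \<le> t\<^sup>2 * R" using dR by (intro mult_left_mono) auto
    ultimately show ?thesis by linarith
  qed
  also have "t\<^sup>2 * R \<le> t * m"
    using mult_left_mono[OF tR, of t] t by (simp add: power2_eq_square mult.assoc)
  also have "\<Phi> a - 2 * t * \<Phi> a + t * m \<le> \<Phi> a - t * m"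
    using mult_left_mono[OF m_le[OF a(1)], of "2 * t"] t by simp
  also have "\<dots> < m" using a(2) by simp
  finally show False using m_le[OF c(1)] by simp
qed

text \<open>The sets on which finitely many $g_i$ are at least $-e$ are nonempty by the previous lemma, so
  compactness gives a point that lies in all of them.\<close>

lemma compact_minimax:
  fixes g :: "'i \<Rightarrow> 'a \<Rightarrow> real"
  assumes C: "compactin Z C"
    and cont: "\<And>i. i \<in> \<Gamma> \<Longrightarrow> continuous_map Z euclidean (g i)"
    and conv: "\<And>a b t. \<lbrakk>a \<in> C; b \<in> C; 0 \<le> t; t \<le> 1\<rbrakk> \<Longrightarrow> \<exists>c\<in>C. \<forall>i\<in>\<Gamma>. g i c = (1 - t) * g i a + t * g i b"
    and wt: "\<And>I l. \<lbrakk>finite I; I \<subseteq> \<Gamma>; \<And>i. i \<in> I \<Longrightarrow> 0 \<le> l i\<rbrakk> \<Longrightarrow> \<exists>a\<in>C. 0 \<le> (\<Sum>i\<in>I. l i * g i a)"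
  shows "\<exists>a\<in>C. \<forall>i\<in>\<Gamma>. 0 \<le> g i a"
proof -
  define U where "U q = {a \<in> topspace Z. - snd q \<le> g (fst q) a}" for q
  define Q where "Q = \<Gamma> \<times> {e::real. e > 0}"
  have CZ: "C \<subseteq> topspace Z" using C by (rule compactin_subset_topspace)
  have "C \<inter> \<Inter> (U ` Q) \<noteq> {}"
  proof (rule compactin_fip[THEN iffD1, THEN conjunct2, rule_format, OF C], intro conjI ballI allI impI)
    fix W assume "W \<in> U ` Q"
    then obtain q where q: "q \<in> Q" "W = U q" by blast
    have "closedin Z {a \<in> topspace Z. g (fst q) a \<in> {- snd q..}}"
      using q cont by (intro closedin_continuous_map_preimage[where Y = euclidean]) (auto simp: Q_def)
    then show "closedin Z W" using q by (simp add: U_def)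
  next
    fix \<F> assume "finite \<F> \<and> \<F> \<subseteq> U ` Q"
    then obtain P where P: "P \<subseteq> Q" "finite P" "\<F> = U ` P" by (meson finite_subset_image)
    define I where "I = fst ` P"
    define e where "e = Min (insert 1 (snd ` P))"
    have I: "finite I" "I \<subseteq> \<Gamma>" using P by (auto simp: I_def Q_def)
    have e: "e > 0" unfolding e_def using P by (subst Min_gr_iff) (auto simp: Q_def)
    have "\<exists>K. \<forall>a\<in>C. \<bar>g i a\<bar> \<le> K" if "i \<in> I" for i
    proof -
      have "compact (g i ` C)" using image_compactin[OF C cont] that I by (auto simp: compactin_euclidean_iff)
      then show ?thesis by (auto dest!: compact_imp_bounded simp: bounded_iff)
    qed
    then obtain K0 where K0: "\<And>i a. \<lbrakk>i \<in> I; a \<in> C\<rbrakk> \<Longrightarrow> \<bar>g i a\<bar> \<le> K0 i" by metis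
    have K: "\<bar>g i a\<bar> \<le> (\<Sum>i\<in>I. \<bar>K0 i\<bar>)" if "i \<in> I" "a \<in> C" for i a
      using K0[OF that] member_le_sum[of i I "\<lambda>i. \<bar>K0 i\<bar>"] that I by simp
    have "\<exists>a\<in>C. \<forall>i\<in>I. - e < g i a"
    proof (rule approximate_minimax[OF I(1) _ K _ e])
      show "\<exists>c\<in>C. \<forall>i\<in>I. g i c = (1 - t) * g i a + t * g i b"
        if "a \<in> C" "b \<in> C" "0 \<le> t" "t \<le> 1" for a b t
        using conv[OF that] I by blast
      show "\<exists>a\<in>C. 0 \<le> (\<Sum>i\<in>I. l i * g i a)" if "\<And>i. i \<in> I \<Longrightarrow> 0 \<le> l i" for l
        using wt[OF I that] .
    qed
    then obtain a where a: "a \<in> C" "\<And>i. i \<in> I \<Longrightarrow> - e < g i a" by blast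
    have "a \<in> U q" if "q \<in> P" for q
    proof -
      have "e \<le> snd q" unfolding e_def using P that by (intro Min_le) auto
      moreover have "- e < g (fst q) a" using that by (intro a(2)) (auto simp: I_def)
      ultimately show ?thesis using a(1) CZ by (auto simp: U_def)
    qed
    then show "C \<inter> \<Inter> \<F> \<noteq> {}" using a(1) P by blast
  qed
  then obtain a where a: "a \<in> C" "\<And>q. q \<in> Q \<Longrightarrow> a \<in> U q" by blast
  have "0 \<le> g i a" if "i \<in> \<Gamma>" for i
  proof (rule field_le_epsilon)
    fix e :: real assume "e > 0"
    then show "0 \<le> g i a + e" using a(2)[of "(i, e)"] that by (simp add: U_def Q_def)
  qed
  with a(1) show ?thesis by blast
qed


section \<open>Compactness of the unit ball of a dual space\<close>

lemma dual_pairing_bound: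
  assumes dual: "is_dual V F p" and m: "m \<in> carrier V" and f: "f \<in> carrier F"
  shows "cmod (p m f) \<le> nrm V m * nrm F f"
proof -
  interpret F: complex_banach F using dual by (simp add: is_dual_def)
  have bl: "bounded_linear_on F scalars (p m)" and nm: "op_norm F scalars (p m) = nrm V m"
    using dual m by (auto simp: is_dual_def)
  obtain B where B: "\<And>x. x \<in> carrier F \<Longrightarrow> cmod (p m x) \<le> B * nrm F x"
    using bl unfolding bounded_linear_on_def scalars_def by auto
  have scl: "\<And>c x. x \<in> carrier F \<Longrightarrow> p m (c *\<^sub>C x) = c * p m x"
    using bl by (auto simp: bounded_linear_on_def linear_maps_on_def scaleC_complex_def)
  show ?thesis
  proof (cases "nrm F f = 0")
    case True
    then show ?thesis using B[OF f] by simp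
  next
    case False
    then have pos: "nrm F f > 0" using F.nrm_nonneg[OF f] by simp
    define z where "z = complex_of_real (1 / nrm F f) *\<^sub>C f"
    have z: "z \<in> carrier F" "nrm F z \<le> 1"
      using f pos F.nrm_scaleC[OF f] complex_vector.subspace_scale[OF F.subspace f]
      by (simp_all add: z_def norm_divide)
    have "nrm scalars (p m z) \<le> op_norm F scalars (p m)"
      unfolding op_norm_def
    proof (rule cSUP_upper)
      show "bdd_above ((\<lambda>x. nrm scalars (p m x)) ` {x \<in> carrier F. nrm F x \<le> 1})"
      proof (rule bdd_aboveI2)
        fix x assume "x \<in> {x \<in> carrier F. nrm F x \<le> 1}"
        then have x: "x \<in> carrier F" "nrm F x \<le> 1" by auto
        have "cmod (p m x) \<le> \<bar>B\<bar> * nrm F x"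
          using B[OF x(1)] F.nrm_nonneg[OF x(1)] by (meson abs_ge_self mult_right_mono order_trans)
        also have "\<dots> \<le> \<bar>B\<bar>" using x(2) by (simp add: mult_left_le)
        finally show "nrm scalars (p m x) \<le> \<bar>B\<bar>" by (simp add: scalars_def)
      qed
    qed (use z in auto)
    then have "cmod (p m z) \<le> nrm V m" unfolding nm by (simp add: scalars_def)
    moreover have "cmod (p m z) = cmod (p m f) / nrm F f"
      using pos by (simp add: z_def scl f norm_mult norm_divide)
    ultimately show ?thesis using pos by (simp add: field_simps)
  qed
qed

lemma dual_norm_le:
  assumes dual: "is_dual V F p" and m: "m \<in> carrier V" and C: "0 \<le> C"
    and bd: "\<And>f. f \<in> carrier F \<Longrightarrow> cmod (p m f) \<le> C * nrm F f"
  shows "nrm V m \<le> C"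
proof -
  interpret F: complex_banach F using dual by (simp add: is_dual_def)
  have zero: "0 \<in> carrier F" "nrm F 0 = 0"
    using complex_vector.subspace_0[OF F.subspace] F.nrm_eq_0 by blast+
  have "op_norm F scalars (p m) \<le> C"
    unfolding op_norm_def
  proof (rule cSUP_least)
    show "{x \<in> carrier F. nrm F x \<le> 1} \<noteq> {}" using zero by force
    fix x assume "x \<in> {x \<in> carrier F. nrm F x \<le> 1}"
    then have x: "x \<in> carrier F" "nrm F x \<le> 1" by auto
    have "cmod (p m x) \<le> C * 1" using bd[OF x(1)] mult_left_mono[OF x(2) C] by linarith
    then show "nrm scalars (p m x) \<le> C" by (simp add: scalars_def)
  qed
  then show ?thesis using dual m by (auto simp: is_dual_def)
qed

lemma dual_eqI:
  assumes V: "complex_banach V" and dual: "is_dual V F p" and m: "m \<in> carrier V" and n: "n \<in> carrier V"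
    and eq: "\<And>f. f \<in> carrier F \<Longrightarrow> p m f = p n f"
  shows "m = n"
proof -
  interpret V: complex_banach V by (rule V)
  interpret F: complex_banach F using dual by (simp add: is_dual_def)
  have d: "m - n \<in> carrier V" using m n by (rule complex_vector.subspace_diff[OF V.subspace])
  have "p (m - n) f = 0" if f: "f \<in> carrier F" for f
  proof -
    have "linear_maps_on (carrier V) (\<lambda>m. p m f)" using dual f by (simp add: is_dual_def)
    then have "p (m - n + n) f = p (m - n) f + p n f" using d n unfolding linear_maps_on_def by blast
    then show ?thesis using eq[OF f] by simp
  qed
  then have "nrm V (m - n) \<le> 0" by (intro dual_norm_le[OF dual d]) auto
  then have "nrm V (m - n) = 0" using V.nrm_nonneg[OF d] by simp
  then show ?thesis using V.nrm_eq_0[OF d] by simp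
qed

text \<open>By Tychonoff's theorem, the linear maps that are bounded by $C\|f\|$ form a compact set in a
  product of discs. Representing each of them by an element of \<open>V\<close> is a continuous map onto the ball.\<close>

lemma banach_alaoglu:
  assumes V: "complex_banach V" and dual: "is_dual V F p" and C: "0 \<le> C"
  shows "compactin (weak_topology (carrier V) ((\<lambda>f m. p m f) ` carrier F)) {m \<in> carrier V. nrm V m \<le> C}"
    (is "compactin ?W ?B")
proof -
  interpret F: complex_banach F using dual by (simp add: is_dual_def)
  have F_add: "f + g \<in> carrier F" if "f \<in> carrier F" "g \<in> carrier F" for f g
    using that by (rule complex_vector.subspace_add[OF F.subspace])
  have F_scale: "c *\<^sub>C f \<in> carrier F" if "f \<in> carrier F" for f c
    using that by (rule complex_vector.subspace_scale[OF F.subspace])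
  have F_zero: "0 \<in> carrier F" by (rule complex_vector.subspace_0[OF F.subspace])
  define P where "P = product_topology (\<lambda>_. euclidean :: complex topology) (carrier F)"
  define D where "D = Pi\<^sub>E (carrier F) (\<lambda>f. cball (0::complex) (C * nrm F f))"
  define A where "A = (\<Inter>q\<in>carrier F \<times> carrier F. {z \<in> topspace P. z (fst q + snd q) - z (fst q) - z (snd q) \<in> {0}})"
  define S where "S = (\<Inter>q\<in>UNIV \<times> carrier F. {z \<in> topspace P. z (fst q *\<^sub>C snd q) - fst q * z (snd q) \<in> {0}})"
  have pr: "continuous_map P euclidean (\<lambda>z. z f)" if "f \<in> carrier F" for f
    unfolding P_def using that by (rule continuous_map_product_projection)
  have cl: "closedin P {z \<in> topspace P. k z \<in> {0}}" if "continuous_map P euclidean k" for k :: "_ \<Rightarrow> complex"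
    using that by (rule closedin_continuous_map_preimage) simp
  have "closedin P A" unfolding A_def
  proof (rule closedin_INT)
    fix q assume "q \<in> carrier F \<times> carrier F"
    then have "fst q \<in> carrier F" "snd q \<in> carrier F" by auto
    then show "closedin P {z \<in> topspace P. z (fst q + snd q) - z (fst q) - z (snd q) \<in> {0}}"
      by (intro cl continuous_map_diff pr F_add)
  qed (use F_zero in auto)
  moreover have "closedin P S" unfolding S_def
  proof (rule closedin_INT)
    fix q :: "complex \<times> _" assume "q \<in> UNIV \<times> carrier F"
    then have "snd q \<in> carrier F" by auto
    then have "continuous_map P euclidean (\<lambda>z. z (snd q))" "continuous_map P euclidean (\<lambda>z. z (fst q *\<^sub>C snd q))"
      by (simp_all add: pr F_scale)
    then show "closedin P {z \<in> topspace P. z (fst q *\<^sub>C snd q) - fst q * z (snd q) \<in> {0}}"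
      by (intro cl continuous_map_diff) (auto intro!: continuous_map_compose_continuous[where h = "\<lambda>w. fst q * w"] continuous_intros)
  qed (use F_zero in auto)
  moreover have "compactin P D"
    unfolding P_def D_def by (subst compactin_PiE) (auto simp: compactin_euclidean_iff)
  ultimately have KC: "compactin P (A \<inter> S \<inter> D)"
    by (meson closedin_Int closed_Int_compactin)
  have KE: "z \<in> A \<inter> S \<inter> D \<longleftrightarrow> z \<in> extensional (carrier F) \<and>
      (\<forall>f\<in>carrier F. \<forall>g\<in>carrier F. z (f + g) = z f + z g) \<and>
      (\<forall>c. \<forall>f\<in>carrier F. z (c *\<^sub>C f) = c * z f) \<and> (\<forall>f\<in>carrier F. cmod (z f) \<le> C * nrm F f)" for z
    using F_zero unfolding A_def S_def D_def P_def
    by (auto simp: PiE_iff diff_diff_eq)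
  have "\<exists>m\<in>carrier V. \<forall>f\<in>carrier F. p m f = z f" if "z \<in> A \<inter> S \<inter> D" for z
  proof -
    have "bounded_linear_on F scalars z"
      using that unfolding KE by (auto simp: bounded_linear_on_def linear_maps_on_def scalars_def scaleC_complex_def)
    then show ?thesis using dual by (auto simp: is_dual_def)
  qed
  then obtain h where h: "\<And>z. z \<in> A \<inter> S \<inter> D \<Longrightarrow> h z \<in> carrier V"
    "\<And>z f. \<lbrakk>z \<in> A \<inter> S \<inter> D; f \<in> carrier F\<rbrakk> \<Longrightarrow> p (h z) f = z f"
    by metis
  have "continuous_map (subtopology P (A \<inter> S \<inter> D)) ?W h"
  proof (rule continuous_map_into_weak_topology)
    show "h z \<in> carrier V" if "z \<in> topspace (subtopology P (A \<inter> S \<inter> D))" for z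
      using that h(1) by auto
    fix \<phi> assume "\<phi> \<in> (\<lambda>f m. p m f) ` carrier F"
    then obtain f where f: "f \<in> carrier F" "\<phi> = (\<lambda>m. p m f)" by auto
    show "continuous_map (subtopology P (A \<inter> S \<inter> D)) euclidean (\<lambda>z. \<phi> (h z))"
      by (rule continuous_map_eq[OF continuous_map_from_subtopology[OF pr[OF f(1)]]]) (use f h in auto)
  qed
  then have "compactin ?W (h ` (A \<inter> S \<inter> D))"
    by (rule image_compactin[rotated]) (use KC in \<open>simp add: compactin_subtopology\<close>)
  moreover have "h ` (A \<inter> S \<inter> D) = ?B"
  proof (intro equalityI subsetI)
    fix m assume "m \<in> h ` (A \<inter> S \<inter> D)"
    then obtain z where z: "z \<in> A \<inter> S \<inter> D" "m = h z" by blast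
    have "cmod (p m f) \<le> C * nrm F f" if "f \<in> carrier F" for f
      using z(1) that unfolding z(2) h(2)[OF z(1) that] KE by blast
    then have "nrm V m \<le> C"
      using z h(1) by (intro dual_norm_le[OF dual _ C]) auto
    then show "m \<in> ?B" using z h by auto
  next
    fix m assume "m \<in> ?B"
    then have m: "m \<in> carrier V" "nrm V m \<le> C" by auto
    define z where "z = restrict (p m) (carrier F)"
    have "bounded_linear_on F scalars (p m)" using dual m by (auto simp: is_dual_def)
    moreover have "cmod (p m f) \<le> C * nrm F f" if "f \<in> carrier F" for f
      using dual_pairing_bound[OF dual m(1) that] mult_right_mono[OF m(2) F.nrm_nonneg[OF that]] by linarith
    ultimately have z: "z \<in> A \<inter> S \<inter> D"
      unfolding KE z_def using F_add F_scale
      by (auto simp: bounded_linear_on_def linear_maps_on_def scaleC_complex_def)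
    have "h z = m"
      by (rule dual_eqI[OF V dual]) (use z h m in \<open>auto simp: z_def\<close>)
    then show "m \<in> h ` (A \<inter> S \<inter> D)" using z by blast
  qed
  ultimately show ?thesis by simp
qed

section \<open>Normal functionals\<close>

text \<open>The functionals of norm at most \<open>r\<close> in the predual of $\mathbb{B}(X)$: the two vectors can be
  rescaled to have equal norms, which turns the bound on the product into one on each of them.\<close>

definition normal_le :: "('v::complex_vector, 'b) chilb_scheme \<Rightarrow> real \<Rightarrow> (('v \<Rightarrow> 'v) \<Rightarrow> complex) \<Rightarrow> bool" where
  "normal_le X r \<phi> \<longleftrightarrow> (\<exists>x\<in>carrier (ell2 (UNIV :: nat set) X). \<exists>y\<in>carrier (ell2 UNIV X).
     (nrm (ell2 UNIV X) x)\<^sup>2 \<le> r \<and> (nrm (ell2 UNIV X) y)\<^sup>2 \<le> r \<and>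
     (\<forall>T\<in>operators X. \<phi> T = cinner (ell2 UNIV X) (ampl UNIV X T x) y))"

context pre_hilbert
begin

lemma normal_leI:
  assumes x: "x \<in> carrier (ell2 J X)" "(nrm (ell2 J X) x)\<^sup>2 \<le> r"
    and y: "y \<in> carrier (ell2 J X)" "(nrm (ell2 J X) y)\<^sup>2 \<le> r"
    and \<phi>: "\<And>T. T \<in> operators X \<Longrightarrow> \<phi> T = cinner (ell2 J X) (ampl J X T x) y"
  shows "normal_le X r \<phi>"
proof -
  obtain x' y' where s: "x' \<in> carrier (ell2 (UNIV :: nat set) X)" "y' \<in> carrier (ell2 UNIV X)"
    "nrm (ell2 UNIV X) x' = nrm (ell2 J X) x" "nrm (ell2 UNIV X) y' = nrm (ell2 J X) y"
    "\<And>T. T \<in> operators X \<Longrightarrow> cinner (ell2 UNIV X) (ampl UNIV X T x') y' = cinner (ell2 J X) (ampl J X T x) y"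
    using ell2_to_sequences[OF x(1) y(1)] by blast
  show ?thesis
    unfolding normal_le_def by (rule bexI[OF _ s(1)], rule bexI[OF _ s(2)]) (use s x y \<phi> in auto)
qed

lemma normal_le_continuous:
  assumes "normal_le X r \<phi>"
  shows "continuous_map (weakstar_op X) euclidean \<phi>"
proof -
  obtain x y where x: "x \<in> carrier (ell2 (UNIV :: nat set) X)" and y: "y \<in> carrier (ell2 UNIV X)"
    and \<phi>: "\<forall>T\<in>operators X. \<phi> T = cinner (ell2 UNIV X) (ampl UNIV X T x) y"
    using assms unfolding normal_le_def by blast
  show ?thesis by (rule continuous_map_eq[OF weakstar_continuous[OF x y]]) (simp add: \<phi>)
qed

lemma normal_le_bound:
  assumes \<phi>: "normal_le X r \<phi>" and T: "T \<in> operators X"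
  shows "cmod (\<phi> T) \<le> r * op_norm X X T"
proof -
  interpret E: pre_hilbert "ell2 UNIV X" by (rule ell2_pre_hilbert)
  obtain x y where x: "x \<in> carrier (ell2 (UNIV :: nat set) X)" "(nrm (ell2 UNIV X) x)\<^sup>2 \<le> r"
    and y: "y \<in> carrier (ell2 UNIV X)" "(nrm (ell2 UNIV X) y)\<^sup>2 \<le> r"
    and eq: "\<forall>T\<in>operators X. \<phi> T = cinner (ell2 UNIV X) (ampl UNIV X T x) y"
    using \<phi> unfolding normal_le_def by blast
  let ?a = "nrm (ell2 UNIV X) x" and ?b = "nrm (ell2 UNIV X) y" and ?n = "op_norm X X T"
  have "cmod (\<phi> T) \<le> nrm (ell2 UNIV X) (ampl UNIV X T x) * ?b"
    using eq T E.cauchy_schwarz[OF ampl_closed(1)[OF T x(1)] y(1)] by simp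
  also have "\<dots> \<le> (?n * ?a) * ?b"
    by (rule mult_right_mono[OF ampl_closed(2)[OF T x(1)] E.nrm_ge_0[OF y(1)]])
  also have "\<dots> = ?n * (?a * ?b)" by simp
  also have "\<dots> \<le> ?n * r"
  proof (rule mult_left_mono[OF _ op_norm_nonneg[OF T]])
    show "?a * ?b \<le> r" using sum_squares_bound[of ?a ?b] x(2) y(2) by linarith
  qed
  finally show ?thesis by (simp add: mult.commute)
qed

lemma normal_le_zero: "normal_le X 0 (\<lambda>_. 0)"
proof -
  interpret E: pre_hilbert "ell2 UNIV X" by (rule ell2_pre_hilbert)
  show ?thesis
  proof (rule normal_leI[where x = 0 and y = 0 and J = "UNIV :: nat set"])
    fix T assume T: "T \<in> operators X"
    show "0 = cinner (ell2 (UNIV :: nat set) X) (ampl UNIV X T 0) 0"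
      by (rule E.ip_zero_right[symmetric]) (rule ampl_closed(1)[OF T E.zero_in])
  qed (simp_all add: E.zero_in E.nrm_zero)
qed

lemma normal_le_rank_one:
  assumes x: "x \<in> carrier X" "(nrm X x)\<^sup>2 \<le> r" and y: "y \<in> carrier X" "(nrm X y)\<^sup>2 \<le> r"
  shows "normal_le X r (\<lambda>T. cinner X (T x) y)"
proof (rule normal_leI[where x = "delta () x" and y = "delta () y" and J = UNIV])
  have u: "() \<in> UNIV" by simp
  show "delta () x \<in> carrier (ell2 UNIV X)" "delta () y \<in> carrier (ell2 UNIV X)"
    using x y by (simp_all add: delta_in)
  show "(nrm (ell2 UNIV X) (delta () x))\<^sup>2 \<le> r" "(nrm (ell2 UNIV X) (delta () y))\<^sup>2 \<le> r"
    unfolding delta_nrm[OF u x(1)] delta_nrm[OF u y(1)] using x y by blast+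
  fix T assume T: "T \<in> operators X"
  have "delta () x \<in> carrier (ell2 UNIV X)" using x by (simp add: delta_in)
  then show "cinner X (T x) y = cinner (ell2 UNIV X) (ampl UNIV X T (delta () x)) (delta () y)"
    using delta_ip_right[OF u y(1) ampl_closed(1)[OF T]] by (simp add: ampl_at) (simp add: delta_def)
qed

lemma normal_le_scale:
  assumes "normal_le X r \<phi>"
  shows "normal_le X (cmod c * r) (\<lambda>T. c * \<phi> T)"
proof -
  interpret E: pre_hilbert "ell2 UNIV X" by (rule ell2_pre_hilbert)
  obtain x y where x: "x \<in> carrier (ell2 (UNIV :: nat set) X)" "(nrm (ell2 UNIV X) x)\<^sup>2 \<le> r"
    and y: "y \<in> carrier (ell2 UNIV X)" "(nrm (ell2 UNIV X) y)\<^sup>2 \<le> r"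
    and eq: "\<And>T. T\<in>operators X \<Longrightarrow> \<phi> T = cinner (ell2 UNIV X) (ampl UNIV X T x) y"
    using assms unfolding normal_le_def by blast
  \<comment> \<open>The scalar is distributed evenly over both vectors.\<close>
  define a where "a = csqrt c"
  have a: "a * a = c" unfolding a_def by (metis power2_csqrt power2_eq_square)
  then have ac: "(cmod a)\<^sup>2 = cmod c" by (metis norm_mult power2_eq_square)
  show ?thesis
  proof (rule normal_leI[where x = "a *\<^sub>C x" and y = "cnj a *\<^sub>C y" and J = UNIV])
    show "(nrm (ell2 UNIV X) (a *\<^sub>C x))\<^sup>2 \<le> cmod c * r" "(nrm (ell2 UNIV X) (cnj a *\<^sub>C y))\<^sup>2 \<le> cmod c * r"
      using x y by (simp_all add: E.nrm_scale power_mult_distrib ac mult_left_mono)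
    fix T assume T: "T \<in> operators X"
    note aT = ampl_in[OF T, of UNIV]
    show "c * \<phi> T = cinner (ell2 UNIV X) (ampl UNIV X T (a *\<^sub>C x)) (cnj a *\<^sub>C y)"
      using x(1) y(1) E.op_in[OF aT, of x]
      by (simp add: E.op_scale[OF aT] E.ip_scale_left E.ip_scale_right eq[OF T] a[symmetric])
  qed (use x y in \<open>simp_all add: E.scale_in\<close>)
qed

text \<open>A sequence of square-summable sequences is one family over $\mathbb{N} \times \mathbb{N}$. This is the
  completeness of the predual.\<close>

lemma normal_le_sums:
  assumes \<phi>: "\<And>k::nat. normal_le X (r k) (\<phi> k)"
    and r: "r sums R"
    and sums: "\<And>T. T \<in> operators X \<Longrightarrow> (\<lambda>k. \<phi> k T) sums \<psi> T"
  shows "normal_le X R \<psi>"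
proof -
  interpret E: pre_hilbert "ell2 (UNIV :: nat set) X" by (rule ell2_pre_hilbert)
  obtain x y where x: "\<And>k. x k \<in> carrier (ell2 (UNIV :: nat set) X)" "\<And>k. (nrm (ell2 UNIV X) (x k))\<^sup>2 \<le> r k"
    and y: "\<And>k. y k \<in> carrier (ell2 (UNIV :: nat set) X)" "\<And>k. (nrm (ell2 UNIV X) (y k))\<^sup>2 \<le> r k"
    and eq: "\<And>k T. T\<in>operators X \<Longrightarrow> \<phi> k T = cinner (ell2 UNIV X) (ampl UNIV X T (x k)) (y k)"
    using \<phi> unfolding normal_le_def by metis
  have r0: "0 \<le> r k" for k using x(2)[of k] by (meson order_trans zero_le_power2)
  have rs: "(r has_sum R) UNIV" using r r0 by (intro sums_nonneg_imp_has_sum) auto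
  have *: "z \<in> carrier (ell2 UNIV (ell2 UNIV X)) \<and> (nrm (ell2 UNIV (ell2 UNIV X)) z)\<^sup>2 \<le> R"
    if z: "\<And>k. z k \<in> carrier (ell2 (UNIV :: nat set) X)" "\<And>k. (nrm (ell2 UNIV X) (z k))\<^sup>2 \<le> r k" for z
  proof
    have sm: "(\<lambda>k. (nrm (ell2 UNIV X) (z k))\<^sup>2) summable_on UNIV"
      by (rule summable_on_comparison_test[OF has_sum_imp_summable[OF rs]]) (simp_all add: z)
    then show "z \<in> carrier (ell2 UNIV (ell2 UNIV X))" by (intro E.ell2I) (simp_all add: z)
    show "(nrm (ell2 UNIV (ell2 UNIV X)) z)\<^sup>2 \<le> R"
      unfolding ell2_nrm_sq[of UNIV "ell2 UNIV X"] infsumI[OF rs, symmetric]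
      by (rule infsum_mono[OF sm has_sum_imp_summable[OF rs] z(2)])
  qed
  have X: "x \<in> carrier (ell2 UNIV (ell2 UNIV X))" "(nrm (ell2 UNIV (ell2 UNIV X)) x)\<^sup>2 \<le> R"
    and Y: "y \<in> carrier (ell2 UNIV (ell2 UNIV X))" "(nrm (ell2 UNIV (ell2 UNIV X)) y)\<^sup>2 \<le> R"
    using *[OF x] *[OF y] by blast+
  show ?thesis
  proof (rule normal_leI)
    show "(\<lambda>(i, j). x i j) \<in> carrier (ell2 (UNIV \<times> UNIV) X)" by (rule uncurry_in[OF X(1)])
    show "(\<lambda>(i, j). y i j) \<in> carrier (ell2 (UNIV \<times> UNIV) X)" by (rule uncurry_in[OF Y(1)])
    show "(nrm (ell2 (UNIV \<times> UNIV) X) (\<lambda>(i, j). x i j))\<^sup>2 \<le> R" "(nrm (ell2 (UNIV \<times> UNIV) X) (\<lambda>(i, j). y i j))\<^sup>2 \<le> R"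
      using X(2) Y(2) unfolding uncurry_nrm[OF X(1)] uncurry_nrm[OF Y(1)] .
    fix T assume T: "T \<in> operators X"
    note aT = ampl_in[OF T, of UNIV]
    let ?z = "ampl UNIV (ell2 UNIV X) (ampl UNIV X T) x"
    have z: "?z \<in> carrier (ell2 UNIV (ell2 UNIV X))" by (rule E.ampl_closed(1)[OF aT X(1)])
    have "((\<lambda>k. cinner (ell2 UNIV X) (?z k) (y k)) has_sum cinner (ell2 UNIV (ell2 UNIV X)) ?z y) UNIV"
      unfolding ell2_cinner[of UNIV "ell2 UNIV X"] by (rule has_sum_infsum[OF E.ell2_ip_summable[OF z Y(1)]])
    then have "(\<lambda>k. \<phi> k T) sums cinner (ell2 UNIV (ell2 UNIV X)) ?z y"
      using has_sum_imp_sums by (simp add: eq[OF T] E.ampl_at[OF X(1)])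
    then have "\<psi> T = cinner (ell2 UNIV (ell2 UNIV X)) ?z y"
      using sums[OF T] sums_unique2 by blast
    also have "\<dots> = cinner (ell2 (UNIV \<times> UNIV) X) (\<lambda>(i, j). ?z i j) (\<lambda>(i, j). y i j)"
      by (rule uncurry_ip[OF z Y(1)])
    also have "(\<lambda>(i, j). ?z i j) = ampl (UNIV \<times> UNIV) X T (\<lambda>(i, j). x i j)"
      using uncurry_in[OF X(1)] by (auto simp: E.ampl_at[OF X(1)] ampl_at x(1))
    finally show "\<psi> T = cinner (ell2 (UNIV \<times> UNIV) X) (ampl (UNIV \<times> UNIV) X T (\<lambda>(i, j). x i j)) (\<lambda>(i, j). y i j)" .
  qed
qed

lemma normal_le_add:
  assumes "normal_le X r \<phi>" "normal_le X s \<psi>"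
  shows "normal_le X (r + s) (\<lambda>T. \<phi> T + \<psi> T)"
proof (rule normal_le_sums[where r = "\<lambda>k::nat. if k = 0 then r else if k = 1 then s else 0"
      and \<phi> = "\<lambda>k::nat. if k = 0 then \<phi> else if k = 1 then \<psi> else (\<lambda>_. 0)"])
  show "normal_le X (if k = 0 then r else if k = 1 then s else 0) (if k = 0 then \<phi> else if k = 1 then \<psi> else (\<lambda>_. 0))"
    for k :: nat using assms normal_le_zero by simp
  show "(\<lambda>k::nat. if k = 0 then r else if k = 1 then s else 0) sums (r + s)"
    using sums_finite[of "{0, 1::nat}" "\<lambda>k. if k = 0 then r else if k = 1 then s else 0"] by auto
  show "(\<lambda>k::nat. (if k = 0 then \<phi> else if k = 1 then \<psi> else (\<lambda>_. 0)) T) sums (\<phi> T + \<psi> T)" for T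
    using sums_finite[of "{0, 1::nat}" "\<lambda>k. (if k = 0 then \<phi> else if k = 1 then \<psi> else (\<lambda>_. 0)) T"] by auto
qed

lemma normal_le_sum:
  assumes "finite I" "\<And>i. i \<in> I \<Longrightarrow> normal_le X (r i) (\<phi> i)"
  shows "normal_le X (\<Sum>i\<in>I. r i) (\<lambda>T. \<Sum>i\<in>I. \<phi> i T)"
  using assms by (induction I rule: finite_induct) (simp_all add: normal_le_zero normal_le_add)

lemma normal_le_diff:
  assumes "normal_le X r \<phi>" "normal_le X s \<psi>"
  shows "normal_le X (r + s) (\<lambda>T. \<phi> T - \<psi> T)"
  using normal_le_add[OF assms(1) normal_le_scale[OF assms(2), of "-1"]] by simp

lemma normal_le_linear:
  assumes "normal_le X r \<phi>"
  shows "S \<in> operators X \<Longrightarrow> T \<in> operators X \<Longrightarrow> \<phi> (S + T) = \<phi> S + \<phi> T"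
    and "T \<in> operators X \<Longrightarrow> \<phi> (c *\<^sub>C T) = c * \<phi> T"
proof -
  interpret E: pre_hilbert "ell2 UNIV X" by (rule ell2_pre_hilbert)
  obtain x y where x: "x \<in> carrier (ell2 (UNIV :: nat set) X)" and y: "y \<in> carrier (ell2 UNIV X)"
    and eq: "\<And>T. T\<in>operators X \<Longrightarrow> \<phi> T = cinner (ell2 UNIV X) (ampl UNIV X T x) y"
    using assms unfolding normal_le_def by blast
  show "\<phi> (S + T) = \<phi> S + \<phi> T" if S: "S \<in> operators X" and T: "T \<in> operators X"
  proof -
    have "ampl UNIV X (S + T) x = ampl UNIV X S x + ampl UNIV X T x" by (auto simp: ampl_at[OF x])
    then show ?thesis
      using S T x y by (simp add: eq op_plus_in E.ip_add_left ampl_closed(1))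
  qed
  show "\<phi> (c *\<^sub>C T) = c * \<phi> T" if T: "T \<in> operators X"
  proof -
    have "ampl UNIV X (c *\<^sub>C T) x = c *\<^sub>C ampl UNIV X T x" by (auto simp: ampl_at[OF x])
    then show ?thesis
      using T x y by (simp add: eq op_scaleC_in E.ip_scale_left ampl_closed(1))
  qed
qed

end

section \<open>Isometric images of dual spaces are weak$^*$-closed\<close>

text \<open>
  The closedness proof in this locale is the closed range theorem for the preadjoint of \<open>\<pi>\<close>. As the
  separation theorem is replaced by minimax on the compact unit ball of \<open>V\<close>, functionals are only ever
  compared on that ball.
\<close>

locale dual_embedding = complex_hilbert X + V: complex_banach V
  for X :: "('x::complex_vector, 'b) chilb_scheme"
    and V :: "'m::complex_vector cnormed" +
  fixes F :: "'f::complex_vector cnormed" and p :: "'m \<Rightarrow> 'f \<Rightarrow> complex" and \<pi> :: "'m \<Rightarrow> 'x \<Rightarrow> 'x"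
  assumes dual: "is_dual V F p"
    and emb_in: "m \<in> carrier V \<Longrightarrow> \<pi> m \<in> operators X"
    and emb_linear: "linear_maps_on (carrier V) \<pi>"
    and emb_isometric: "m \<in> carrier V \<Longrightarrow> op_norm X X (\<pi> m) = nrm V m"
    and emb_continuous:
      "continuous_map (weak_topology (carrier V) ((\<lambda>f m. p m f) ` carrier F)) (weakstar_op X) \<pi>"
begin

abbreviation "ball_V c \<equiv> {m \<in> carrier V. nrm V m \<le> c}"
abbreviation "top_V \<equiv> weak_topology (carrier V) ((\<lambda>f m. p m f) ` carrier F)"

lemma V_add: "\<lbrakk>m \<in> carrier V; n \<in> carrier V\<rbrakk> \<Longrightarrow> m + n \<in> carrier V"
  by (rule complex_vector.subspace_add[OF V.subspace])

lemma V_scale: "m \<in> carrier V \<Longrightarrow> c *\<^sub>C m \<in> carrier V"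
  by (rule complex_vector.subspace_scale[OF V.subspace])

lemma V_zero: "0 \<in> carrier V"
  by (rule complex_vector.subspace_0[OF V.subspace])

lemma V_nrm_zero: "nrm V 0 = 0"
  using V.nrm_eq_0[OF V_zero] by simp

lemma emb_add: "\<lbrakk>m \<in> carrier V; n \<in> carrier V\<rbrakk> \<Longrightarrow> \<pi> (m + n) = \<pi> m + \<pi> n"
  using emb_linear by (simp add: linear_maps_on_def)

lemma emb_scale: "m \<in> carrier V \<Longrightarrow> \<pi> (c *\<^sub>C m) = c *\<^sub>C \<pi> m"
  using emb_linear by (simp add: linear_maps_on_def)

lemma normal_emb_linear:
  assumes "normal_le X r \<phi>"
  shows "\<lbrakk>m \<in> carrier V; n \<in> carrier V\<rbrakk> \<Longrightarrow> \<phi> (\<pi> (m + n)) = \<phi> (\<pi> m) + \<phi> (\<pi> n)"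
    and "m \<in> carrier V \<Longrightarrow> \<phi> (\<pi> (c *\<^sub>C m)) = c * \<phi> (\<pi> m)"
  using normal_le_linear[OF assms] by (simp_all add: emb_add emb_scale emb_in)

lemma normal_emb_continuous:
  assumes "normal_le X r \<phi>"
  shows "continuous_map top_V euclidean (\<lambda>m. Re (\<phi> (\<pi> m)))"
  using continuous_map_compose[OF emb_continuous normal_le_continuous[OF assms]]
  by (intro continuous_map_compose_continuous[where h = Re]) (auto simp: o_def intro: continuous_intros)

lemma compact_ball: "0 \<le> c \<Longrightarrow> compactin top_V (ball_V c)"
  by (rule banach_alaoglu[OF V.complex_banach_axioms dual])

lemma ball_convex:
  assumes a: "a \<in> ball_V c" and b: "b \<in> ball_V c" and t: "0 \<le> t" "t \<le> 1"
  shows "complex_of_real (1 - t) *\<^sub>C a + complex_of_real t *\<^sub>C b \<in> ball_V c"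
proof -
  let ?a = "complex_of_real (1 - t) *\<^sub>C a" and ?b = "complex_of_real t *\<^sub>C b"
  have m: "?a \<in> carrier V" "?b \<in> carrier V" using a b by (simp_all add: V_scale)
  have "nrm V (?a + ?b) \<le> nrm V ?a + nrm V ?b" by (rule V.nrm_triangle[OF m])
  also have "\<dots> = (1 - t) * nrm V a + t * nrm V b"
    using a b t by (simp add: V.nrm_scaleC del: of_real_diff)
  also have "\<dots> \<le> (1 - t) * c + t * c"
    using a b t by (intro add_mono mult_left_mono) auto
  also have "\<dots> = c" by (simp add: algebra_simps)
  finally show ?thesis using V_add[OF m] by (simp del: of_real_diff)
qed

lemma normal_emb_convex:
  assumes "normal_le X r \<phi>" "a \<in> carrier V" "b \<in> carrier V"
  shows "Re (\<phi> (\<pi> (complex_of_real (1 - t) *\<^sub>C a + complex_of_real t *\<^sub>C b)))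
    = (1 - t) * Re (\<phi> (\<pi> a)) + t * Re (\<phi> (\<pi> b))"
  using assms(2,3) by (simp add: normal_emb_linear[OF assms(1)] V_scale del: of_real_diff)

lemma rotate:
  assumes \<phi>: "normal_le X r \<phi>" and m: "m \<in> ball_V c"
  obtains n where "n \<in> ball_V c" "Re (\<phi> (\<pi> n)) = cmod (\<phi> (\<pi> m))"
proof -
  let ?z = "\<phi> (\<pi> m)"
  define u where "u = (if ?z = 0 then 1 else cnj ?z / cmod ?z)"
  have "cmod u = 1" by (simp add: u_def norm_divide)
  have "u * ?z = cmod ?z"
    using complex_norm_square[of ?z] by (simp add: u_def field_simps power2_eq_square)
  then have "Re (\<phi> (\<pi> (u *\<^sub>C m))) = cmod ?z"
    using m by (simp add: normal_emb_linear[OF \<phi>])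
  moreover have "u *\<^sub>C m \<in> ball_V c"
    using m \<open>cmod u = 1\<close> by (simp add: V_scale V.nrm_scaleC)
  ultimately show ?thesis using that by blast
qed

lemma normal_emb_bound:
  assumes \<phi>: "normal_le X r \<phi>" and bd: "\<And>m. m \<in> ball_V 1 \<Longrightarrow> cmod (\<phi> (\<pi> m)) \<le> s"
    and m: "m \<in> carrier V"
  shows "cmod (\<phi> (\<pi> m)) \<le> s * nrm V m"
proof (cases "m = 0")
  case True
  then show ?thesis using normal_emb_linear(2)[OF \<phi> m, of 0] V_nrm_zero by simp
next
  case False
  then have pos: "nrm V m > 0" using V.nrm_nonneg[OF m] V.nrm_eq_0[OF m] by (simp add: less_le)
  let ?n = "complex_of_real (1 / nrm V m) *\<^sub>C m"
  have "?n \<in> ball_V 1" using m pos by (simp add: V_scale V.nrm_scaleC norm_divide)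
  from bd[OF this] show ?thesis
    using pos by (simp add: normal_emb_linear(2)[OF \<phi> m] norm_mult norm_divide field_simps)
qed

text \<open>
  If every $\psi$ of norm at most 1 differed from $\varphi$ by more than $e$ somewhere on the ball, minimax
  would give one \<open>m\<close> in the ball with $\mathrm{Re}\,\psi(\pi(m)) \le \mathrm{Re}\,\varphi(\pi(m)) - e$ for all
  these $\psi$. The supremum over $\psi$ of rank one is $\|\pi(m)\| = \|m\|$, which contradicts
  $|\varphi(\pi(m))| \le \|m\|$.
\<close>

lemma normal_approximation:
  assumes \<phi>: "normal_le X r \<phi>" and bd: "\<And>m. m \<in> ball_V 1 \<Longrightarrow> cmod (\<phi> (\<pi> m)) \<le> 1" and e: "e > 0"
  shows "\<exists>\<psi>. normal_le X 1 \<psi> \<and> (\<forall>m\<in>ball_V 1. cmod (\<phi> (\<pi> m) - \<psi> (\<pi> m)) \<le> e)"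
proof (rule ccontr)
  assume neg: "\<not> ?thesis"
  have far: "\<exists>m\<in>ball_V 1. e \<le> Re (\<phi> (\<pi> m) - \<psi> (\<pi> m))" if \<psi>: "normal_le X 1 \<psi>" for \<psi>
  proof -
    obtain m where m: "m \<in> ball_V 1" "e < cmod (\<phi> (\<pi> m) - \<psi> (\<pi> m))"
      using neg \<psi> not_less by blast
    obtain n where "n \<in> ball_V 1" "Re (\<phi> (\<pi> n) - \<psi> (\<pi> n)) = cmod (\<phi> (\<pi> m) - \<psi> (\<pi> m))"
      using rotate[OF normal_le_diff[OF \<phi> \<psi>] m(1)] by blast
    then show ?thesis using m(2) by (metis less_imp_le)
  qed
  define \<Gamma> where "\<Gamma> = {\<psi>. normal_le X 1 \<psi>}"
  define g where "g \<psi> m = Re (\<phi> (\<pi> m)) - Re (\<psi> (\<pi> m)) - e" for \<psi> m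
  have "\<exists>m\<in>ball_V 1. \<forall>\<psi>\<in>\<Gamma>. 0 \<le> g \<psi> m"
  proof (rule compact_minimax[OF compact_ball])
    fix \<psi> assume "\<psi> \<in> \<Gamma>"
    then have "normal_le X 1 \<psi>" by (simp add: \<Gamma>_def)
    then show "continuous_map top_V euclidean (g \<psi>)"
      unfolding g_def by (intro continuous_map_diff normal_emb_continuous[OF \<phi>] normal_emb_continuous) auto
  next
    fix a b and t :: real assume a: "a \<in> ball_V 1" and b: "b \<in> ball_V 1" and t: "0 \<le> t" "t \<le> 1"
    let ?c = "complex_of_real (1 - t) *\<^sub>C a + complex_of_real t *\<^sub>C b"
    have "g \<psi> ?c = (1 - t) * g \<psi> a + t * g \<psi> b" if "\<psi> \<in> \<Gamma>" for \<psi>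
    proof -
      have "normal_le X 1 \<psi>" using that by (simp add: \<Gamma>_def)
      then show ?thesis
        using a b unfolding g_def by (simp only: normal_emb_convex[OF \<phi>] normal_emb_convex mem_Collect_eq) (simp add: algebra_simps)
    qed
    then show "\<exists>c\<in>ball_V 1. \<forall>\<psi>\<in>\<Gamma>. g \<psi> c = (1 - t) * g \<psi> a + t * g \<psi> b"
      using ball_convex[OF a b t] by blast
  next
    fix I and l :: "_ \<Rightarrow> real"
    assume I: "finite I" "I \<subseteq> \<Gamma>" and l: "\<And>\<psi>. \<psi> \<in> I \<Longrightarrow> 0 \<le> l \<psi>"
    define L where "L = sum l I"
    have L0: "0 \<le> L" unfolding L_def using l by (rule sum_nonneg)
    show "\<exists>m\<in>ball_V 1. 0 \<le> (\<Sum>\<psi>\<in>I. l \<psi> * g \<psi> m)"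
    proof (cases "L = 0")
      case True
      then have "l \<psi> = 0" if "\<psi> \<in> I" for \<psi>
        using that l I(1) unfolding L_def by (simp add: sum_nonneg_eq_0_iff)
      then show ?thesis using V_zero V_nrm_zero by (intro bexI[of _ 0]) auto
    next
      case False
      then have L: "L > 0" using L0 by simp
      define \<psi> where "\<psi> T = (\<Sum>\<omega>\<in>I. complex_of_real (l \<omega> / L) * \<omega> T)" for T
      have "normal_le X (\<Sum>\<omega>\<in>I. cmod (complex_of_real (l \<omega> / L)) * 1) \<psi>"
        unfolding \<psi>_def using I by (intro normal_le_sum normal_le_scale) (auto simp: \<Gamma>_def)
      also have "(\<Sum>\<omega>\<in>I. cmod (complex_of_real (l \<omega> / L)) * 1) = (\<Sum>\<omega>\<in>I. l \<omega> / L)"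
        using l L by (intro sum.cong) (simp_all add: norm_divide)
      also have "\<dots> = 1" using L by (simp add: L_def sum_divide_distrib[symmetric])
      finally obtain m where m: "m \<in> ball_V 1" "e \<le> Re (\<phi> (\<pi> m) - \<psi> (\<pi> m))"
        using far by blast
      have "L * Re (\<psi> (\<pi> m)) = (\<Sum>\<omega>\<in>I. l \<omega> * Re (\<omega> (\<pi> m)))"
        unfolding \<psi>_def Re_sum sum_distrib_left using L by (intro sum.cong) auto
      then have "(\<Sum>\<omega>\<in>I. l \<omega> * g \<omega> m) = L * (Re (\<phi> (\<pi> m)) - Re (\<psi> (\<pi> m)) - e)"
        unfolding g_def right_diff_distrib sum_subtractf by (simp add: L_def sum_distrib_right)
      then show ?thesis using m L by (intro bexI[of _ m]) auto
    qed
  qed simp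
  then obtain m where m: "m \<in> carrier V" "nrm V m \<le> 1" and far_m: "\<And>\<psi>. normal_le X 1 \<psi> \<Longrightarrow> Re (\<psi> (\<pi> m)) \<le> Re (\<phi> (\<pi> m)) - e"
    by (force simp: g_def \<Gamma>_def)
  note T = emb_in[OF m(1)]
  have "nrm X (\<pi> m x) \<le> Re (\<phi> (\<pi> m)) - e" if x: "x \<in> carrier X" "nrm X x \<le> 1" for x
  proof -
    let ?z = "\<pi> m x"
    have z: "?z \<in> carrier X" by (rule op_in[OF T])
    define y where "y = complex_of_real (inverse (nrm X ?z)) *\<^sub>C ?z"
    have y: "y \<in> carrier X" "nrm X y \<le> 1"
      using z nrm_ge_0[OF z] by (cases "nrm X ?z = 0"; simp add: y_def nrm_scale norm_inverse)+
    have "cinner X ?z y = complex_of_real (nrm X ?z)"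
      using z by (cases "nrm X ?z = 0") (simp_all add: y_def ip_scale_right ip_self power2_eq_square)
    moreover have "(nrm X x)\<^sup>2 \<le> 1" "(nrm X y)\<^sup>2 \<le> 1"
      using x y nrm_ge_0 by (simp_all add: power_le_one)
    ultimately show ?thesis using far_m[OF normal_le_rank_one[OF x(1) _ y(1)]] by simp
  qed
  then have "nrm V m \<le> Re (\<phi> (\<pi> m)) - e"
    unfolding emb_isometric[OF m(1), symmetric] by (rule op_norm_leI)
  moreover have "Re (\<phi> (\<pi> m)) \<le> nrm V m"
    using normal_emb_bound[OF \<phi> bd m(1)] complex_Re_le_cmod[of "\<phi> (\<pi> m)"] by simp
  ultimately show False using e by simp
qed

text \<open>Approximate up to $\frac12$, double the remainder and repeat: the approximations sum up to a normal
  functional of norm at most $\sum_k 2^{-k} = 2$.\<close>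

lemma normal_extension:
  assumes \<phi>: "normal_le X r \<phi>" and bd: "\<And>m. m \<in> ball_V 1 \<Longrightarrow> cmod (\<phi> (\<pi> m)) \<le> 1"
  shows "\<exists>\<psi>. normal_le X 2 \<psi> \<and> (\<forall>m\<in>carrier V. \<psi> (\<pi> m) = \<phi> (\<pi> m))"
proof -
  define good where "good \<rho> \<longleftrightarrow> (\<exists>r. normal_le X r \<rho>) \<and> (\<forall>m\<in>ball_V 1. cmod (\<rho> (\<pi> m)) \<le> 1)" for \<rho>
  have "\<exists>\<psi>. normal_le X 1 \<psi> \<and> good (\<lambda>T. 2 * (\<rho> T - \<psi> T))" if "good \<rho>" for \<rho>
  proof -
    obtain r where r: "normal_le X r \<rho>" "\<And>m. m \<in> ball_V 1 \<Longrightarrow> cmod (\<rho> (\<pi> m)) \<le> 1"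
      using \<open>good \<rho>\<close> unfolding good_def by blast
    obtain \<psi> where \<psi>: "normal_le X 1 \<psi>" "\<And>m. m \<in> ball_V 1 \<Longrightarrow> cmod (\<rho> (\<pi> m) - \<psi> (\<pi> m)) \<le> 1/2"
      using normal_approximation[OF r, of "1/2"] by auto
    have "cmod (2 * (\<rho> (\<pi> m) - \<psi> (\<pi> m))) \<le> 1" if "m \<in> ball_V 1" for m
      unfolding norm_mult using \<psi>(2)[OF that] by simp
    then have "good (\<lambda>T. 2 * (\<rho> T - \<psi> T))"
      unfolding good_def using normal_le_scale[OF normal_le_diff[OF r(1) \<psi>(1)], of 2] by blast
    with \<psi>(1) show ?thesis by blast
  qed
  then obtain s where s: "\<And>\<rho>. good \<rho> \<Longrightarrow> normal_le X 1 (s \<rho>)" "\<And>\<rho>. good \<rho> \<Longrightarrow> good (\<lambda>T. 2 * (\<rho> T - s \<rho> T))"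
    by metis
  define \<rho> where "\<rho> = rec_nat \<phi> (\<lambda>_ \<rho> T. 2 * (\<rho> T - s \<rho> T))"
  have \<rho>_0: "\<rho> 0 = \<phi>" and \<rho>_Suc: "\<And>k. \<rho> (Suc k) = (\<lambda>T. 2 * (\<rho> k T - s (\<rho> k) T))"
    by (simp_all add: \<rho>_def)
  have good: "good (\<rho> k)" for k
  proof (induction k)
    case 0
    show ?case unfolding \<rho>_0 good_def using \<phi> bd by blast
  next
    case (Suc k)
    then show ?case unfolding \<rho>_Suc by (rule s(2))
  qed
  define c where "c k = complex_of_real ((1/2) ^ k)" for k :: nat
  have cn: "cmod (c k) = (1/2) ^ k" for k by (simp add: c_def norm_power norm_divide)
  have partial: "\<phi> T - (\<Sum>k<n. c k * s (\<rho> k) T) = c n * \<rho> n T" for n T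
  proof (induction n)
    case 0
    show ?case by (simp add: c_def \<rho>_0)
  next
    case (Suc n)
    have "\<phi> T - (\<Sum>k<Suc n. c k * s (\<rho> k) T) = c n * \<rho> n T - c n * s (\<rho> n) T"
      using Suc by (simp add: diff_diff_eq[symmetric])
    also have "\<dots> = c (Suc n) * \<rho> (Suc n) T" by (simp add: c_def \<rho>_Suc algebra_simps)
    finally show ?case .
  qed
  define \<psi> where "\<psi> T = (\<Sum>k. c k * s (\<rho> k) T)" for T
  have geo: "(\<lambda>k. (1/2::real) ^ k) sums 2" using geometric_sums[of "1/2::real"] by simp
  have sums: "(\<lambda>k. c k * s (\<rho> k) T) sums \<psi> T" if T: "T \<in> operators X" for T
  proof -
    have sm: "summable (\<lambda>k. (1/2::real) ^ k * op_norm X X T)"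
      using sums_summable[OF geo] by (rule summable_mult2)
    have le: "norm (c k * s (\<rho> k) T) \<le> (1/2) ^ k * op_norm X X T" for k
      unfolding norm_mult cn using normal_le_bound[OF s(1)[OF good] T, of k] by (simp add: mult_left_mono)
    have "summable (\<lambda>k. c k * s (\<rho> k) T)" by (rule summable_comparison_test'[OF sm le])
    then show ?thesis unfolding \<psi>_def by (rule summable_sums)
  qed
  have "normal_le X 2 \<psi>"
  proof (rule normal_le_sums[OF _ geo sums])
    show "normal_le X ((1/2) ^ k) (\<lambda>T. c k * s (\<rho> k) T)" for k
      using normal_le_scale[OF s(1)[OF good[of k]], of "c k"] by (simp add: cn)
  qed
  moreover have "\<psi> (\<pi> m) = \<phi> (\<pi> m)" if m: "m \<in> carrier V" for m
  proof -
    have "(\<lambda>n. c n * \<rho> n (\<pi> m)) \<longlonglongrightarrow> 0"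
    proof (rule Lim_null_comparison)
      have "cmod (\<rho> n (\<pi> m)) \<le> nrm V m" for n
      proof -
        obtain r where "normal_le X r (\<rho> n)" "\<And>m. m \<in> ball_V 1 \<Longrightarrow> cmod (\<rho> n (\<pi> m)) \<le> 1"
          using good[of n] unfolding good_def by blast
        from normal_emb_bound[OF this m] show ?thesis by simp
      qed
      then show "\<forall>\<^sub>F n in sequentially. norm (c n * \<rho> n (\<pi> m)) \<le> (1/2) ^ n * nrm V m"
        unfolding norm_mult cn by (intro always_eventually) (simp add: mult_left_mono)
      show "(\<lambda>n. (1/2) ^ n * nrm V m) \<longlonglongrightarrow> 0"
        by (intro tendsto_mult_left_zero LIMSEQ_power_zero) simp
    qed
    then have "(\<lambda>n. \<phi> (\<pi> m) - (\<Sum>k<n. c k * s (\<rho> k) (\<pi> m))) \<longlonglongrightarrow> 0" by (simp add: partial)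
    moreover have "(\<lambda>n. \<phi> (\<pi> m) - (\<Sum>k<n. c k * s (\<rho> k) (\<pi> m))) \<longlonglongrightarrow> \<phi> (\<pi> m) - \<psi> (\<pi> m)"
      using sums[OF emb_in[OF m]] unfolding sums_def by (intro tendsto_diff tendsto_const)
    ultimately show ?thesis using LIMSEQ_unique by fastforce
  qed
  ultimately show ?thesis by blast
qed

text \<open>A rescaling of \<open>\<phi>\<close> extends from the image of \<open>V\<close> to a normal functional of norm at most 2. Both
  functionals are weak$^*$-continuous, so they also agree on the closure.\<close>

lemma normal_closure_bound:
  assumes \<phi>: "normal_le X r \<phi>" and bd: "\<And>m. m \<in> ball_V 1 \<Longrightarrow> cmod (\<phi> (\<pi> m)) \<le> s" and s: "s > 0"
    and T: "T \<in> weakstar_op X closure_of (\<pi> ` carrier V)"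
  shows "cmod (\<phi> T) \<le> s * (2 * op_norm X X T)"
proof -
  have TX: "T \<in> operators X" using T in_closure_of topspace_weakstar by metis
  let ?\<phi> = "\<lambda>T. complex_of_real (1 / s) * \<phi> T"
  note \<phi>' = normal_le_scale[OF \<phi>, of "complex_of_real (1 / s)"]
  have "cmod (?\<phi> (\<pi> m)) \<le> 1" if "m \<in> ball_V 1" for m
    using bd[OF that] s by (simp add: norm_mult norm_divide)
  from normal_extension[OF \<phi>' this] obtain \<psi> where \<psi>: "normal_le X 2 \<psi>"
    "\<And>m. m \<in> carrier V \<Longrightarrow> \<psi> (\<pi> m) = ?\<phi> (\<pi> m)" by blast
  have "closedin (weakstar_op X) {T \<in> topspace (weakstar_op X). \<psi> T - ?\<phi> T \<in> {0}}"
    by (rule closedin_continuous_map_preimage[where Y = euclidean])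
      (use normal_le_continuous[OF normal_le_diff[OF \<psi>(1) \<phi>']] in auto)
  moreover have "\<pi> ` carrier V \<subseteq> {T \<in> topspace (weakstar_op X). \<psi> T - ?\<phi> T \<in> {0}}"
    using \<psi>(2) emb_in by auto
  ultimately have "\<psi> T = ?\<phi> T" using T closure_of_minimal by fastforce
  then have "\<phi> T = complex_of_real s * \<psi> T" using s by simp
  then have "cmod (\<phi> T) = s * cmod (\<psi> T)" using s by (simp add: norm_mult)
  then show ?thesis
    using mult_left_mono[OF normal_le_bound[OF \<psi>(1) TX], of s] s by simp
qed

text \<open>
  For \<open>T\<close> in the closure, look for \<open>m\<close> in a fixed ball of \<open>V\<close> with $\varphi(\pi(m)) = \varphi(T)$ for
  all normal $\varphi$. By minimax it suffices to treat one $\varphi$ at a time and only the inequality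
  $\mathrm{Re}\,\varphi(\pi(m)) \ge \mathrm{Re}\,\varphi(T)$, and that is the bound on $\varphi(T)$ above.
\<close>

theorem emb_range_closed: "closedin (weakstar_op X) (\<pi> ` carrier V)"
proof -
  have "T \<in> \<pi> ` carrier V" if T: "T \<in> weakstar_op X closure_of (\<pi> ` carrier V)" for T
  proof -
    have TX: "T \<in> operators X" using T in_closure_of topspace_weakstar by metis
    \<comment> \<open>Any radius larger than \<open>2 * op_norm X X T\<close> makes the estimate below strict.\<close>
    define C where "C = 2 * op_norm X X T + 1"
    have C: "C > 0" using op_norm_nonneg[OF TX] by (simp add: C_def)
    define \<Gamma> where "\<Gamma> = {\<phi>. \<exists>r. normal_le X r \<phi>}"
    define g where "g \<phi> m = Re (\<phi> (\<pi> m)) - Re (\<phi> T)" for \<phi> m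
    have "\<exists>m\<in>ball_V C. \<forall>\<phi>\<in>\<Gamma>. 0 \<le> g \<phi> m"
    proof (rule compact_minimax[OF compact_ball])
      show "continuous_map top_V euclidean (g \<phi>)" if "\<phi> \<in> \<Gamma>" for \<phi>
        using that unfolding g_def \<Gamma>_def by (auto intro: continuous_map_diff normal_emb_continuous)
    next
      fix a b and t :: real assume a: "a \<in> ball_V C" and b: "b \<in> ball_V C" and t: "0 \<le> t" "t \<le> 1"
      let ?c = "complex_of_real (1 - t) *\<^sub>C a + complex_of_real t *\<^sub>C b"
      have "g \<phi> ?c = (1 - t) * g \<phi> a + t * g \<phi> b" if \<phi>: "\<phi> \<in> \<Gamma>" for \<phi>
      proof -
        obtain r where "normal_le X r \<phi>" using \<phi> by (auto simp: \<Gamma>_def)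
        then show ?thesis
          using a b unfolding g_def by (simp only: normal_emb_convex mem_Collect_eq) (simp add: algebra_simps)
      qed
      then show "\<exists>c\<in>ball_V C. \<forall>\<phi>\<in>\<Gamma>. g \<phi> c = (1 - t) * g \<phi> a + t * g \<phi> b"
        using ball_convex[OF a b t] by blast
    next
      fix I and l :: "_ \<Rightarrow> real"
      assume I: "finite I" "I \<subseteq> \<Gamma>" and l: "\<And>\<phi>. \<phi> \<in> I \<Longrightarrow> 0 \<le> l \<phi>"
      define \<phi> where "\<phi> S = (\<Sum>\<omega>\<in>I. complex_of_real (l \<omega>) * \<omega> S)" for S
      have "\<forall>\<omega>\<in>I. \<exists>R. normal_le X R \<omega>" using I(2) by (auto simp: \<Gamma>_def)
      then obtain R where "\<forall>\<omega>\<in>I. normal_le X (R \<omega>) \<omega>" by (rule bchoice[THEN exE])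
      then have R: "normal_le X (R \<omega>) \<omega>" if "\<omega> \<in> I" for \<omega> using that by blast
      have r: "normal_le X (\<Sum>\<omega>\<in>I. cmod (complex_of_real (l \<omega>)) * R \<omega>) \<phi>"
        unfolding \<phi>_def by (rule normal_le_sum[OF I(1)]) (rule normal_le_scale[OF R])
      have g_sum: "(\<Sum>\<omega>\<in>I. l \<omega> * g \<omega> m) = Re (\<phi> (\<pi> m)) - Re (\<phi> T)" for m
        by (simp add: g_def \<phi>_def right_diff_distrib sum_subtractf)
      show "\<exists>m\<in>ball_V C. 0 \<le> (\<Sum>\<omega>\<in>I. l \<omega> * g \<omega> m)"
      proof (rule ccontr)
        let ?a = "Re (\<phi> T)"
        assume "\<not> ?thesis"
        then have less: "Re (\<phi> (\<pi> m)) < ?a" if "m \<in> ball_V C" for m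
          using that unfolding g_sum by fastforce
        have \<phi>0: "\<phi> (\<pi> 0) = 0" using normal_emb_linear(2)[OF r V_zero, of 0] by simp
        have a: "?a > 0" using less[of 0] V_zero V_nrm_zero C \<phi>0 by simp
        have "cmod (\<phi> (\<pi> m)) \<le> ?a / C" if m: "m \<in> ball_V 1" for m
        proof -
          have mV: "m \<in> carrier V" using m by simp
          have "complex_of_real C *\<^sub>C m \<in> ball_V C"
            using m C by (simp add: V_scale V.nrm_scaleC)
          then obtain n where "n \<in> ball_V C" "Re (\<phi> (\<pi> n)) = cmod (\<phi> (\<pi> (complex_of_real C *\<^sub>C m)))"
            using rotate[OF r] by blast
          then have "cmod (\<phi> (\<pi> (complex_of_real C *\<^sub>C m))) < ?a" using less by metis
          then show ?thesis using C by (simp add: normal_emb_linear(2)[OF r mV] norm_mult field_simps)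
        qed
        from normal_closure_bound[OF r this _ T]
        have "cmod (\<phi> T) \<le> ?a / C * (2 * op_norm X X T)" using a C by simp
        also have "\<dots> < ?a" using a C op_norm_nonneg[OF TX] by (simp add: C_def field_simps)
        finally show False using complex_Re_le_cmod[of "\<phi> T"] by simp
      qed
    qed (use C in simp)
    then obtain m where m: "m \<in> carrier V" and le: "\<And>r \<phi>. normal_le X r \<phi> \<Longrightarrow> Re (\<phi> T) \<le> Re (\<phi> (\<pi> m))"
      by (force simp: g_def \<Gamma>_def)
    have eq: "\<phi> T = \<phi> (\<pi> m)" if "normal_le X r \<phi>" for r \<phi>
    proof -
      have "Re (c * \<phi> T) \<le> Re (c * \<phi> (\<pi> m))" for c
        using le[OF normal_le_scale[OF that, of c]] .
      from this[of 1] this[of "-1"] this[of \<i>] this[of "- \<i>"] show ?thesis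
        by (simp add: complex_eq_iff)
    qed
    have "T = \<pi> m"
    proof (rule op_weak_eqI[OF TX emb_in[OF m]])
      fix x y assume x: "x \<in> carrier X" and y: "y \<in> carrier X"
      have "normal_le X (max ((nrm X x)\<^sup>2) ((nrm X y)\<^sup>2)) (\<lambda>T. cinner X (T x) y)"
        by (rule normal_le_rank_one[OF x _ y]) simp_all
      then show "cinner X (T x) y = cinner X (\<pi> m x) y" by (rule eq)
    qed
    then show ?thesis using m by blast
  qed
  then have "weakstar_op X closure_of (\<pi> ` carrier V) \<subseteq> \<pi> ` carrier V" by blast
  then show ?thesis
    using emb_in by (simp add: closure_of_subset_eq[symmetric] image_subset_iff)
qed

end

section \<open>Matrix entries and shifts\<close>

lemma closedin_conj:
  assumes "closedin Z {z \<in> topspace Z. P z}" "closedin Z {z \<in> topspace Z. Q z}"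
  shows "closedin Z {z \<in> topspace Z. P z \<and> Q z}"
proof -
  have "{z \<in> topspace Z. P z \<and> Q z} = {z \<in> topspace Z. P z} \<inter> {z \<in> topspace Z. Q z}" by blast
  then show ?thesis using closedin_Int[OF assms] by simp
qed

lemma closedin_ball:
  assumes "\<And>i. i \<in> I \<Longrightarrow> closedin Z {z \<in> topspace Z. P i z}"
  shows "closedin Z {z \<in> topspace Z. \<forall>i\<in>I. P i z}"
proof (cases "I = {}")
  case True
  then show ?thesis using closedin_topspace[of Z] by simp
next
  case False
  then have "{z \<in> topspace Z. \<forall>i\<in>I. P i z} = (\<Inter>i\<in>I. {z \<in> topspace Z. P i z})" by blast
  then show ?thesis using closedin_INT[OF False assms] by simp
qed

lemma closedin_imp:
  assumes "p \<Longrightarrow> closedin Z {z \<in> topspace Z. Q z}"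
  shows "closedin Z {z \<in> topspace Z. p \<longrightarrow> Q z}"
  using assms closedin_topspace[of Z] by (cases p) simp_all

lemma (in pre_hilbert) ell2_permute_nrm:
  assumes h: "bij_betw h A B"
  shows "nrm (ell2 A X) (\<lambda>a. if a \<in> A then f (h a) else 0) = nrm (ell2 B X) f"
proof -
  have "(\<Sum>\<^sub>\<infinity>a\<in>A. (nrm X (if a \<in> A then f (h a) else 0))\<^sup>2) = (\<Sum>\<^sub>\<infinity>a\<in>A. (nrm X (f (h a)))\<^sup>2)"
    by (rule infsum_cong) simp
  also have "\<dots> = (\<Sum>\<^sub>\<infinity>b\<in>B. (nrm X (f b))\<^sup>2)"
    by (rule infsum_reindex_bij_betw[OF h])
  finally show ?thesis by (simp add: ell2_nrm)
qed

context pre_hilbert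
begin

lemma rank_one_continuous:
  assumes "x \<in> carrier X" "y \<in> carrier X"
  shows "continuous_map (weakstar_op X) euclidean (\<lambda>T. cinner X (T x) y)"
  by (rule normal_le_continuous[OF normal_le_rank_one[OF assms(1) _ assms(2)]])
    (rule max.cobounded1, rule max.cobounded2)

lemma closedin_equalizer:
  assumes f: "continuous_map Z (weakstar_op X) f" and g: "continuous_map Z (weakstar_op X) g"
  shows "closedin Z {z \<in> topspace Z. f z = g z}"
proof -
  have fg: "f z \<in> operators X" "g z \<in> operators X" if "z \<in> topspace Z" for z
    using f g that by (auto simp: continuous_map_def)
  have "closedin Z {z \<in> topspace Z. \<forall>x\<in>carrier X. \<forall>y\<in>carrier X.
      cinner X (f z x) y - cinner X (g z x) y \<in> {0}}"
  proof (intro closedin_ball closedin_continuous_map_preimage[where Y = euclidean] continuous_map_diff)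
    fix x y assume x: "x \<in> carrier X" and y: "y \<in> carrier X"
    show "continuous_map Z euclidean (\<lambda>z. cinner X (f z x) y)"
      "continuous_map Z euclidean (\<lambda>z. cinner X (g z x) y)"
      using continuous_map_compose[OF f rank_one_continuous[OF x y]]
        continuous_map_compose[OF g rank_one_continuous[OF x y]] by (simp_all add: o_def)
  qed simp
  also have "{z \<in> topspace Z. \<forall>x\<in>carrier X. \<forall>y\<in>carrier X.
      cinner X (f z x) y - cinner X (g z x) y \<in> {0}} = {z \<in> topspace Z. f z = g z}"
    using op_weak_eqI[OF fg] by auto
  finally show ?thesis .
qed

end

context complex_hilbert
begin

text \<open>Weakly, $(Tf)_r = \sum_s T_{r,s} f_s$: move \<open>T\<close> to the other side as its adjoint and expand the inner
  product.\<close>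

lemma op_row_expansion:
  assumes T: "T \<in> operators (ell2 I X)" and f: "f \<in> carrier (ell2 I X)"
    and r: "r \<in> I" and y: "y \<in> carrier X"
  shows "((\<lambda>s. cinner X (mat_entry X T r s (f s)) y) has_sum cinner X (T f r) y) I"
proof -
  interpret E: complex_hilbert "ell2 I X" by (rule ell2_hilbert)
  let ?d = "delta r y"
  have d: "?d \<in> carrier (ell2 I X)" using r y by (rule delta_in)
  let ?g = "adj (ell2 I X) T ?d"
  have g: "?g \<in> carrier (ell2 I X)" by (rule E.op_in[OF E.adj_in[OF T]])
  have "cinner X (mat_entry X T r s (f s)) y = cinner X (f s) (?g s)" if s: "s \<in> I" for s
  proof -
    have fs: "f s \<in> carrier X" "delta s (f s) \<in> carrier (ell2 I X)"
      using ell2_at[OF f] delta_in[OF s] by blast+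
    have "cinner X (mat_entry X T r s (f s)) y = cinner (ell2 I X) (T (delta s (f s))) ?d"
      using delta_ip_right[OF r y E.op_in[OF T]] fs by (simp add: mat_entry_apply)
    also have "\<dots> = cinner (ell2 I X) (delta s (f s)) ?g" by (rule E.adj_ip[OF T fs(2) d])
    also have "\<dots> = cinner X (f s) (?g s)" by (rule delta_ip_left[OF s fs(1) g])
    finally show ?thesis .
  qed
  then have iff: "((\<lambda>s. cinner X (mat_entry X T r s (f s)) y) has_sum cinner X (T f r) y) I
      \<longleftrightarrow> ((\<lambda>s. cinner X (f s) (?g s)) has_sum cinner X (T f r) y) I"
    by (rule has_sum_cong)
  have "cinner X (T f r) y = (\<Sum>\<^sub>\<infinity>s\<in>I. cinner X (f s) (?g s))"
    using delta_ip_right[OF r y E.op_in[OF T], of f] E.adj_ip[OF T f d] by (simp add: ell2_cinner)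
  then show ?thesis
    unfolding iff using has_sum_infsum[OF ell2_ip_summable[OF f g]] by simp
qed

lemma op_entries_eqI:
  assumes S: "S \<in> operators (ell2 I X)" and T: "T \<in> operators (ell2 I X)"
    and eq: "\<And>r s. \<lbrakk>r \<in> I; s \<in> I\<rbrakk> \<Longrightarrow> mat_entry X S r s = mat_entry X T r s"
  shows "S = T"
proof -
  interpret E: complex_hilbert "ell2 I X" by (rule ell2_hilbert)
  show ?thesis
  proof (rule E.op_eqI[OF S T])
    fix f assume f: "f \<in> carrier (ell2 I X)"
    note Sf = E.op_in[OF S, of f] and Tf = E.op_in[OF T, of f]
    show "S f = T f"
    proof
      fix r show "S f r = T f r"
      proof (cases "r \<in> I")
        case True
        show ?thesis
        proof (rule ip_eq_imp_eq[OF ell2_at[OF Sf] ell2_at[OF Tf]])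
          fix y assume y: "y \<in> carrier X"
          have "((\<lambda>s. cinner X (mat_entry X S r s (f s)) y) has_sum cinner X (T f r) y) I
              \<longleftrightarrow> ((\<lambda>s. cinner X (mat_entry X T r s (f s)) y) has_sum cinner X (T f r) y) I"
            by (rule has_sum_cong) (simp add: eq[OF True])
          then show "cinner X (S f r) y = cinner X (T f r) y"
            using op_row_expansion[OF T f True y] op_row_expansion[OF S f True y] has_sum_unique by blast
        qed
      next
        case False
        then show ?thesis using ell2_outside[OF Sf] ell2_outside[OF Tf] by simp
      qed
    qed
  qed
qed

lemma ampl_adj_ip:
  assumes T: "T \<in> operators X" and f: "f \<in> carrier (ell2 I X)" and g: "g \<in> carrier (ell2 I X)"
  shows "cinner (ell2 I X) (ampl I X T f) g = cinner (ell2 I X) f (ampl I X (adj X T) g)"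
  unfolding ell2_cinner ampl_at[OF f] ampl_at[OF g]
  using adj_ip[OF T ell2_at[OF f] ell2_at[OF g]] by simp

lemma adj_mat_entry:
  assumes T: "T \<in> operators (ell2 I X)" and r: "r \<in> I" and s: "s \<in> I"
  shows "adj X (mat_entry X T r s) = mat_entry X (adj (ell2 I X) T) s r"
proof (rule adj_eqI)
  interpret E: complex_hilbert "ell2 I X" by (rule ell2_hilbert)
  note T' = E.adj_in[OF T]
  show "mat_entry X (adj (ell2 I X) T) s r \<in> operators X" by (rule mat_entry_in[OF T' r])
  fix x y assume x: "x \<in> carrier X" and y: "y \<in> carrier X"
  have d: "delta s x \<in> carrier (ell2 I X)" "delta r y \<in> carrier (ell2 I X)"
    using r s x y by (simp_all add: delta_in)
  show "cinner X (mat_entry X T r s x) y = cinner X x (mat_entry X (adj (ell2 I X) T) s r y)"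
    using x y delta_ip_right[OF r y E.op_in[OF T], of "delta s x"] E.adj_ip[OF T d]
      delta_ip_left[OF s x E.op_in[OF T'], of "delta r y"] by (simp add: mat_entry_apply)
qed

end

text \<open>Composing a normal functional with $T \mapsto V^* T U$ replaces its sequences $(x_n)$ and $(y_n)$ by
  $(U x_n)$ and $(V y_n)$.\<close>

lemma weakstar_continuous_sandwich:
  assumes X: "pre_hilbert X" and L: "pre_hilbert L"
    and f: "\<And>T. T \<in> operators L \<Longrightarrow> f T \<in> operators X"
    and U: "\<And>x. x \<in> carrier X \<Longrightarrow> U x \<in> carrier L" "\<And>x. x \<in> carrier X \<Longrightarrow> nrm L (U x) = nrm X x"
    and V: "\<And>x. x \<in> carrier X \<Longrightarrow> V x \<in> carrier L" "\<And>x. x \<in> carrier X \<Longrightarrow> nrm L (V x) = nrm X x"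
    and eq: "\<And>T x y. \<lbrakk>T \<in> operators L; x \<in> carrier X; y \<in> carrier X\<rbrakk>
      \<Longrightarrow> cinner X (f T x) y = cinner L (T (U x)) (V y)"
  shows "continuous_map (weakstar_op L) (weakstar_op X) f"
proof -
  interpret X: pre_hilbert X by (rule X)
  interpret L: pre_hilbert L by (rule L)
  show ?thesis
  proof (rule X.weakstar_continuousI)
    show "f T \<in> operators X" if "T \<in> topspace (weakstar_op L)" for T using that f by simp
    fix x y assume x: "x \<in> carrier (ell2 (UNIV :: nat set) X)" and y: "y \<in> carrier (ell2 (UNIV :: nat set) X)"
    note xn = X.ell2_at[OF x] and yn = X.ell2_at[OF y]
    have Ux: "(\<lambda>n. U (x n)) \<in> carrier (ell2 UNIV L)"
      using X.ell2_summable[OF x] by (intro L.ell2I) (simp_all add: U xn)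
    have Vy: "(\<lambda>n. V (y n)) \<in> carrier (ell2 UNIV L)"
      using X.ell2_summable[OF y] by (intro L.ell2I) (simp_all add: V yn)
    show "continuous_map (weakstar_op L) euclidean (\<lambda>T. cinner (ell2 UNIV X) (ampl UNIV X (f T) x) y)"
      by (rule continuous_map_eq[OF L.weakstar_continuous[OF Ux Vy]])
        (simp add: L.ampl_ip[OF Ux] X.ampl_ip[OF x] eq xn yn)
  qed
qed

lemma (in pre_hilbert) mat_entry_continuous:
  assumes r: "r \<in> I" and s: "s \<in> I"
  shows "continuous_map (weakstar_op (ell2 I X)) (weakstar_op X) (\<lambda>T. mat_entry X T r s)"
proof (rule weakstar_continuous_sandwich[where U = "delta s" and V = "delta r"])
  interpret E: pre_hilbert "ell2 I X" by (rule ell2_pre_hilbert)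
  fix T x y assume T: "T \<in> operators (ell2 I X)" and x: "x \<in> carrier X" and y: "y \<in> carrier X"
  show "cinner X (mat_entry X T r s x) y = cinner (ell2 I X) (T (delta s x)) (delta r y)"
    using delta_ip_right[OF r y E.op_in[OF T], of "delta s x"] x by (simp add: mat_entry_apply)
qed (use r s in \<open>simp_all add: pre_hilbert_axioms ell2_pre_hilbert mat_entry_in delta_in delta_nrm\<close>)

lemma (in pre_hilbert) mat_entry_add:
  "mat_entry X (S + T) r s = mat_entry X S r s + mat_entry X T r s"
  by (auto simp: mat_entry_def)

lemma (in pre_hilbert) mat_entry_scale:
  "mat_entry X (c *\<^sub>C S) r s = c *\<^sub>C mat_entry X S r s"
  by (auto simp: mat_entry_def)

lemma (in pre_hilbert) mat_entry_zero [simp]: "mat_entry X 0 r s = 0"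
  by (auto simp: mat_entry_def)

locale group_hilbert = group G + complex_hilbert X
  for G :: "('g, 'c) monoid_scheme" (structure) and X :: "('x::complex_vector) chilb"
begin

abbreviation "K \<equiv> ell2 (carrier G) X"

sublocale K: complex_hilbert K
  by (rule ell2_hilbert)

lemma bij_left_translation: "t \<in> carrier G \<Longrightarrow> bij_betw (\<lambda>r. inv t \<otimes> r) (carrier G) (carrier G)"
  by (rule bij_betwI[where g = "\<lambda>r. t \<otimes> r"]) (auto simp: m_assoc[symmetric])

lemma bij_right_translation: "t \<in> carrier G \<Longrightarrow> bij_betw (\<lambda>r. r \<otimes> t) (carrier G) (carrier G)"
  by (rule bij_betwI[where g = "\<lambda>r. r \<otimes> inv t"]) (auto simp: m_assoc)

lemma tensor_lambda_at:
  assumes "f \<in> carrier K"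
  shows "tensor_lambda G X a t f r = (if r \<in> carrier G then a (f (inv t \<otimes> r)) else 0)"
  using assms by (simp add: tensor_lambda_def)

lemma tensor_lambda_in:
  assumes a: "a \<in> operators X" and t: "t \<in> carrier G"
  shows "tensor_lambda G X a t \<in> operators K"
proof (rule K.operatorsI[where B = "op_norm X X a"])
  fix f g and c :: complex assume f: "f \<in> carrier K"
  note h = bij_left_translation[OF t]
  have eq: "tensor_lambda G X a t f = (\<lambda>r. if r \<in> carrier G then ampl (carrier G) X a f (inv t \<otimes> r) else 0)"
    using f by (auto simp: tensor_lambda_def ampl_at)
  show "tensor_lambda G X a t f \<in> carrier K"
    unfolding eq by (rule ell2_permute[OF h ampl_closed(1)[OF a f]])
  show "nrm K (tensor_lambda G X a t f) \<le> op_norm X X a * nrm K f"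
    unfolding eq ell2_permute_nrm[OF h] by (rule ampl_closed(2)[OF a f])
  show "tensor_lambda G X a t (c *\<^sub>C f) = c *\<^sub>C tensor_lambda G X a t f"
    by (rule ext) (simp add: tensor_lambda_at[OF f] tensor_lambda_at[OF K.scale_in[OF f]] op_scale[OF a] ell2_at[OF f])
  assume g: "g \<in> carrier K"
  show "tensor_lambda G X a t (f + g) = tensor_lambda G X a t f + tensor_lambda G X a t g"
    by (rule ext) (simp add: tensor_lambda_at[OF f] tensor_lambda_at[OF g] tensor_lambda_at[OF K.add_in[OF f g]]
        op_add[OF a] ell2_at[OF f] ell2_at[OF g])
qed (simp add: tensor_lambda_def)

lemma mat_entry_tensor_lambda:
  assumes a: "a \<in> operators X" and t: "t \<in> carrier G" and r: "r \<in> carrier G" and s: "s \<in> carrier G"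
  shows "mat_entry X (tensor_lambda G X a t) r s = (if r = t \<otimes> s then a else 0)"
proof
  fix x
  show "mat_entry X (tensor_lambda G X a t) r s x = (if r = t \<otimes> s then a else 0) x"
    using tensor_lambda_delta[OF group_axioms complex_hilbert_axioms a t s, of x] op_outside[OF a, of x]
    by (auto simp: mat_entry_def delta_def)
qed

lemma tensor_lambda_mult:
  assumes a: "a \<in> operators X" and b: "b \<in> operators X" and s: "s \<in> carrier G" and t: "t \<in> carrier G"
  shows "tensor_lambda G X a s \<circ> tensor_lambda G X b t = tensor_lambda G X (a \<circ> b) (s \<otimes> t)"
proof (rule K.op_eqI)
  fix f assume f: "f \<in> carrier K"
  note bf = K.op_in[OF tensor_lambda_in[OF b t], of f]
  show "(tensor_lambda G X a s \<circ> tensor_lambda G X b t) f = tensor_lambda G X (a \<circ> b) (s \<otimes> t) f"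
    by (rule ext) (simp add: tensor_lambda_at[OF bf] tensor_lambda_at[OF f] s t inv_mult_group m_assoc)
qed (use assms in \<open>simp_all add: K.op_comp_in tensor_lambda_in op_comp_in\<close>)

lemma tensor_lambda_adj:
  assumes a: "a \<in> operators X" and t: "t \<in> carrier G"
  shows "adj K (tensor_lambda G X a t) = tensor_lambda G X (adj X a) (inv t)"
proof (rule op_entries_eqI)
  note T = tensor_lambda_in[OF a t]
  show "adj K (tensor_lambda G X a t) \<in> operators K" by (rule K.adj_in[OF T])
  show "tensor_lambda G X (adj X a) (inv t) \<in> operators K" using a t by (simp add: tensor_lambda_in)
  fix r s assume r: "r \<in> carrier G" and s: "s \<in> carrier G"
  have z: "adj X 0 = 0" by (rule adj_eqI) simp_all
  have "s = t \<otimes> r \<longleftrightarrow> r = inv t \<otimes> s" using r s t by (metis inv_solve_left)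
  then show "mat_entry X (adj K (tensor_lambda G X a t)) r s = mat_entry X (tensor_lambda G X (adj X a) (inv t)) r s"
    using adj_mat_entry[OF T s r, symmetric] a t r s by (simp add: mat_entry_tensor_lambda z)
qed

lemma id_op_in: "id_op X \<in> operators X"
  by (rule operatorsI[where B = 1]) (simp_all add: id_op_def)

lemma tensor_lambda_one: "f \<in> carrier K \<Longrightarrow> tensor_lambda G X (id_op X) \<one> f = f"
  by (rule ext) (simp add: tensor_lambda_at id_op_def ell2_at ell2_outside)

end

section \<open>Weak$^*$-closed bundles of operators\<close>

text \<open>The images $\pi(M_t)$ of the fibres, as a bundle of weak$^*$-closed subspaces of
  $\mathbb{B}(X)$.\<close>

locale operator_bundle = group_hilbert G X
  for G :: "('g, 'c) monoid_scheme" (structure) and X :: "('x::complex_vector) chilb" +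
  fixes N :: "'g \<Rightarrow> ('x \<Rightarrow> 'x) set"
  assumes N_closed: "t \<in> carrier G \<Longrightarrow> closedin (weakstar_op X) (N t)"
    and N_subspace: "t \<in> carrier G \<Longrightarrow> complex_vector.subspace (N t)"
    and N_mult: "\<lbrakk>s \<in> carrier G; t \<in> carrier G; a \<in> N s; b \<in> N t\<rbrakk> \<Longrightarrow> a \<circ> b \<in> N (s \<otimes> t)"
    and N_adj: "\<lbrakk>t \<in> carrier G; a \<in> N t\<rbrakk> \<Longrightarrow> adj X a \<in> N (inv t)"
    and N_id: "id_op X \<in> N \<one>"
begin

lemma N_op: "\<lbrakk>t \<in> carrier G; a \<in> N t\<rbrakk> \<Longrightarrow> a \<in> operators X"
  using closedin_subset[OF N_closed] by auto

lemma N_zero: "t \<in> carrier G \<Longrightarrow> 0 \<in> N t"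
  by (rule complex_vector.subspace_0[OF N_subspace])

definition gens :: "'g set \<Rightarrow> (('g \<Rightarrow> 'x) \<Rightarrow> 'g \<Rightarrow> 'x) set" where
  "gens A = {tensor_lambda G X a t | t a. t \<in> A \<and> a \<in> N t}"

abbreviation "lin A \<equiv> complex_vector.span (gens A)"

text \<open>For a coset \<open>w\<close> this turns out to be the weak$^*$-closed span of \<open>gens w\<close>.\<close>

definition coset_algebra :: "'g set \<Rightarrow> (('g \<Rightarrow> 'x) \<Rightarrow> 'g \<Rightarrow> 'x) set" where
  "coset_algebra w = {T \<in> operators K.
     (\<forall>r\<in>carrier G. \<forall>s\<in>carrier G. mat_entry X T r s \<in> N (r \<otimes> inv s)) \<and>
     (\<forall>r\<in>carrier G. \<forall>s\<in>carrier G. \<forall>t\<in>carrier G. mat_entry X T (r \<otimes> t) (s \<otimes> t) = mat_entry X T r s) \<and>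
     (\<forall>r\<in>carrier G. \<forall>s\<in>carrier G. r \<otimes> inv s \<notin> w \<longrightarrow> mat_entry X T r s = 0)}"

lemma lin_op: "A \<subseteq> carrier G \<Longrightarrow> b \<in> lin A \<Longrightarrow> b \<in> operators K"
proof -
  assume A: "A \<subseteq> carrier G" and b: "b \<in> lin A"
  have "tensor_lambda G X a t \<in> operators K" if "t \<in> A" "a \<in> N t" for a t
    using that A tensor_lambda_in N_op by blast
  then have "gens A \<subseteq> operators K" by (auto simp: gens_def)
  then show ?thesis using complex_vector.span_minimal[OF _ K.op_subspace] b by blast
qed

lemma coset_algebra_subspace: "complex_vector.subspace (coset_algebra w)"
proof (rule complex_vector.subspaceI)
  show "0 \<in> coset_algebra w" by (simp add: coset_algebra_def N_zero)
  fix S T and c :: complex assume S: "S \<in> coset_algebra w"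
  have st: "r \<otimes> inv s \<in> carrier G" if "r \<in> carrier G" "s \<in> carrier G" for r s using that by simp
  show "c *\<^sub>C S \<in> coset_algebra w"
    using S unfolding coset_algebra_def
    by (auto simp: K.op_scaleC_in mat_entry_scale intro: complex_vector.subspace_scale[OF N_subspace[OF st]])
  assume T: "T \<in> coset_algebra w"
  show "S + T \<in> coset_algebra w"
    using S T unfolding coset_algebra_def
    by (auto simp: K.op_plus_in mat_entry_add intro: complex_vector.subspace_add[OF N_subspace[OF st]])
qed

lemma coset_algebra_closed: "closedin (weakstar_op K) (coset_algebra w)"
proof -
  have "closedin (weakstar_op K) {T \<in> topspace (weakstar_op K).
     (\<forall>r\<in>carrier G. \<forall>s\<in>carrier G. mat_entry X T r s \<in> N (r \<otimes> inv s)) \<and>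
     (\<forall>r\<in>carrier G. \<forall>s\<in>carrier G. \<forall>t\<in>carrier G. mat_entry X T (r \<otimes> t) (s \<otimes> t) = mat_entry X T r s) \<and>
     (\<forall>r\<in>carrier G. \<forall>s\<in>carrier G. r \<otimes> inv s \<notin> w \<longrightarrow> mat_entry X T r s = 0)}"
  proof (intro closedin_conj closedin_ball closedin_imp)
    fix r s assume r: "r \<in> carrier G" and s: "s \<in> carrier G"
    note e = mat_entry_continuous[OF r s]
    show "closedin (weakstar_op K) {T \<in> topspace (weakstar_op K). mat_entry X T r s \<in> N (r \<otimes> inv s)}"
      by (rule closedin_continuous_map_preimage[OF e N_closed]) (simp add: r s)
    show "closedin (weakstar_op K) {T \<in> topspace (weakstar_op K). mat_entry X T r s = 0}"
      by (rule closedin_equalizer[OF e]) simp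
    fix t assume "t \<in> carrier G"
    with r s show "closedin (weakstar_op K) {T \<in> topspace (weakstar_op K).
        mat_entry X T (r \<otimes> t) (s \<otimes> t) = mat_entry X T r s}"
      by (intro closedin_equalizer mat_entry_continuous) simp_all
  qed
  then show ?thesis unfolding coset_algebra_def by (simp only: K.topspace_weakstar)
qed

lemma gens_coset_algebra: "w \<subseteq> carrier G \<Longrightarrow> gens w \<subseteq> coset_algebra w"
proof
  assume w: "w \<subseteq> carrier G"
  fix T assume "T \<in> gens w"
  then obtain a t where T: "T = tensor_lambda G X a t" and t: "t \<in> w" and a: "a \<in> N t"
    by (auto simp: gens_def)
  have tG: "t \<in> carrier G" using w t by blast
  note aX = N_op[OF tG a]
  note e = mat_entry_tensor_lambda[OF aX tG]
  have iff: "r = t \<otimes> s \<longleftrightarrow> r \<otimes> inv s = t" if "r \<in> carrier G" "s \<in> carrier G" for r s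
    using that tG by (metis inv_solve_right)
  have "mat_entry X T r s \<in> N (r \<otimes> inv s)" if "r \<in> carrier G" "s \<in> carrier G" for r s
    using that a N_zero unfolding T by (auto simp: e iff)
  moreover have "mat_entry X T (r \<otimes> q) (s \<otimes> q) = mat_entry X T r s"
    if "r \<in> carrier G" "s \<in> carrier G" "q \<in> carrier G" for r s q
  proof -
    have "r \<otimes> q = t \<otimes> (s \<otimes> q) \<longleftrightarrow> r = t \<otimes> s" using that tG by (simp add: m_assoc[symmetric])
    then show ?thesis unfolding T using that by (simp add: e)
  qed
  moreover have "mat_entry X T r s = 0" if "r \<in> carrier G" "s \<in> carrier G" "r \<otimes> inv s \<notin> w" for r s
    using that t unfolding T by (auto simp: e iff)
  moreover have "T \<in> operators K" unfolding T by (rule tensor_lambda_in[OF aX tG])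
  ultimately show "T \<in> coset_algebra w"
    unfolding coset_algebra_def by (intro CollectI conjI ballI impI)
qed

lemma closure_subset_coset_algebra:
  assumes "w \<subseteq> carrier G"
  shows "weakstar_op K closure_of lin w \<subseteq> coset_algebra w"
proof (rule closure_of_minimal[OF _ coset_algebra_closed])
  show "lin w \<subseteq> coset_algebra w"
    by (rule complex_vector.span_minimal[OF gens_coset_algebra[OF assms] coset_algebra_subspace])
qed

text \<open>The closure of the vectors $(b \otimes 1)\xi$ with \<open>b\<close> in \<open>lin A\<close>.\<close>

definition approx_space :: "'j set \<Rightarrow> ('j \<Rightarrow> 'g \<Rightarrow> 'x) \<Rightarrow> 'g set \<Rightarrow> ('j \<Rightarrow> 'g \<Rightarrow> 'x) set" where
  "approx_space J \<xi> A = {\<eta> \<in> carrier (ell2 J K). \<forall>e>0. \<exists>b\<in>lin A. nrm (ell2 J K) (\<eta> - ampl J K b \<xi>) < e}"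

lemma approx_space_subspace:
  assumes A: "A \<subseteq> carrier G" and \<xi>: "\<xi> \<in> carrier (ell2 J K)"
  shows "complex_vector.subspace (approx_space J \<xi> A)"
proof -
  interpret L: complex_hilbert "ell2 J K" by (rule K.ell2_hilbert)
  have b_in: "ampl J K b \<xi> \<in> carrier (ell2 J K)" if "b \<in> lin A" for b
    by (rule K.ampl_closed(1)[OF lin_op[OF A that] \<xi>])
  show ?thesis
  proof (rule complex_vector.subspaceI)
    have "ampl J K 0 \<xi> = 0" by (simp add: K.ampl_at[OF \<xi>] fun_eq_iff)
    then have "nrm (ell2 J K) (0 - ampl J K 0 \<xi>) < e" if "e > 0" for e
      using that by (simp only: diff_self L.nrm_zero)
    then show "0 \<in> approx_space J \<xi> A"
      unfolding approx_space_def by (intro CollectI conjI allI impI L.zero_in bexI[OF _ complex_vector.span_zero])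
    fix \<eta> \<zeta> and c :: complex assume \<eta>: "\<eta> \<in> approx_space J \<xi> A"
    then have \<eta>L: "\<eta> \<in> carrier (ell2 J K)" by (simp add: approx_space_def)
    show "c *\<^sub>C \<eta> \<in> approx_space J \<xi> A"
      unfolding approx_space_def
    proof (intro CollectI conjI allI impI)
      show "c *\<^sub>C \<eta> \<in> carrier (ell2 J K)" using \<eta>L by (rule L.scale_in)
      fix e :: real assume "e > 0"
      then have "e / (cmod c + 1) > 0" by (simp add: add_nonneg_pos)
      then obtain b where b: "b \<in> lin A" "nrm (ell2 J K) (\<eta> - ampl J K b \<xi>) < e / (cmod c + 1)"
        using \<eta> unfolding approx_space_def by blast
      have "c *\<^sub>C \<eta> - ampl J K (c *\<^sub>C b) \<xi> = c *\<^sub>C (\<eta> - ampl J K b \<xi>)"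
        by (simp add: fun_eq_iff K.ampl_at[OF \<xi>] complex_vector.scale_right_diff_distrib)
      then have "nrm (ell2 J K) (c *\<^sub>C \<eta> - ampl J K (c *\<^sub>C b) \<xi>) = cmod c * nrm (ell2 J K) (\<eta> - ampl J K b \<xi>)"
        using L.nrm_scale[OF L.diff_in[OF \<eta>L b_in[OF b(1)]]] by simp
      also have "\<dots> \<le> (cmod c + 1) * nrm (ell2 J K) (\<eta> - ampl J K b \<xi>)"
        using L.nrm_ge_0[OF L.diff_in[OF \<eta>L b_in[OF b(1)]]] by (simp add: mult_right_mono)
      also have "\<dots> < e"
        using b(2) by (simp add: pos_less_divide_eq add_nonneg_pos mult.commute)
      finally show "\<exists>b\<in>lin A. nrm (ell2 J K) (c *\<^sub>C \<eta> - ampl J K b \<xi>) < e"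
        using complex_vector.span_scale[OF b(1)] by blast
    qed
    assume \<zeta>: "\<zeta> \<in> approx_space J \<xi> A"
    then have \<zeta>L: "\<zeta> \<in> carrier (ell2 J K)" by (simp add: approx_space_def)
    show "\<eta> + \<zeta> \<in> approx_space J \<xi> A"
      unfolding approx_space_def
    proof (intro CollectI conjI allI impI)
      show "\<eta> + \<zeta> \<in> carrier (ell2 J K)" using \<eta>L \<zeta>L by (rule L.add_in)
      fix e :: real assume "e > 0"
      then have e2: "e / 2 > 0" by simp
      obtain b where b: "b \<in> lin A" "nrm (ell2 J K) (\<eta> - ampl J K b \<xi>) < e / 2"
        using \<eta> e2 unfolding approx_space_def by blast
      obtain d where d: "d \<in> lin A" "nrm (ell2 J K) (\<zeta> - ampl J K d \<xi>) < e / 2"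
        using \<zeta> e2 unfolding approx_space_def by blast
      have eq: "\<eta> + \<zeta> - ampl J K (b + d) \<xi> = (\<eta> - ampl J K b \<xi>) + (\<zeta> - ampl J K d \<xi>)"
        by (simp add: fun_eq_iff K.ampl_at[OF \<xi>])
      have "nrm (ell2 J K) (\<eta> + \<zeta> - ampl J K (b + d) \<xi>) < e"
        unfolding eq using L.nrm_triangle_ineq[OF L.diff_in[OF \<eta>L b_in[OF b(1)]] L.diff_in[OF \<zeta>L b_in[OF d(1)]]] b(2) d(2)
        by linarith
      then show "\<exists>b\<in>lin A. nrm (ell2 J K) (\<eta> + \<zeta> - ampl J K b \<xi>) < e"
        using complex_vector.span_add[OF b(1) d(1)] by blast
    qed
  qed
qed

lemma approx_space_limit:
  assumes A: "A \<subseteq> carrier G" and \<xi>: "\<xi> \<in> carrier (ell2 J K)"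
    and s: "\<And>n::nat. s n \<in> approx_space J \<xi> A" and l: "l \<in> carrier (ell2 J K)"
    and lim: "(\<lambda>n. nrm (ell2 J K) (s n - l)) \<longlonglongrightarrow> 0"
  shows "l \<in> approx_space J \<xi> A"
  unfolding approx_space_def
proof (intro CollectI conjI allI impI l)
  interpret L: complex_hilbert "ell2 J K" by (rule K.ell2_hilbert)
  have sL: "s n \<in> carrier (ell2 J K)" for n using s[of n] by (simp add: approx_space_def)
  fix e :: real assume "e > 0"
  then have e2: "e / 2 > 0" by simp
  obtain n where n: "nrm (ell2 J K) (s n - l) < e / 2"
    using order_tendstoD(2)[OF lim e2] eventually_sequentially by auto
  obtain b where b: "b \<in> lin A" "nrm (ell2 J K) (s n - ampl J K b \<xi>) < e / 2"
    using s[of n] e2 unfolding approx_space_def by blast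
  have bL: "ampl J K b \<xi> \<in> carrier (ell2 J K)" by (rule K.ampl_closed(1)[OF lin_op[OF A b(1)] \<xi>])
  have "nrm (ell2 J K) (l - ampl J K b \<xi>) < e"
    using L.nrm_diff_triangle[OF l sL bL, of n] L.nrm_diff_commute[OF l sL, of n] n b(2) by simp
  then show "\<exists>b\<in>lin A. nrm (ell2 J K) (l - ampl J K b \<xi>) < e" using b(1) by blast
qed

lemma approx_space_map:
  assumes A: "A \<subseteq> carrier G" and B: "B \<subseteq> carrier G" and \<xi>: "\<xi> \<in> carrier (ell2 J K)"
    and S: "S \<in> operators K" and SAB: "\<And>b. b \<in> lin A \<Longrightarrow> S \<circ> b \<in> lin B"
    and \<eta>: "\<eta> \<in> approx_space J \<xi> A"
  shows "ampl J K S \<eta> \<in> approx_space J \<xi> B"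
  unfolding approx_space_def
proof (intro CollectI conjI allI impI)
  interpret L: complex_hilbert "ell2 J K" by (rule K.ell2_hilbert)
  have \<eta>L: "\<eta> \<in> carrier (ell2 J K)" using \<eta> by (simp add: approx_space_def)
  show "ampl J K S \<eta> \<in> carrier (ell2 J K)" by (rule K.ampl_closed(1)[OF S \<eta>L])
  let ?n = "op_norm K K S"
  fix e :: real assume "e > 0"
  then have "e / (?n + 1) > 0" using K.op_norm_nonneg[OF S] by simp
  then obtain b where b: "b \<in> lin A" "nrm (ell2 J K) (\<eta> - ampl J K b \<xi>) < e / (?n + 1)"
    using \<eta> unfolding approx_space_def by blast
  note bK = lin_op[OF A b(1)]
  note bL = K.ampl_closed(1)[OF bK \<xi>]
  note dL = L.diff_in[OF \<eta>L bL]
  have "ampl J K S \<eta> - ampl J K (S \<circ> b) \<xi> = ampl J K S (\<eta> - ampl J K b \<xi>)"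
    unfolding K.ampl_comp[OF S bK] using L.op_diff[OF K.ampl_in[OF S] \<eta>L bL] by simp
  then have "nrm (ell2 J K) (ampl J K S \<eta> - ampl J K (S \<circ> b) \<xi>) \<le> ?n * nrm (ell2 J K) (\<eta> - ampl J K b \<xi>)"
    using K.ampl_closed(2)[OF S dL] by simp
  also have "\<dots> \<le> (?n + 1) * nrm (ell2 J K) (\<eta> - ampl J K b \<xi>)"
    using L.nrm_ge_0[OF dL] by (simp add: mult_right_mono)
  also have "\<dots> < e"
    using b(2) K.op_norm_nonneg[OF S] by (simp add: pos_less_divide_eq mult.commute)
  finally show "\<exists>b\<in>lin B. nrm (ell2 J K) (ampl J K S \<eta> - ampl J K b \<xi>) < e"
    using SAB[OF b(1)] by blast
qed

lemma gen_comp_lin: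
  assumes A: "A \<subseteq> carrier G" and B: "B \<subseteq> carrier G" and t: "t \<in> carrier G" and a: "a \<in> N t"
    and tAB: "\<And>s. s \<in> A \<Longrightarrow> t \<otimes> s \<in> B" and b: "b \<in> lin A"
  shows "tensor_lambda G X a t \<circ> b \<in> lin B"
proof -
  note S = tensor_lambda_in[OF N_op[OF t a] t]
  have "lin A \<subseteq> {b \<in> operators K. tensor_lambda G X a t \<circ> b \<in> lin B}"
  proof (rule complex_vector.span_minimal[OF subsetI])
    show "complex_vector.subspace {b \<in> operators K. tensor_lambda G X a t \<circ> b \<in> lin B}"
    proof (rule complex_vector.subspaceI)
      have "tensor_lambda G X a t \<circ> (0 :: ('g \<Rightarrow> 'x) \<Rightarrow> 'g \<Rightarrow> 'x) = 0" by (simp add: fun_eq_iff K.op_zero[OF S])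
      then show "0 \<in> {b \<in> operators K. tensor_lambda G X a t \<circ> b \<in> lin B}"
        using complex_vector.span_zero[of "gens B"] K.op_zero_in by (intro CollectI conjI) simp_all
      fix x y and c :: complex
      assume x: "x \<in> {b \<in> operators K. tensor_lambda G X a t \<circ> b \<in> lin B}"
      then have xK: "x \<in> operators K" by simp
      have "tensor_lambda G X a t \<circ> (c *\<^sub>C x) = c *\<^sub>C (tensor_lambda G X a t \<circ> x)"
        by (simp add: fun_eq_iff K.op_scale[OF S K.op_in[OF xK]])
      then show "c *\<^sub>C x \<in> {b \<in> operators K. tensor_lambda G X a t \<circ> b \<in> lin B}"
        using x complex_vector.span_scale[of "tensor_lambda G X a t \<circ> x" "gens B" c] K.op_scaleC_in[OF xK] by simp
      assume y: "y \<in> {b \<in> operators K. tensor_lambda G X a t \<circ> b \<in> lin B}"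
      then have yK: "y \<in> operators K" by simp
      have "tensor_lambda G X a t \<circ> (x + y) = (tensor_lambda G X a t \<circ> x) + (tensor_lambda G X a t \<circ> y)"
        by (simp add: fun_eq_iff K.op_add[OF S K.op_in[OF xK] K.op_in[OF yK]])
      then show "x + y \<in> {b \<in> operators K. tensor_lambda G X a t \<circ> b \<in> lin B}"
        using x y complex_vector.span_add[of "tensor_lambda G X a t \<circ> x" "gens B" "tensor_lambda G X a t \<circ> y"]
          K.op_plus_in[OF xK yK] by simp
    qed
    fix x assume "x \<in> gens A"
    then obtain s d where x: "x = tensor_lambda G X d s" and s: "s \<in> A" and d: "d \<in> N s"
      by (auto simp: gens_def)
    have sG: "s \<in> carrier G" using A s by blast
    have "tensor_lambda G X a t \<circ> x = tensor_lambda G X (a \<circ> d) (t \<otimes> s)"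
      unfolding x by (rule tensor_lambda_mult[OF N_op[OF t a] N_op[OF sG d] t sG])
    moreover have "tensor_lambda G X (a \<circ> d) (t \<otimes> s) \<in> gens B"
      unfolding gens_def using tAB[OF s] N_mult[OF t sG a d] by blast
    ultimately show "x \<in> {b \<in> operators K. tensor_lambda G X a t \<circ> b \<in> lin B}"
      using complex_vector.span_base tensor_lambda_in[OF N_op[OF sG d] sG] x by auto
  qed
  then show ?thesis using b by blast
qed

end

text \<open>As \<open>S'\<close> maps \<open>Z\<close> into \<open>Y\<close>, the operator \<open>S\<close> maps the orthogonal complement of \<open>Y\<close> into that of
  \<open>Z\<close>; hence it intertwines the projections.\<close>

lemma (in complex_hilbert) projection_intertwine:
  assumes S: "S \<in> operators X"
    and P: "P \<in> operators X" "\<And>x. P x \<in> Y" "\<And>x y. \<lbrakk>x \<in> carrier X; y \<in> Y\<rbrakk> \<Longrightarrow> cinner X (x - P x) y = 0"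
    and Y: "Y \<subseteq> carrier X"
    and Q: "Q \<in> operators X" "\<And>x. Q x \<in> Z" "\<And>z. z \<in> Z \<Longrightarrow> Q z = z"
      "\<And>x y. \<lbrakk>x \<in> carrier X; y \<in> carrier X\<rbrakk> \<Longrightarrow> cinner X (Q x) y = cinner X x (Q y)"
    and Z: "Z \<subseteq> carrier X"
    and SYZ: "\<And>y. y \<in> Y \<Longrightarrow> S y \<in> Z"
    and S': "\<And>z. z \<in> Z \<Longrightarrow> S' z \<in> Y" "\<And>x z. \<lbrakk>x \<in> carrier X; z \<in> Z\<rbrakk> \<Longrightarrow> cinner X (S x) z = cinner X x (S' z)"
    and x: "x \<in> carrier X"
  shows "Q (S x) = S (P x)"
proof -
  have Px: "P x \<in> carrier X" by (rule op_in[OF P(1)])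
  let ?k = "S (x - P x)"
  have k: "?k \<in> carrier X" by (rule op_in[OF S])
  have Qk: "Q ?k \<in> carrier X" by (rule op_in[OF Q(1)])
  have "cinner X (Q ?k) (Q ?k) = cinner X ?k (Q ?k)"
    using Q(4)[OF k Qk] Q(3)[OF Q(2)] by simp
  also have "\<dots> = cinner X (x - P x) (S' (Q ?k))"
    by (rule S'(2)[OF diff_in[OF x Px] Q(2)])
  also have "\<dots> = 0" by (rule P(3)[OF x S'(1)[OF Q(2)]])
  finally have "Q ?k = 0" using nrm0D[OF Qk] by (simp add: ip_self[OF Qk])
  then have "Q (S x - S (P x)) = 0" using op_diff[OF S x Px] by simp
  then have "Q (S x) - Q (S (P x)) = 0" using op_diff[OF Q(1) op_in[OF S] op_in[OF S]] by simp
  then show ?thesis using Q(3)[OF SYZ[OF P(2)]] by simp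
qed

section \<open>Bicommutant\<close>

lemma (in pre_hilbert) ampl_delta:
  assumes T: "T \<in> operators X" and j: "j \<in> I" and x: "x \<in> carrier X"
  shows "ampl I X T (delta j x) = delta j (T x)"
proof
  fix i show "ampl I X T (delta j x) i = delta j (T x) i"
    unfolding ampl_at[OF delta_in[OF j x]] by (simp add: delta_def op_zero[OF T])
qed

lemma (in group) rcoset_facts:
  assumes H: "H \<lhd> G" and w: "w \<in> rcosets H"
  shows rcoset_carrier: "w \<subseteq> carrier G"
    and rcoset_mult: "\<lbrakk>t \<in> w; h \<in> H\<rbrakk> \<Longrightarrow> t \<otimes> h \<in> w"
    and rcoset_inv_mult: "\<lbrakk>t \<in> w; s \<in> w\<rbrakk> \<Longrightarrow> inv t \<otimes> s \<in> H"
proof -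
  interpret H: normal H G by (rule H)
  obtain g where g: "g \<in> carrier G" "w = H #> g" using w by (auto simp: RCOSETS_def)
  have w_eq: "w = {h \<otimes> g | h. h \<in> H}" unfolding g by (auto simp: r_coset_def)
  show wG: "w \<subseteq> carrier G" using r_coset_subset_G[OF H.subset g(1)] g(2) by simp
  show "t \<otimes> h \<in> w" if t: "t \<in> w" and h: "h \<in> H" for t h
  proof -
    obtain k where k: "k \<in> H" "t = k \<otimes> g" using t w_eq by auto
    have kG: "k \<in> carrier G" "h \<in> carrier G" using k h H.subset by auto
    have "t \<otimes> h = (k \<otimes> (g \<otimes> h \<otimes> inv g)) \<otimes> g"
      unfolding k using kG g by (simp add: m_assoc)
    moreover have "k \<otimes> (g \<otimes> h \<otimes> inv g) \<in> H" using H.inv_op_closed2[OF g(1) h] k by simp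
    ultimately show ?thesis unfolding w_eq by blast
  qed
  show "inv t \<otimes> s \<in> H" if t: "t \<in> w" and s: "s \<in> w" for t s
  proof -
    obtain k where k: "k \<in> H" "t = k \<otimes> g" using t w_eq by auto
    obtain l where l: "l \<in> H" "s = l \<otimes> g" using s w_eq by auto
    have kG: "k \<in> carrier G" "l \<in> carrier G" using k l H.subset by auto
    have "inv t \<otimes> s = inv g \<otimes> (inv k \<otimes> l) \<otimes> g"
      unfolding k l using kG g by (simp add: m_assoc inv_mult_group)
    then show ?thesis using H.inv_op_closed1[OF g(1), of "inv k \<otimes> l"] k l by simp
  qed
qed

context operator_bundle
begin

lemma approx_space_projection:
  assumes A: "A \<subseteq> carrier G" and \<xi>: "\<xi> \<in> carrier (ell2 J K)"
  shows "\<exists>P. P \<in> operators (ell2 J K) \<and> (\<forall>x. P x \<in> approx_space J \<xi> A) \<and> (\<forall>y\<in>approx_space J \<xi> A. P y = y) \<and>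
    (\<forall>x\<in>carrier (ell2 J K). \<forall>y\<in>approx_space J \<xi> A. cinner (ell2 J K) (x - P x) y = 0) \<and>
    (\<forall>x\<in>carrier (ell2 J K). \<forall>y\<in>carrier (ell2 J K). cinner (ell2 J K) (P x) y = cinner (ell2 J K) x (P y))"
proof -
  interpret L: complex_hilbert "ell2 J K" by (rule K.ell2_hilbert)
  show ?thesis
  proof (rule L.projection_exists[OF approx_space_subspace[OF A \<xi>]])
    show "approx_space J \<xi> A \<subseteq> carrier (ell2 J K)" by (auto simp: approx_space_def)
    fix s :: "nat \<Rightarrow> _" and l
    assume "\<And>n. s n \<in> approx_space J \<xi> A" "l \<in> carrier (ell2 J K)" "(\<lambda>n. nrm (ell2 J K) (s n - l)) \<longlonglongrightarrow> 0"
    then show "l \<in> approx_space J \<xi> A" by (rule approx_space_limit[OF A \<xi>])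
  qed
qed

text \<open>
  Let \<open>P\<close> and \<open>Q\<close> be the projections onto the closures of the vectors $b\xi$ with \<open>b\<close> in the span of the
  generators over \<open>H\<close> and over \<open>w\<close>. A generator \<open>g\<close> over \<open>w\<close> maps the first space into the second, and its
  adjoint maps back, so $Qg = gP$. Formally \<open>T\<close> is the sum of the generators built from its entries,
  a sum that converges only on vectors $x \otimes \delta_s$; comparing matrix entries therefore gives
  $QT = TP$. As $\xi$ lies in the first space, $T\xi = TP\xi = QT\xi$ lies in the second.
\<close>

lemma strong_approximation:
  assumes H: "H \<lhd> G" and w: "w \<in> rcosets H" and T: "T \<in> coset_algebra w"
    and \<xi>: "\<xi> \<in> carrier (ell2 J K)" and e: "e > 0"
  shows "\<exists>b\<in>lin w. nrm (ell2 J K) (ampl J K T \<xi> - ampl J K b \<xi>) < e"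
proof -
  interpret L: complex_hilbert "ell2 J K" by (rule K.ell2_hilbert)
  interpret H: normal H G by (rule H)
  note wG = rcoset_carrier[OF H w] and HG = H.subset
  let ?Y = "approx_space J \<xi> H" and ?Z = "approx_space J \<xi> w"
  have YL: "?Y \<subseteq> carrier (ell2 J K)" and ZL: "?Z \<subseteq> carrier (ell2 J K)" by (auto simp: approx_space_def)
  let ?ip = "cinner (ell2 J K)"
  obtain P where "P \<in> operators (ell2 J K) \<and> (\<forall>x. P x \<in> ?Y) \<and> (\<forall>y\<in>?Y. P y = y) \<and>
      (\<forall>x\<in>carrier (ell2 J K). \<forall>y\<in>?Y. ?ip (x - P x) y = 0) \<and>
      (\<forall>x\<in>carrier (ell2 J K). \<forall>y\<in>carrier (ell2 J K). ?ip (P x) y = ?ip x (P y))"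
    using approx_space_projection[OF HG \<xi>] by blast
  then have P: "P \<in> operators (ell2 J K)" "\<And>x. P x \<in> ?Y" "\<And>y. y \<in> ?Y \<Longrightarrow> P y = y"
    "\<And>x y. \<lbrakk>x \<in> carrier (ell2 J K); y \<in> ?Y\<rbrakk> \<Longrightarrow> ?ip (x - P x) y = 0"
    "\<And>x y. \<lbrakk>x \<in> carrier (ell2 J K); y \<in> carrier (ell2 J K)\<rbrakk> \<Longrightarrow> ?ip (P x) y = ?ip x (P y)"
    by simp_all
  obtain Q where "Q \<in> operators (ell2 J K) \<and> (\<forall>x. Q x \<in> ?Z) \<and> (\<forall>y\<in>?Z. Q y = y) \<and>
      (\<forall>x\<in>carrier (ell2 J K). \<forall>y\<in>?Z. ?ip (x - Q x) y = 0) \<and>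
      (\<forall>x\<in>carrier (ell2 J K). \<forall>y\<in>carrier (ell2 J K). ?ip (Q x) y = ?ip x (Q y))"
    using approx_space_projection[OF wG \<xi>] by blast
  then have Q: "Q \<in> operators (ell2 J K)" "\<And>x. Q x \<in> ?Z" "\<And>y. y \<in> ?Z \<Longrightarrow> Q y = y"
    "\<And>x y. \<lbrakk>x \<in> carrier (ell2 J K); y \<in> ?Z\<rbrakk> \<Longrightarrow> ?ip (x - Q x) y = 0"
    "\<And>x y. \<lbrakk>x \<in> carrier (ell2 J K); y \<in> carrier (ell2 J K)\<rbrakk> \<Longrightarrow> ?ip (Q x) y = ?ip x (Q y)"
    by simp_all
  have TK: "T \<in> operators K" using T by (simp add: coset_algebra_def)
  let ?A = "ampl J K T"
  note A = K.ampl_in[OF TK, of J]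
  have inter: "Q (ampl J K (tensor_lambda G X a t) \<zeta>) = ampl J K (tensor_lambda G X a t) (P \<zeta>)"
    if t: "t \<in> w" and a: "a \<in> N t" and \<zeta>: "\<zeta> \<in> carrier (ell2 J K)" for t a \<zeta>
  proof -
    have tG: "t \<in> carrier G" using t wG by blast
    note S = tensor_lambda_in[OF N_op[OF tG a] tG]
    have itG: "inv t \<in> carrier G" using tG by simp
    note a' = N_adj[OF tG a]
    note S' = tensor_lambda_in[OF N_op[OF itG a'] itG]
    show ?thesis
    proof (rule L.projection_intertwine[OF K.ampl_in[OF S] P(1,2,4) YL Q(1,2,3,5) ZL _ _ _ \<zeta>,
          where S' = "ampl J K (tensor_lambda G X (adj X a) (inv t))"])
      show "ampl J K (tensor_lambda G X a t) y \<in> ?Z" if "y \<in> ?Y" for y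
        by (rule approx_space_map[OF HG wG \<xi> S _ that])
          (rule gen_comp_lin[OF HG wG tG a rcoset_mult[OF H w t]])
      show "ampl J K (tensor_lambda G X (adj X a) (inv t)) z \<in> ?Y" if "z \<in> ?Z" for z
        by (rule approx_space_map[OF wG HG \<xi> S' _ that])
          (rule gen_comp_lin[OF wG HG itG a' rcoset_inv_mult[OF H w t]])
      show "cinner (ell2 J K) (ampl J K (tensor_lambda G X a t) x) z =
          cinner (ell2 J K) x (ampl J K (tensor_lambda G X (adj X a) (inv t)) z)"
        if x: "x \<in> carrier (ell2 J K)" and z: "z \<in> ?Z" for x z
      proof -
        have "z \<in> carrier (ell2 J K)" using z ZL by blast
        from K.ampl_adj_ip[OF S x this] show ?thesis
          unfolding tensor_lambda_adj[OF N_op[OF tG a] tG] .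
      qed
    qed
  qed
  have comm: "Q \<circ> ?A = ?A \<circ> P"
  proof (rule K.op_entries_eqI)
    show QA: "Q \<circ> ?A \<in> operators (ell2 J K)" by (rule L.op_comp_in[OF Q(1) A])
    show AP: "?A \<circ> P \<in> operators (ell2 J K)" by (rule L.op_comp_in[OF A P(1)])
    fix k j assume k: "k \<in> J" and j: "j \<in> J"
    show "mat_entry K (Q \<circ> ?A) k j = mat_entry K (?A \<circ> P) k j"
    proof (rule op_entries_eqI)
      show QA': "mat_entry K (Q \<circ> ?A) k j \<in> operators K" by (rule K.mat_entry_in[OF QA j])
      show AP': "mat_entry K (?A \<circ> P) k j \<in> operators K" by (rule K.mat_entry_in[OF AP j])
      fix r s assume r: "r \<in> carrier G" and s: "s \<in> carrier G"
      show "mat_entry X (mat_entry K (Q \<circ> ?A) k j) r s = mat_entry X (mat_entry K (?A \<circ> P) k j) r s"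
      proof (rule op_weak_eqI[OF mat_entry_in[OF QA' s] mat_entry_in[OF AP' s]])
        fix x y assume x: "x \<in> carrier X" and y: "y \<in> carrier X"
        define \<zeta> where "\<zeta> = delta j (delta s x)"
        define \<zeta>' where "\<zeta>' = delta k (delta r y)"
        have dx: "delta s x \<in> carrier K" and dy: "delta r y \<in> carrier K"
          using delta_in[OF s x] delta_in[OF r y] by blast+
        have \<zeta>: "\<zeta> \<in> carrier (ell2 J K)" and \<zeta>': "\<zeta>' \<in> carrier (ell2 J K)"
          unfolding \<zeta>_def \<zeta>'_def using K.delta_in[OF j dx] K.delta_in[OF k dy] by blast+
        have coord: "cinner X (\<eta> k r) y = cinner (ell2 J K) \<eta> \<zeta>'" if \<eta>: "\<eta> \<in> carrier (ell2 J K)" for \<eta>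
          unfolding \<zeta>'_def K.delta_ip_right[OF k dy \<eta>] delta_ip_right[OF r y K.ell2_at[OF \<eta>]] ..
        note P\<zeta> = L.op_in[OF P(1), of \<zeta>]
        note Q\<zeta>' = L.op_in[OF Q(1), of \<zeta>']
        note P\<zeta>k = K.ell2_at[OF P\<zeta>, of k]
        note Q\<zeta>'j = K.ell2_at[OF Q\<zeta>', of j]
        let ?f = "\<lambda>s'. cinner X (mat_entry X T r s' (P \<zeta> k s')) y"
        \<comment> \<open>Right invariance identifies the entry of \<open>T\<close> at \<open>(q, s)\<close> with the one at \<open>(r, h q)\<close>.\<close>
        define h where "h q = s \<otimes> (inv q \<otimes> r)" for q
        have h: "bij_betw h (carrier G) (carrier G)"
          by (rule bij_betwI[where g = "\<lambda>s'. r \<otimes> (inv s' \<otimes> s)"])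
            (use r s in \<open>auto simp: h_def inv_mult_group m_assoc, simp_all add: m_assoc[symmetric]\<close>)
        have term_eq: "cinner X (T (delta s x) q) (Q \<zeta>' j q) = ?f (h q)" if q: "q \<in> carrier G" for q
        proof -
          define t where "t = q \<otimes> inv s"
          define a where "a = mat_entry X T q s"
          have tG: "t \<in> carrier G" using q s by (simp add: t_def)
          have ts: "t \<otimes> s = q" using q s by (simp add: t_def m_assoc)
          have a: "a \<in> N t" using T q s by (simp add: a_def t_def coset_algebra_def)
          note aX = N_op[OF tG a]
          have "mat_entry X T (q \<otimes> (inv q \<otimes> r)) (s \<otimes> (inv q \<otimes> r)) = a"
            using T q r s by (simp add: coset_algebra_def a_def del: m_assoc)
          moreover have "q \<otimes> (inv q \<otimes> r) = r" using q r by (simp add: m_assoc[symmetric])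
          ultimately have ra: "mat_entry X T r (h q) = a" by (simp add: h_def)
          have ax: "T (delta s x) q = a x" using x by (simp add: a_def mat_entry_apply)
          show ?thesis
          proof (cases "t \<in> w")
            case True
            let ?g = "ampl J K (tensor_lambda G X a t)"
            note S = tensor_lambda_in[OF aX tG]
            have g\<zeta>: "?g \<zeta> = delta j (delta q (a x))"
              unfolding \<zeta>_def K.ampl_delta[OF S j dx]
                tensor_lambda_delta[OF group_axioms complex_hilbert_axioms aX tG s x] ts ..
            have dax: "delta q (a x) \<in> carrier K" by (rule delta_in[OF q op_in[OF aX]])
            have "cinner X (a x) (Q \<zeta>' j q) = cinner (ell2 J K) (?g \<zeta>) (Q \<zeta>')"
              unfolding g\<zeta> K.delta_ip_left[OF j dax Q\<zeta>'] delta_ip_left[OF q op_in[OF aX] Q\<zeta>'j] ..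
            also have "\<dots> = cinner (ell2 J K) (Q (?g \<zeta>)) \<zeta>'"
              by (rule Q(5)[symmetric, OF L.op_in[OF K.ampl_in[OF S]] \<zeta>'])
            also have "\<dots> = cinner (ell2 J K) (?g (P \<zeta>)) \<zeta>'" unfolding inter[OF True a \<zeta>] ..
            also have "\<dots> = cinner X (?g (P \<zeta>) k r) y"
              by (rule coord[symmetric, OF L.op_in[OF K.ampl_in[OF S]]])
            also have "?g (P \<zeta>) k r = a (P \<zeta> k (inv t \<otimes> r))"
              using r by (simp add: K.ampl_at[OF P\<zeta>] tensor_lambda_at[OF P\<zeta>k])
            also have "inv t \<otimes> r = h q"
              using q r s by (simp add: t_def h_def inv_mult_group m_assoc)
            finally show ?thesis unfolding ax ra .
          next
            case False
            then have "a = 0" using T q s by (simp add: a_def t_def coset_algebra_def)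
            then show ?thesis unfolding ax ra using y ell2_at[OF Q\<zeta>'j] by simp
          qed
        qed
        have "cinner X (mat_entry X (mat_entry K (Q \<circ> ?A) k j) r s x) y = cinner X (Q (?A \<zeta>) k r) y"
          using x dx by (simp add: mat_entry_apply K.mat_entry_apply \<zeta>_def)
        also have "\<dots> = cinner (ell2 J K) (?A \<zeta>) (Q \<zeta>')"
          unfolding coord[OF L.op_in[OF Q(1)]] by (rule Q(5)[OF L.op_in[OF A] \<zeta>'])
        also have "\<dots> = cinner K (T (delta s x)) (Q \<zeta>' j)"
          unfolding \<zeta>_def K.ampl_delta[OF TK j dx] K.delta_ip_left[OF j K.op_in[OF TK] Q\<zeta>'] ..
        also have "\<dots> = (\<Sum>\<^sub>\<infinity>q\<in>carrier G. ?f (h q))"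
          unfolding ell2_cinner by (rule infsum_cong) (rule term_eq)
        also have "\<dots> = (\<Sum>\<^sub>\<infinity>s'\<in>carrier G. ?f s')"
          by (rule infsum_reindex_bij_betw[OF h])
        also have "\<dots> = cinner X (T (P \<zeta> k) r) y"
          by (rule infsumI[OF op_row_expansion[OF TK P\<zeta>k r y]])
        also have "T (P \<zeta> k) r = mat_entry X (mat_entry K (?A \<circ> P) k j) r s x"
          using x dx by (simp add: mat_entry_apply K.mat_entry_apply \<zeta>_def[symmetric] K.ampl_at[OF P\<zeta>])
        finally show "cinner X (mat_entry X (mat_entry K (Q \<circ> ?A) k j) r s x) y
          = cinner X (mat_entry X (mat_entry K (?A \<circ> P) k j) r s x) y" .
      qed
    qed
  qed
  have "\<xi> \<in> ?Y"
  proof -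
    have id: "tensor_lambda G X (id_op X) \<one> \<in> lin H"
      unfolding gens_def using N_id H.one_closed by (intro complex_vector.span_base) blast
    have "ampl J K (tensor_lambda G X (id_op X) \<one>) \<xi> = \<xi>"
      using tensor_lambda_one[OF K.ell2_at[OF \<xi>]] by (simp add: fun_eq_iff K.ampl_at[OF \<xi>])
    then have "nrm (ell2 J K) (\<xi> - ampl J K (tensor_lambda G X (id_op X) \<one>) \<xi>) = 0"
      using L.nrm_zero by simp
    then show ?thesis using id \<xi> unfolding approx_space_def by (auto intro!: bexI[OF _ id])
  qed
  then have "?A \<xi> = Q (?A \<xi>)"
    using P(3) fun_cong[OF comm, of \<xi>] by simp
  then have "?A \<xi> \<in> ?Z" using Q(2) by metis
  then show ?thesis using e unfolding approx_space_def by blast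
qed

text \<open>Finitely many square-summable sequences of vectors form a single square-summable family. Strong approximation on that
  family approximates the corresponding normal functionals all at once.\<close>

theorem coset_algebra_eq_closure:
  assumes H: "H \<lhd> G" and w: "w \<in> rcosets H"
  shows "weakstar_op K closure_of lin w = coset_algebra w"
proof (rule equalityI)
  note wG = rcoset_carrier[OF H w]
  show "weakstar_op K closure_of lin w \<subseteq> coset_algebra w" by (rule closure_subset_coset_algebra[OF wG])
  show "coset_algebra w \<subseteq> weakstar_op K closure_of lin w"
  proof
    fix T assume T: "T \<in> coset_algebra w"
    then have TK: "T \<in> operators K" by (simp add: coset_algebra_def)
    let ?Z = "ell2 (UNIV :: nat set) K"
    interpret Z: complex_hilbert ?Z by (rule K.ell2_hilbert)
    show "T \<in> weakstar_op K closure_of lin w"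
    proof (rule K.in_weakstar_closure[OF TK])
      show "lin w \<subseteq> operators K" using lin_op[OF wG] by blast
      fix \<Psi> :: "((nat \<Rightarrow> 'g \<Rightarrow> 'x) \<times> (nat \<Rightarrow> 'g \<Rightarrow> 'x)) set" and e :: real
      assume fin: "finite \<Psi>" and \<Psi>: "\<Psi> \<subseteq> carrier ?Z \<times> carrier ?Z" and e: "e > 0"
      define \<xi>0 where "\<xi>0 = (\<lambda>\<psi>. if \<psi> \<in> \<Psi> then fst \<psi> else 0)"
      have \<xi>0: "\<xi>0 \<in> carrier (ell2 \<Psi> ?Z)"
        using \<Psi> fin by (intro Z.ell2I) (auto simp: \<xi>0_def)
      define \<xi> where "\<xi> = (\<lambda>(\<psi>, n). \<xi>0 \<psi> n)"
      have \<xi>: "\<xi> \<in> carrier (ell2 (\<Psi> \<times> UNIV) K)" unfolding \<xi>_def by (rule K.uncurry_in[OF \<xi>0])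
      interpret L: complex_hilbert "ell2 (\<Psi> \<times> (UNIV :: nat set)) K" by (rule K.ell2_hilbert)
      define M where "M = (\<Sum>\<psi>\<in>\<Psi>. nrm ?Z (snd \<psi>)) + 1"
      have sn: "snd \<psi> \<in> carrier ?Z" if "\<psi> \<in> \<Psi>" for \<psi> using that \<Psi> by auto
      have M: "nrm ?Z (snd \<psi>) < M" if "\<psi> \<in> \<Psi>" for \<psi>
        using member_le_sum[OF that _ fin, of "\<lambda>\<psi>. nrm ?Z (snd \<psi>)"] Z.nrm_ge_0 sn unfolding M_def by fastforce
      have M0: "M > 0" unfolding M_def using Z.nrm_ge_0 sn by (intro add_nonneg_pos sum_nonneg) auto
      have eM: "e / M > 0" using e M0 by simp
      obtain b where b: "b \<in> lin w"
        "nrm (ell2 (\<Psi> \<times> UNIV) K) (ampl (\<Psi> \<times> UNIV) K T \<xi> - ampl (\<Psi> \<times> UNIV) K b \<xi>) < e / M"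
        using strong_approximation[OF H w T \<xi> eM] by blast
      note bK = lin_op[OF wG b(1)]
      define \<eta> where "\<eta> = ampl (\<Psi> \<times> UNIV) K T \<xi> - ampl (\<Psi> \<times> UNIV) K b \<xi>"
      have \<eta>: "\<eta> \<in> carrier (ell2 (\<Psi> \<times> UNIV) K)"
        unfolding \<eta>_def by (intro L.diff_in K.ampl_closed(1) TK bK \<xi>)
      define c where "c = (\<lambda>\<psi> n. \<eta> (\<psi>, n))"
      have c: "c \<in> carrier (ell2 \<Psi> ?Z)" unfolding c_def by (rule K.curry_in[OF \<eta>])
      have "nrm (ell2 \<Psi> ?Z) c = nrm (ell2 (\<Psi> \<times> UNIV) K) \<eta>"
        unfolding K.uncurry_nrm[OF c] by (simp add: c_def)
      then have c_le: "nrm ?Z (c \<psi>) < e / M" for \<psi>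
        using Z.ell2_coord_le[OF c, of \<psi>] b(2) unfolding \<eta>_def by simp
      have "cmod (cinner ?Z (ampl UNIV K b x) y - cinner ?Z (ampl UNIV K T x) y) < e" if xy: "(x, y) \<in> \<Psi>" for x y
      proof -
        have x: "x \<in> carrier ?Z" and y: "y \<in> carrier ?Z" using xy \<Psi> by auto
        have cx: "c (x, y) = ampl UNIV K T x - ampl UNIV K b x"
        proof
          fix n
          have "\<xi> ((x, y), n) = x n" using xy by (simp add: \<xi>_def \<xi>0_def)
          then show "c (x, y) n = (ampl UNIV K T x - ampl UNIV K b x) n"
            by (simp add: c_def \<eta>_def K.ampl_at[OF \<xi>] K.ampl_at[OF x])
        qed
        have "cinner ?Z (c (x, y)) y = cinner ?Z (ampl UNIV K T x) y - cinner ?Z (ampl UNIV K b x) y"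
          unfolding cx by (rule Z.ip_diff_left[OF K.ampl_closed(1)[OF TK x] K.ampl_closed(1)[OF bK x] y])
        then have "cmod (cinner ?Z (ampl UNIV K b x) y - cinner ?Z (ampl UNIV K T x) y) = cmod (cinner ?Z (c (x, y)) y)"
          by (simp add: norm_minus_commute)
        also have "\<dots> \<le> nrm ?Z (c (x, y)) * nrm ?Z y"
          by (rule Z.cauchy_schwarz[OF Z.ell2_at[OF c] y])
        also have "\<dots> \<le> e / M * nrm ?Z y"
          using c_le[of "(x, y)"] Z.nrm_ge_0[OF y] by (intro mult_right_mono) auto
        also have "\<dots> < e / M * M" using M[OF xy] eM by (intro mult_strict_left_mono) auto
        also have "\<dots> = e" using M0 by simp
        finally show ?thesis .
      qed
      then show "\<exists>s\<in>lin w. \<forall>(x, y)\<in>\<Psi>. cmod (cinner ?Z (ampl UNIV K s x) y - cinner ?Z (ampl UNIV K T x) y) < e"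
        using b(1) by blast
    qed
  qed
qed

end

section \<open>Permutations of the index set\<close>

definition permute_op ::
    "'i set \<Rightarrow> 'j set \<Rightarrow> ('v::complex_vector, 'b) chilb_scheme \<Rightarrow> ('i \<times> 'j \<Rightarrow> 'i \<times> 'j)
     \<Rightarrow> ('i \<Rightarrow> 'j \<Rightarrow> 'v) \<Rightarrow> 'i \<Rightarrow> 'j \<Rightarrow> 'v" where
  "permute_op I J X \<sigma> f = (if f \<in> carrier (ell2 I (ell2 J X))
     then (\<lambda>i j. if (i, j) \<in> I \<times> J then f (fst (\<sigma> (i, j))) (snd (\<sigma> (i, j))) else 0) else 0)"

context complex_hilbert
begin

lemma permute_op_at:
  assumes "f \<in> carrier (ell2 I (ell2 J X))" "i \<in> I" "j \<in> J" "\<sigma> (i, j) = (k, l)"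
  shows "permute_op I J X \<sigma> f i j = f k l"
  using assms by (simp add: permute_op_def)

lemma permute_op_curry:
  assumes f: "f \<in> carrier (ell2 I (ell2 J X))"
  shows "permute_op I J X \<sigma> f =
    (\<lambda>i j. (\<lambda>p. if p \<in> I \<times> J then (\<lambda>(i, j). f i j) (\<sigma> p) else 0) (i, j))"
  using f by (simp add: permute_op_def fun_eq_iff case_prod_beta)

lemma permute_op_closed:
  assumes \<sigma>: "bij_betw \<sigma> (I \<times> J) (I \<times> J)" and f: "f \<in> carrier (ell2 I (ell2 J X))"
  shows "permute_op I J X \<sigma> f \<in> carrier (ell2 I (ell2 J X))"
  unfolding permute_op_curry[OF f] by (rule curry_in[OF ell2_permute[OF \<sigma> uncurry_in[OF f]]])

lemma permute_op_isometric:
  assumes \<sigma>: "bij_betw \<sigma> (I \<times> J) (I \<times> J)"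
    and f: "f \<in> carrier (ell2 I (ell2 J X))" and g: "g \<in> carrier (ell2 I (ell2 J X))"
  shows "cinner (ell2 I (ell2 J X)) (permute_op I J X \<sigma> f) (permute_op I J X \<sigma> g)
    = cinner (ell2 I (ell2 J X)) f g"
  unfolding uncurry_ip[OF permute_op_closed[OF \<sigma> f] permute_op_closed[OF \<sigma> g]] uncurry_ip[OF f g]
  unfolding permute_op_curry[OF f] permute_op_curry[OF g] prod.case_eq_if prod.collapse
  by (rule ell2_permute_ip[OF \<sigma>, unfolded prod.case_eq_if])

lemma permute_op_in:
  assumes \<sigma>: "bij_betw \<sigma> (I \<times> J) (I \<times> J)"
  shows "permute_op I J X \<sigma> \<in> operators (ell2 I (ell2 J X))"
proof -
  interpret J: complex_hilbert "ell2 J X" by (rule ell2_hilbert)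
  interpret L: complex_hilbert "ell2 I (ell2 J X)" by (rule J.ell2_hilbert)
  show ?thesis
  proof (rule L.operatorsI[where B = 1])
    fix f g and c :: complex assume f: "f \<in> carrier (ell2 I (ell2 J X))"
    show "permute_op I J X \<sigma> f \<in> carrier (ell2 I (ell2 J X))" by (rule permute_op_closed[OF \<sigma> f])
    show "nrm (ell2 I (ell2 J X)) (permute_op I J X \<sigma> f) \<le> 1 * nrm (ell2 I (ell2 J X)) f"
      using permute_op_isometric[OF \<sigma> f f] L.nrm_sq[OF f] L.nrm_ge_0[OF f]
      by (simp add: L.nrm_eqI[OF permute_op_closed[OF \<sigma> f]])
    show "permute_op I J X \<sigma> (c *\<^sub>C f) = c *\<^sub>C permute_op I J X \<sigma> f"
      using f L.scale_in[OF f, of c] by (simp add: permute_op_def fun_eq_iff)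
    assume g: "g \<in> carrier (ell2 I (ell2 J X))"
    show "permute_op I J X \<sigma> (f + g) = permute_op I J X \<sigma> f + permute_op I J X \<sigma> g"
      using f g L.add_in[OF f g] by (simp add: permute_op_def fun_eq_iff)
  qed (simp add: permute_op_def)
qed

lemma permute_op_inverse:
  assumes \<sigma>: "bij_betw \<sigma> (I \<times> J) (I \<times> J)" and f: "f \<in> carrier (ell2 I (ell2 J X))"
    and inv: "\<And>p. p \<in> I \<times> J \<Longrightarrow> \<tau> p \<in> I \<times> J \<and> \<sigma> (\<tau> p) = p"
  shows "permute_op I J X \<tau> (permute_op I J X \<sigma> f) = f"
proof -
  interpret J: complex_hilbert "ell2 J X" by (rule ell2_hilbert)
  have "permute_op I J X \<tau> (permute_op I J X \<sigma> f) i j = f i j" for i j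
  proof (cases "(i, j) \<in> I \<times> J")
    case True
    obtain k l where kl: "\<tau> (i, j) = (k, l)" by (cases "\<tau> (i, j)")
    have "k \<in> I" "l \<in> J" "\<sigma> (k, l) = (i, j)" using inv[OF True] kl by auto
    then show ?thesis
      using True kl permute_op_at[OF permute_op_closed[OF \<sigma> f]] permute_op_at[OF f] by simp
  next
    case False
    then have "f i j = 0" using J.ell2_outside[OF f] ell2_outside[OF J.ell2_at[OF f]] by fastforce
    then show ?thesis
      using False permute_op_closed[OF \<sigma> f] by (auto simp: permute_op_def)
  qed
  then show ?thesis by blast
qed

lemma permute_op_adj_ip:
  assumes \<sigma>: "bij_betw \<sigma> (I \<times> J) (I \<times> J)" and \<tau>: "bij_betw \<tau> (I \<times> J) (I \<times> J)"
    and f: "f \<in> carrier (ell2 I (ell2 J X))" and g: "g \<in> carrier (ell2 I (ell2 J X))"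
    and inv: "\<And>p. p \<in> I \<times> J \<Longrightarrow> \<sigma> p \<in> I \<times> J \<and> \<tau> (\<sigma> p) = p"
  shows "cinner (ell2 I (ell2 J X)) (permute_op I J X \<sigma> f) g = cinner (ell2 I (ell2 J X)) f (permute_op I J X \<tau> g)"
  using permute_op_isometric[OF \<sigma> f permute_op_closed[OF \<tau> g]] permute_op_inverse[OF \<tau> g, of \<sigma>] inv by simp

lemma permute_op_delta:
  assumes \<sigma>: "bij_betw \<sigma> (I \<times> J) (I \<times> J)" and kl: "k \<in> I" "l \<in> J" "\<sigma> (k, l) = (i, j)"
    and ij: "i \<in> I" "j \<in> J" and x: "x \<in> carrier X"
  shows "permute_op I J X \<sigma> (delta i (delta j x)) = delta k (delta l x)"
proof -
  interpret J: complex_hilbert "ell2 J X" by (rule ell2_hilbert)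
  have d: "delta i (delta j x) \<in> carrier (ell2 I (ell2 J X))"
    by (rule J.delta_in[OF ij(1) delta_in[OF ij(2) x]])
  have iff: "\<sigma> (a, b) = (i, j) \<longleftrightarrow> a = k \<and> b = l" if "a \<in> I" "b \<in> J" for a b
    using \<sigma> kl that inj_onD[of \<sigma> "I \<times> J" "(a, b)" "(k, l)"] by (auto simp: bij_betw_def)
  have dd: "delta i (delta j x) a b = (if (a, b) = (i, j) then x else 0)"
    for i a j b by (simp add: delta_def)
  have "permute_op I J X \<sigma> (delta i (delta j x)) a b = delta k (delta l x) a b" for a b
  proof (cases "a \<in> I \<and> b \<in> J")
    case True
    obtain m n where mn: "\<sigma> (a, b) = (m, n)" by (cases "\<sigma> (a, b)")
    show ?thesis
      unfolding dd[of k l] using True iff[of a b] permute_op_at[OF d, of a b \<sigma>, OF _ _ mn]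
      by (simp add: mn dd)
  next
    case False
    then show ?thesis unfolding dd using kl d by (auto simp: permute_op_def)
  qed
  then show ?thesis by blast
qed

text \<open>A normal functional of $T \otimes 1$ is the normal functional of \<open>T\<close> given by the uncurried families.\<close>

lemma ampl_continuous:
  "continuous_map (weakstar_op X) (weakstar_op (ell2 I X)) (ampl I X)"
proof -
  interpret I: complex_hilbert "ell2 I X" by (rule ell2_hilbert)
  show ?thesis
  proof (rule I.weakstar_continuousI)
    show "ampl I X T \<in> operators (ell2 I X)" if "T \<in> topspace (weakstar_op X)" for T
      using that by (simp add: ampl_in)
    fix x y assume x: "x \<in> carrier (ell2 (UNIV :: nat set) (ell2 I X))" and y: "y \<in> carrier (ell2 (UNIV :: nat set) (ell2 I X))"
    note x' = uncurry_in[OF x] and y' = uncurry_in[OF y]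
    show "continuous_map (weakstar_op X) euclidean
        (\<lambda>T. cinner (ell2 UNIV (ell2 I X)) (ampl UNIV (ell2 I X) (ampl I X T) x) y)"
    proof (rule continuous_map_eq[OF weakstar_continuous[OF x' y']])
      fix T assume "T \<in> topspace (weakstar_op X)"
      then have T: "T \<in> operators X" by simp
      have "(\<lambda>(i, j). ampl UNIV (ell2 I X) (ampl I X T) x i j) = ampl (UNIV \<times> I) X T (\<lambda>(i, j). x i j)"
        by (auto simp: fun_eq_iff ampl_at[OF x'] I.ampl_at[OF x] ampl_at[OF I.ell2_at[OF x]])
      then show "cinner (ell2 (UNIV \<times> I) X) (ampl (UNIV \<times> I) X T (\<lambda>(i, j). x i j)) (\<lambda>(i, j). y i j) =
          cinner (ell2 UNIV (ell2 I X)) (ampl UNIV (ell2 I X) (ampl I X T) x) y"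
        using uncurry_ip[OF I.ampl_closed(1)[OF ampl_in[OF T] x] y] by simp
    qed
  qed
qed

lemma mat_entry_ampl:
  assumes T: "T \<in> operators X" and s: "s \<in> I"
  shows "mat_entry X (ampl I X T) r s = (if r = s then T else 0)"
proof
  fix x show "mat_entry X (ampl I X T) r s x = (if r = s then T else 0) x"
    using ampl_delta[OF T s, of x] op_outside[OF T, of x] by (auto simp: mat_entry_def delta_def)
qed

end

section \<open>Kernels over a quotient group\<close>

text \<open>
  The quotient group appears as a group \<open>Q\<close> with a surjective homomorphism \<open>q\<close> from \<open>G\<close> and a section \<open>t\<close>
  of it, so that membership in a coset becomes an equation in \<open>Q\<close>.
\<close>

locale kernel_quotient = operator_bundle G X N + Q: group Q
  for G :: "('g, 'c) monoid_scheme" (structure) and X :: "('x::complex_vector) chilb"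
    and N :: "'g \<Rightarrow> ('x \<Rightarrow> 'x) set" and Q :: "('q, 'd) monoid_scheme" +
  fixes q :: "'g \<Rightarrow> 'q" and t :: "'q \<Rightarrow> 'g"
  assumes q_closed [simp]: "x \<in> carrier G \<Longrightarrow> q x \<in> carrier Q"
    and q_mult [simp]: "\<lbrakk>x \<in> carrier G; y \<in> carrier G\<rbrakk> \<Longrightarrow> q (x \<otimes> y) = q x \<otimes>\<^bsub>Q\<^esub> q y"
    and t_closed [simp]: "c \<in> carrier Q \<Longrightarrow> t c \<in> carrier G"
    and q_t [simp]: "c \<in> carrier Q \<Longrightarrow> q (t c) = c"
    and t_one: "t \<one>\<^bsub>Q\<^esub> = \<one>"
begin

abbreviation "L \<equiv> ell2 (carrier Q) K"

sublocale L: complex_hilbert L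
  by (rule K.ell2_hilbert)

lemma q_one [simp]: "q \<one> = \<one>\<^bsub>Q\<^esub>"
  using q_t[of "\<one>\<^bsub>Q\<^esub>"] by (simp add: t_one)

lemma q_inv [simp]: "x \<in> carrier G \<Longrightarrow> q (inv x) = inv\<^bsub>Q\<^esub> q x"
  using q_mult[of "inv x" x] by (intro Q.inv_equality[symmetric]) simp_all

abbreviation fiber :: "'q \<Rightarrow> 'g set" where
  "fiber c \<equiv> {x \<in> carrier G. q x = c}"

abbreviation entry2 :: "(('q \<Rightarrow> 'g \<Rightarrow> 'x) \<Rightarrow> 'q \<Rightarrow> 'g \<Rightarrow> 'x) \<Rightarrow> 'q \<Rightarrow> 'g \<Rightarrow> 'q \<Rightarrow> 'g \<Rightarrow> 'x \<Rightarrow> 'x" where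
  "entry2 S u a v b \<equiv> mat_entry X (mat_entry K S u v) a b"

definition quotient_kernels :: "(('q \<Rightarrow> 'g \<Rightarrow> 'x) \<Rightarrow> 'q \<Rightarrow> 'g \<Rightarrow> 'x) set" where
  "quotient_kernels = {S \<in> operators L. \<forall>u\<in>carrier Q. \<forall>v\<in>carrier Q.
     mat_entry K S u v \<in> coset_algebra (fiber (u \<otimes>\<^bsub>Q\<^esub> inv\<^bsub>Q\<^esub> v))}"

definition invariant_kernels :: "(('g \<Rightarrow> 'x) \<Rightarrow> 'g \<Rightarrow> 'x) set" where
  "invariant_kernels = {T \<in> operators K.
     (\<forall>r\<in>carrier G. \<forall>s\<in>carrier G. mat_entry X T r s \<in> N (r \<otimes> inv s)) \<and>
     (\<forall>h\<in>fiber \<one>\<^bsub>Q\<^esub>. \<forall>r\<in>carrier G. \<forall>s\<in>carrier G. mat_entry X T (r \<otimes> h) (s \<otimes> h) = mat_entry X T r s)}"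

lemma entry2_apply: "b \<in> carrier G \<Longrightarrow> x \<in> carrier X \<Longrightarrow> entry2 S u a v b x = S (delta v (delta b x)) u a"
  by (simp add: mat_entry_apply K.mat_entry_apply delta_in)

lemma entry2_outside: "x \<notin> carrier X \<Longrightarrow> entry2 S u a v b x = 0"
  by (simp add: mat_entry_def)

lemma entry2_eqI:
  assumes S: "S \<in> operators L" and S': "S' \<in> operators L"
    and eq: "\<And>u a v b. \<lbrakk>u \<in> carrier Q; a \<in> carrier G; v \<in> carrier Q; b \<in> carrier G\<rbrakk>
      \<Longrightarrow> entry2 S u a v b = entry2 S' u a v b"
  shows "S = S'"
proof (rule K.op_entries_eqI[OF S S'])
  fix u v assume u: "u \<in> carrier Q" and v: "v \<in> carrier Q"
  show "mat_entry K S u v = mat_entry K S' u v"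
    by (rule op_entries_eqI[OF K.mat_entry_in[OF S v] K.mat_entry_in[OF S' v]]) (rule eq[OF u _ v])
qed

text \<open>The permutation that makes the kernels of the quotient bundle block diagonal, and its inverse.\<close>

abbreviation "\<sigma> \<equiv> \<lambda>(c, r). (q r, r \<otimes> inv (t c))"
abbreviation "\<tau> \<equiv> \<lambda>(u, a). (inv\<^bsub>Q\<^esub> q a \<otimes>\<^bsub>Q\<^esub> u, a \<otimes> t (inv\<^bsub>Q\<^esub> q a \<otimes>\<^bsub>Q\<^esub> u))"
abbreviation "GQ \<equiv> carrier Q \<times> carrier G"

lemma \<tau>_\<sigma>: "p \<in> GQ \<Longrightarrow> \<sigma> p \<in> GQ \<and> \<tau> (\<sigma> p) = p"
  by (auto simp: Q.inv_mult_group Q.m_assoc m_assoc)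

lemma \<sigma>_\<tau>: "p \<in> GQ \<Longrightarrow> \<tau> p \<in> GQ \<and> \<sigma> (\<tau> p) = p"
  by (auto simp: Q.m_assoc[symmetric] m_assoc)

lemma bij_\<sigma>: "bij_betw \<sigma> GQ GQ"
  by (rule bij_betwI[where g = \<tau>]) (use \<tau>_\<sigma> \<sigma>_\<tau> in \<open>blast+\<close>)

lemma bij_\<tau>: "bij_betw \<tau> GQ GQ"
  by (rule bij_betwI[where g = \<sigma>]) (use \<tau>_\<sigma> \<sigma>_\<tau> in \<open>blast+\<close>)

definition \<Phi> :: "('q \<Rightarrow> 'g \<Rightarrow> 'x) \<Rightarrow> 'q \<Rightarrow> 'g \<Rightarrow> 'x" where
  "\<Phi> = permute_op (carrier Q) (carrier G) X \<sigma>"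

definition \<Psi> :: "('q \<Rightarrow> 'g \<Rightarrow> 'x) \<Rightarrow> 'q \<Rightarrow> 'g \<Rightarrow> 'x" where
  "\<Psi> = permute_op (carrier Q) (carrier G) X \<tau>"

lemma \<Phi>_in: "\<Phi> \<in> operators L" unfolding \<Phi>_def by (rule permute_op_in[OF bij_\<sigma>])

lemma \<Psi>_in: "\<Psi> \<in> operators L" unfolding \<Psi>_def by (rule permute_op_in[OF bij_\<tau>])

lemma \<Phi>_\<Psi>: "f \<in> carrier L \<Longrightarrow> \<Phi> (\<Psi> f) = f"
  unfolding \<Phi>_def \<Psi>_def by (rule permute_op_inverse[OF bij_\<tau> _ \<tau>_\<sigma>])

lemma \<Psi>_\<Phi>: "f \<in> carrier L \<Longrightarrow> \<Psi> (\<Phi> f) = f"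
  unfolding \<Phi>_def \<Psi>_def by (rule permute_op_inverse[OF bij_\<sigma> _ \<sigma>_\<tau>])

lemma \<Phi>_ip: "\<lbrakk>f \<in> carrier L; g \<in> carrier L\<rbrakk> \<Longrightarrow> cinner L (\<Phi> f) g = cinner L f (\<Psi> g)"
  unfolding \<Phi>_def \<Psi>_def by (rule permute_op_adj_ip[OF bij_\<sigma> bij_\<tau> _ _ \<tau>_\<sigma>])

lemma \<Psi>_ip: "\<lbrakk>f \<in> carrier L; g \<in> carrier L\<rbrakk> \<Longrightarrow> cinner L (\<Psi> f) g = cinner L f (\<Phi> g)"
  unfolding \<Phi>_def \<Psi>_def by (rule permute_op_adj_ip[OF bij_\<tau> bij_\<sigma> _ _ \<sigma>_\<tau>])

lemma \<Phi>_nrm: "f \<in> carrier L \<Longrightarrow> nrm L (\<Phi> f) = nrm L f"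
  using \<Phi>_ip[of f "\<Phi> f"] L.nrm_sq[of f] L.op_in[OF \<Phi>_in, of f]
  by (intro L.nrm_eqI) (simp_all add: \<Psi>_\<Phi> L.nrm_ge_0)

lemma \<Psi>_nrm: "f \<in> carrier L \<Longrightarrow> nrm L (\<Psi> f) = nrm L f"
  using \<Psi>_ip[of f "\<Psi> f"] L.nrm_sq[of f] L.op_in[OF \<Psi>_in, of f]
  by (intro L.nrm_eqI) (simp_all add: \<Phi>_\<Psi> L.nrm_ge_0)

definition twist :: "(('q \<Rightarrow> 'g \<Rightarrow> 'x) \<Rightarrow> 'q \<Rightarrow> 'g \<Rightarrow> 'x) \<Rightarrow> ('q \<Rightarrow> 'g \<Rightarrow> 'x) \<Rightarrow> 'q \<Rightarrow> 'g \<Rightarrow> 'x" where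
  "twist S = \<Phi> \<circ> S \<circ> \<Psi>"

definition untwist :: "(('q \<Rightarrow> 'g \<Rightarrow> 'x) \<Rightarrow> 'q \<Rightarrow> 'g \<Rightarrow> 'x) \<Rightarrow> ('q \<Rightarrow> 'g \<Rightarrow> 'x) \<Rightarrow> 'q \<Rightarrow> 'g \<Rightarrow> 'x" where
  "untwist S = \<Psi> \<circ> S \<circ> \<Phi>"

lemma twist_in: "S \<in> operators L \<Longrightarrow> twist S \<in> operators L"
  unfolding twist_def by (intro L.op_comp_in \<Phi>_in \<Psi>_in)

lemma untwist_in: "S \<in> operators L \<Longrightarrow> untwist S \<in> operators L"
  unfolding untwist_def by (intro L.op_comp_in \<Phi>_in \<Psi>_in)

lemma twist_untwist: "S \<in> operators L \<Longrightarrow> twist (untwist S) = S"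
proof (rule L.op_eqI)
  assume S: "S \<in> operators L"
  fix f assume "f \<in> carrier L"
  then show "twist (untwist S) f = S f"
    using \<Phi>_\<Psi>[OF L.op_in[OF S]] by (simp add: twist_def untwist_def \<Phi>_\<Psi>)
qed (simp_all add: twist_in untwist_in)

lemma untwist_twist: "S \<in> operators L \<Longrightarrow> untwist (twist S) = S"
proof (rule L.op_eqI)
  assume S: "S \<in> operators L"
  fix f assume "f \<in> carrier L"
  then show "untwist (twist S) f = S f"
    using \<Psi>_\<Phi>[OF L.op_in[OF S]] by (simp add: twist_def untwist_def \<Psi>_\<Phi>)
qed (simp_all add: twist_in untwist_in)

lemma twist_comp:
  assumes S: "S \<in> operators L" and T: "T \<in> operators L"
  shows "twist (S \<circ> T) = twist S \<circ> twist T"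
proof (rule L.op_eqI)
  fix f assume "f \<in> carrier L"
  show "twist (S \<circ> T) f = (twist S \<circ> twist T) f"
    by (simp add: twist_def \<Psi>_\<Phi>[OF L.op_in[OF T]])
qed (use assms in \<open>simp_all add: twist_in L.op_comp_in\<close>)

lemma twist_adj:
  assumes S: "S \<in> operators L"
  shows "adj L (twist S) = twist (adj L S)"
proof (rule L.adj_eqI)
  note S' = L.adj_in[OF S]
  show "twist (adj L S) \<in> operators L" by (rule twist_in[OF S'])
  fix f g assume f: "f \<in> carrier L" and g: "g \<in> carrier L"
  show "cinner L (twist S f) g = cinner L f (twist (adj L S) g)"
    using \<Phi>_ip[OF L.op_in[OF S] g] L.adj_ip[OF S L.op_in[OF \<Psi>_in] L.op_in[OF \<Psi>_in]]
      \<Psi>_ip[OF f L.op_in[OF S']] by (simp add: twist_def)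
qed

lemma twist_continuous: "continuous_map (weakstar_op L) (weakstar_op L) twist"
proof (rule weakstar_continuous_sandwich[where U = \<Psi> and V = \<Psi>])
  fix T f g assume "T \<in> operators L" "f \<in> carrier L" "g \<in> carrier L"
  then show "cinner L (twist T f) g = cinner L (T (\<Psi> f)) (\<Psi> g)"
    using \<Phi>_ip[OF L.op_in] by (simp add: twist_def)
qed (use L.op_in[OF \<Psi>_in] in \<open>simp_all add: L.pre_hilbert_axioms twist_in \<Psi>_nrm\<close>)

lemma untwist_continuous: "continuous_map (weakstar_op L) (weakstar_op L) untwist"
proof (rule weakstar_continuous_sandwich[where U = \<Phi> and V = \<Phi>])
  fix T f g assume "T \<in> operators L" "f \<in> carrier L" "g \<in> carrier L"
  then show "cinner L (untwist T f) g = cinner L (T (\<Phi> f)) (\<Phi> g)"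
    using \<Psi>_ip[OF L.op_in] by (simp add: untwist_def)
qed (use L.op_in[OF \<Phi>_in] in \<open>simp_all add: L.pre_hilbert_axioms untwist_in \<Phi>_nrm\<close>)

lemma permuted_entry2:
  assumes \<sigma>: "bij_betw f GQ GQ" and \<tau>: "bij_betw g GQ GQ" and gf: "\<And>p. p \<in> GQ \<Longrightarrow> f p \<in> GQ \<and> g (f p) = p"
    and S: "S \<in> operators L"
    and c: "c \<in> carrier Q" "r \<in> carrier G" "f (c, r) = (u, a)"
    and d: "d \<in> carrier Q" "s \<in> carrier G" "f (d, s) = (v, b)"
  shows "entry2 (permute_op (carrier Q) (carrier G) X f \<circ> S \<circ> permute_op (carrier Q) (carrier G) X g) c r d s
    = entry2 S u a v b"
proof
  fix x
  have vb: "v \<in> carrier Q" "b \<in> carrier G" "g (v, b) = (d, s)" using gf[of "(d, s)"] d by auto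
  show "entry2 (permute_op (carrier Q) (carrier G) X f \<circ> S \<circ> permute_op (carrier Q) (carrier G) X g) c r d s x
    = entry2 S u a v b x"
  proof (cases "x \<in> carrier X")
    case True
    then show ?thesis
      by (simp add: entry2_apply d vb permute_op_delta[OF \<tau> vb d(1,2) True]
          permute_op_at[where \<sigma> = f, OF L.op_in[OF S] c])
  qed (simp add: entry2_outside)
qed

lemma twist_entry2:
  assumes "S \<in> operators L" "c \<in> carrier Q" "r \<in> carrier G" "d \<in> carrier Q" "s \<in> carrier G"
  shows "entry2 (twist S) c r d s = entry2 S (q r) (r \<otimes> inv (t c)) (q s) (s \<otimes> inv (t d))"
  unfolding twist_def \<Phi>_def \<Psi>_def
  by (rule permuted_entry2[OF bij_\<sigma> bij_\<tau> \<tau>_\<sigma>]) (use assms in auto)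

lemma untwist_entry2:
  assumes "S \<in> operators L" "u \<in> carrier Q" "a \<in> carrier G" "v \<in> carrier Q" "b \<in> carrier G"
  defines "c \<equiv> inv\<^bsub>Q\<^esub> q a \<otimes>\<^bsub>Q\<^esub> u" and "d \<equiv> inv\<^bsub>Q\<^esub> q b \<otimes>\<^bsub>Q\<^esub> v"
  shows "entry2 (untwist S) u a v b = entry2 S c (a \<otimes> t c) d (b \<otimes> t d)"
  unfolding untwist_def \<Phi>_def \<Psi>_def
  by (rule permuted_entry2[OF bij_\<tau> bij_\<sigma> \<sigma>_\<tau>]) (use assms in auto)

text \<open>If \<open>twist S\<close> is an amplification, all its diagonal blocks agree; this is the one at the unit.\<close>

definition \<mu> :: "(('q \<Rightarrow> 'g \<Rightarrow> 'x) \<Rightarrow> 'q \<Rightarrow> 'g \<Rightarrow> 'x) \<Rightarrow> ('g \<Rightarrow> 'x) \<Rightarrow> 'g \<Rightarrow> 'x" where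
  "\<mu> S = mat_entry K (twist S) \<one>\<^bsub>Q\<^esub> \<one>\<^bsub>Q\<^esub>"

definition \<nu> :: "(('g \<Rightarrow> 'x) \<Rightarrow> 'g \<Rightarrow> 'x) \<Rightarrow> ('q \<Rightarrow> 'g \<Rightarrow> 'x) \<Rightarrow> 'q \<Rightarrow> 'g \<Rightarrow> 'x" where
  "\<nu> T = untwist (ampl (carrier Q) K T)"

lemma \<mu>_in: "S \<in> operators L \<Longrightarrow> \<mu> S \<in> operators K"
  unfolding \<mu>_def by (rule K.mat_entry_in[OF twist_in]) simp_all

lemma \<nu>_in: "T \<in> operators K \<Longrightarrow> \<nu> T \<in> operators L"
  unfolding \<nu>_def by (rule untwist_in[OF K.ampl_in])

lemma \<mu>_entry:
  assumes "S \<in> operators L" "r \<in> carrier G" "s \<in> carrier G"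
  shows "mat_entry X (\<mu> S) r s = entry2 S (q r) r (q s) s"
  unfolding \<mu>_def using twist_entry2[OF assms(1) _ assms(2) _ assms(3), of "\<one>\<^bsub>Q\<^esub>" "\<one>\<^bsub>Q\<^esub>"] assms
  by (simp add: t_one)

lemma quotient_kernelsD:
  assumes "S \<in> quotient_kernels"
  shows "S \<in> operators L"
    and "\<lbrakk>u \<in> carrier Q; v \<in> carrier Q; a \<in> carrier G; b \<in> carrier G\<rbrakk> \<Longrightarrow> entry2 S u a v b \<in> N (a \<otimes> inv b)"
    and "\<lbrakk>u \<in> carrier Q; v \<in> carrier Q; a \<in> carrier G; b \<in> carrier G; g \<in> carrier G\<rbrakk>
      \<Longrightarrow> entry2 S u (a \<otimes> g) v (b \<otimes> g) = entry2 S u a v b"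
    and "\<lbrakk>u \<in> carrier Q; v \<in> carrier Q; a \<in> carrier G; b \<in> carrier G;
      q a \<otimes>\<^bsub>Q\<^esub> inv\<^bsub>Q\<^esub> q b \<noteq> u \<otimes>\<^bsub>Q\<^esub> inv\<^bsub>Q\<^esub> v\<rbrakk> \<Longrightarrow> entry2 S u a v b = 0"
  using assms unfolding quotient_kernels_def coset_algebra_def by simp_all

text \<open>The entry of \<open>twist S\<close> at $((c,r),(d,s))$ is the entry of \<open>S\<close> at
  $((q(r), r t_c^{-1}), (q(s), s t_d^{-1}))$. Its support condition reads $c = d$, and then right
  invariance removes the factor $t_c^{-1}$.\<close>

lemma twist_quotient_kernel:
  assumes S: "S \<in> quotient_kernels"
  shows "twist S = ampl (carrier Q) K (\<mu> S)"
proof (rule entry2_eqI)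
  note SL = quotient_kernelsD(1)[OF S]
  show "twist S \<in> operators L" by (rule twist_in[OF SL])
  show "ampl (carrier Q) K (\<mu> S) \<in> operators L" by (rule K.ampl_in[OF \<mu>_in[OF SL]])
  fix c r d s assume cr: "c \<in> carrier Q" "r \<in> carrier G" and ds: "d \<in> carrier Q" "s \<in> carrier G"
  have "entry2 (twist S) c r d s = (if c = d then mat_entry X (\<mu> S) r s else 0)"
  proof (cases "c = d")
    case True
    then show ?thesis
      using quotient_kernelsD(3)[OF S, of "q r" "q s" r s "inv (t d)"] cr ds
      by (simp add: twist_entry2[OF SL] \<mu>_entry[OF SL])
  next
    case False
    have "entry2 S (q r) (r \<otimes> inv (t c)) (q s) (s \<otimes> inv (t d)) = 0"
    proof (rule quotient_kernelsD(4)[OF S])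
      show "q (r \<otimes> inv (t c)) \<otimes>\<^bsub>Q\<^esub> inv\<^bsub>Q\<^esub> q (s \<otimes> inv (t d)) \<noteq> q r \<otimes>\<^bsub>Q\<^esub> inv\<^bsub>Q\<^esub> q s"
      proof
        assume "q (r \<otimes> inv (t c)) \<otimes>\<^bsub>Q\<^esub> inv\<^bsub>Q\<^esub> q (s \<otimes> inv (t d)) = q r \<otimes>\<^bsub>Q\<^esub> inv\<^bsub>Q\<^esub> q s"
        then have "q r \<otimes>\<^bsub>Q\<^esub> (inv\<^bsub>Q\<^esub> c \<otimes>\<^bsub>Q\<^esub> (d \<otimes>\<^bsub>Q\<^esub> inv\<^bsub>Q\<^esub> q s)) = q r \<otimes>\<^bsub>Q\<^esub> inv\<^bsub>Q\<^esub> q s"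
          using cr ds by (simp add: Q.inv_mult_group Q.m_assoc)
        then have "(inv\<^bsub>Q\<^esub> c \<otimes>\<^bsub>Q\<^esub> d) \<otimes>\<^bsub>Q\<^esub> inv\<^bsub>Q\<^esub> q s = \<one>\<^bsub>Q\<^esub> \<otimes>\<^bsub>Q\<^esub> inv\<^bsub>Q\<^esub> q s"
          using cr ds by (simp add: Q.m_assoc)
        then have "inv\<^bsub>Q\<^esub> c \<otimes>\<^bsub>Q\<^esub> d = \<one>\<^bsub>Q\<^esub>"
          using cr ds by (simp only: Q.right_cancel Q.m_closed Q.inv_closed q_closed Q.one_closed)
        then have "d = c" using cr ds by (metis Q.inv_closed Q.inv_equality Q.inv_inv Q.inv_comm)
        then show False using False by simp
      qed
    qed (use cr ds in simp_all)
    then show ?thesis using False cr ds by (simp add: twist_entry2[OF SL])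
  qed
  then show "entry2 (twist S) c r d s = entry2 (ampl (carrier Q) K (\<mu> S)) c r d s"
    by (simp add: K.mat_entry_ampl[OF \<mu>_in[OF SL] ds(1)])
qed

lemma \<mu>_invariant:
  assumes S: "S \<in> quotient_kernels"
  shows "\<mu> S \<in> invariant_kernels"
proof -
  note SL = quotient_kernelsD(1)[OF S]
  have "mat_entry X (\<mu> S) r s \<in> N (r \<otimes> inv s)" if "r \<in> carrier G" "s \<in> carrier G" for r s
    using quotient_kernelsD(2)[OF S] that by (simp add: \<mu>_entry[OF SL])
  moreover have "mat_entry X (\<mu> S) (r \<otimes> h) (s \<otimes> h) = mat_entry X (\<mu> S) r s"
    if "h \<in> fiber \<one>\<^bsub>Q\<^esub>" "r \<in> carrier G" "s \<in> carrier G" for h r s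
    using quotient_kernelsD(3)[OF S, of "q r" "q s" r s h] that by (simp add: \<mu>_entry[OF SL])
  ultimately show ?thesis
    unfolding invariant_kernels_def using \<mu>_in[OF SL] by (intro CollectI conjI ballI)
qed

text \<open>The factor \<open>t (?c u a)\<close> in the entries of \<open>\<nu> T\<close> depends on the row. When \<open>a\<close> and \<open>b\<close> are multiplied by \<open>g\<close>
  it changes by $g^{-1}$ up to a factor in the kernel of \<open>q\<close>, under which \<open>T\<close> is invariant.\<close>

lemma \<nu>_quotient_kernel:
  assumes T: "T \<in> invariant_kernels"
  shows "\<nu> T \<in> quotient_kernels"
proof -
  have TK: "T \<in> operators K"
    and TN: "\<And>r s. \<lbrakk>r \<in> carrier G; s \<in> carrier G\<rbrakk> \<Longrightarrow> mat_entry X T r s \<in> N (r \<otimes> inv s)"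
    and TH: "\<And>h r s. \<lbrakk>h \<in> fiber \<one>\<^bsub>Q\<^esub>; r \<in> carrier G; s \<in> carrier G\<rbrakk> \<Longrightarrow> mat_entry X T (r \<otimes> h) (s \<otimes> h) = mat_entry X T r s"
    using T unfolding invariant_kernels_def by blast+
  let ?c = "\<lambda>u a. inv\<^bsub>Q\<^esub> q a \<otimes>\<^bsub>Q\<^esub> u"
  have entry: "entry2 (\<nu> T) u a v b = (if ?c u a = ?c v b then mat_entry X T (a \<otimes> t (?c u a)) (b \<otimes> t (?c u a)) else 0)"
    if "u \<in> carrier Q" "v \<in> carrier Q" "a \<in> carrier G" "b \<in> carrier G" for u v a b
    using that unfolding \<nu>_def
    by (simp add: untwist_entry2[OF K.ampl_in[OF TK]] K.mat_entry_ampl[OF TK])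
  have "mat_entry K (\<nu> T) u v \<in> coset_algebra (fiber (u \<otimes>\<^bsub>Q\<^esub> inv\<^bsub>Q\<^esub> v))"
    if u: "u \<in> carrier Q" and v: "v \<in> carrier Q" for u v
    unfolding coset_algebra_def
  proof (intro CollectI conjI ballI impI)
    show "mat_entry K (\<nu> T) u v \<in> operators K" by (rule K.mat_entry_in[OF \<nu>_in[OF TK] v])
    fix a b assume a: "a \<in> carrier G" and b: "b \<in> carrier G"
    note e = entry[OF u v]
    have "mat_entry X T (a \<otimes> t c) (b \<otimes> t c) \<in> N (a \<otimes> inv b)" if c: "c \<in> carrier Q" for c
    proof -
      have "(a \<otimes> t c) \<otimes> inv (b \<otimes> t c) = a \<otimes> inv b"
        using a b c by (simp add: inv_mult_group m_assoc) (simp add: m_assoc[symmetric])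
      then show ?thesis using TN[of "a \<otimes> t c" "b \<otimes> t c"] a b c by simp
    qed
    then show "entry2 (\<nu> T) u a v b \<in> N (a \<otimes> inv b)"
      using a b u v N_zero by (simp add: e)
    {
      fix g assume g: "g \<in> carrier G"
      have c: "?c w (x \<otimes> g) = inv\<^bsub>Q\<^esub> q g \<otimes>\<^bsub>Q\<^esub> ?c w x" if "x \<in> carrier G" "w \<in> carrier Q" for x w
        using that g by (simp add: Q.inv_mult_group Q.m_assoc)
      have iff: "?c u (a \<otimes> g) = ?c v (b \<otimes> g) \<longleftrightarrow> ?c u a = ?c v b"
        unfolding c[OF a u] c[OF b v] using a b u v g by simp
      define k where "k = ?c u a"
      define k' where "k' = inv\<^bsub>Q\<^esub> q g \<otimes>\<^bsub>Q\<^esub> k"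
      have k: "k \<in> carrier Q" "k' \<in> carrier Q" using a u g by (simp_all add: k_def k'_def)
      define h where "h = inv (t k) \<otimes> (g \<otimes> t k')"
      have h: "h \<in> fiber \<one>\<^bsub>Q\<^esub>"
        using k g by (simp add: h_def) (simp add: k'_def Q.m_assoc[symmetric])
      have gt: "x \<otimes> g \<otimes> t k' = x \<otimes> t k \<otimes> h" if "x \<in> carrier G" for x
      proof -
        have tkh: "t k \<otimes> h = g \<otimes> t k'" using k g by (simp add: h_def m_assoc[symmetric])
        have "h \<in> carrier G" using h by simp
        then show ?thesis using that k g by (simp add: m_assoc tkh)
      qed
      have "mat_entry X T (a \<otimes> g \<otimes> t k') (b \<otimes> g \<otimes> t k') = mat_entry X T (a \<otimes> t k) (b \<otimes> t k)"
        unfolding gt[OF a] gt[OF b] using h a b k by (intro TH) simp_all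
      then show "entry2 (\<nu> T) u (a \<otimes> g) v (b \<otimes> g) = entry2 (\<nu> T) u a v b"
        using e[OF m_closed[OF a g] m_closed[OF b g]] e[OF a b]
        unfolding iff unfolding c[OF a u] k'_def k_def by presburger
    }
    assume "a \<otimes> inv b \<notin> fiber (u \<otimes>\<^bsub>Q\<^esub> inv\<^bsub>Q\<^esub> v)"
    then have ne: "q a \<otimes>\<^bsub>Q\<^esub> inv\<^bsub>Q\<^esub> q b \<noteq> u \<otimes>\<^bsub>Q\<^esub> inv\<^bsub>Q\<^esub> v" using a b by simp
    have "?c u a \<noteq> ?c v b"
    proof
      assume eq: "?c u a = ?c v b"
      have "u \<otimes>\<^bsub>Q\<^esub> inv\<^bsub>Q\<^esub> v = q a \<otimes>\<^bsub>Q\<^esub> (?c u a \<otimes>\<^bsub>Q\<^esub> inv\<^bsub>Q\<^esub> v)"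
        using a u v by (simp add: Q.m_assoc[symmetric])
      also have "\<dots> = q a \<otimes>\<^bsub>Q\<^esub> inv\<^bsub>Q\<^esub> q b"
        unfolding eq using a b v by (simp add: Q.m_assoc)
      finally show False using ne by simp
    qed
    then show "entry2 (\<nu> T) u a v b = 0" using a b by (simp add: e)
  qed
  then show ?thesis unfolding quotient_kernels_def using \<nu>_in[OF TK] by blast
qed

lemma \<mu>_\<nu>: "T \<in> operators K \<Longrightarrow> \<mu> (\<nu> T) = T"
  unfolding \<mu>_def \<nu>_def by (simp add: twist_untwist[OF K.ampl_in] K.mat_entry_ampl)

lemma \<nu>_\<mu>: "S \<in> quotient_kernels \<Longrightarrow> \<nu> (\<mu> S) = S"
  unfolding \<nu>_def using untwist_twist[OF quotient_kernelsD(1)] by (simp only: twist_quotient_kernel[symmetric])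

lemma \<mu>_comp:
  assumes S: "S \<in> quotient_kernels" and T: "T \<in> quotient_kernels"
  shows "\<mu> (S \<circ> T) = \<mu> S \<circ> \<mu> T"
proof -
  note SL = quotient_kernelsD(1)[OF S] and TL = quotient_kernelsD(1)[OF T]
  have "twist (S \<circ> T) = ampl (carrier Q) K (\<mu> S \<circ> \<mu> T)"
    unfolding twist_comp[OF SL TL] twist_quotient_kernel[OF S] twist_quotient_kernel[OF T]
    by (rule K.ampl_comp[symmetric, OF \<mu>_in[OF SL] \<mu>_in[OF TL]])
  then show ?thesis
    unfolding \<mu>_def[of "S \<circ> T"] by (simp add: K.mat_entry_ampl K.op_comp_in \<mu>_in SL TL)
qed

lemma \<mu>_adj: "S \<in> operators L \<Longrightarrow> \<mu> (adj L S) = adj K (\<mu> S)"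
  unfolding \<mu>_def using K.adj_mat_entry[OF twist_in, of S "\<one>\<^bsub>Q\<^esub>" "\<one>\<^bsub>Q\<^esub>"] by (simp add: twist_adj)

lemma \<mu>_add: "S \<in> operators L \<Longrightarrow> T \<in> operators L \<Longrightarrow> \<mu> (S + T) = \<mu> S + \<mu> T"
proof -
  assume S: "S \<in> operators L" and T: "T \<in> operators L"
  have "twist (S + T) = twist S + twist T"
    by (rule ext) (simp add: twist_def L.op_add[OF \<Phi>_in L.op_in[OF S] L.op_in[OF T]])
  then show ?thesis unfolding \<mu>_def by (simp add: K.mat_entry_add)
qed

lemma \<mu>_scale: "S \<in> operators L \<Longrightarrow> \<mu> (c *\<^sub>C S) = c *\<^sub>C \<mu> S"
proof -
  assume S: "S \<in> operators L"
  have "twist (c *\<^sub>C S) f = (c *\<^sub>C twist S) f" for f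
    using L.op_scale[OF \<Phi>_in L.op_in[OF S, of "\<Psi> f"], of c] by (simp add: twist_def)
  then have "twist (c *\<^sub>C S) = c *\<^sub>C twist S" by blast
  then show ?thesis unfolding \<mu>_def by (simp add: K.mat_entry_scale)
qed

lemma \<mu>_continuous: "continuous_map (weakstar_op L) (weakstar_op K) \<mu>"
  using continuous_map_compose[OF twist_continuous K.mat_entry_continuous[of "\<one>\<^bsub>Q\<^esub>" "carrier Q" "\<one>\<^bsub>Q\<^esub>"]]
  by (simp add: \<mu>_def[abs_def] o_def)

lemma \<nu>_continuous: "continuous_map (weakstar_op K) (weakstar_op L) \<nu>"
  using continuous_map_compose[OF K.ampl_continuous untwist_continuous]
  by (simp add: \<nu>_def[abs_def] o_def)

lemma \<mu>_homeomorphic: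
  "homeomorphic_maps (subtopology (weakstar_op L) quotient_kernels) (subtopology (weakstar_op K) invariant_kernels) \<mu> \<nu>"
  unfolding homeomorphic_maps_def
proof (intro conjI ballI)
  have inv_K: "T \<in> operators K" if "T \<in> invariant_kernels" for T using that by (simp add: invariant_kernels_def)
  show "continuous_map (subtopology (weakstar_op L) quotient_kernels) (subtopology (weakstar_op K) invariant_kernels) \<mu>"
    using \<mu>_invariant by (intro continuous_map_into_subtopology continuous_map_from_subtopology \<mu>_continuous) auto
  show "continuous_map (subtopology (weakstar_op K) invariant_kernels) (subtopology (weakstar_op L) quotient_kernels) \<nu>"
    using \<nu>_quotient_kernel by (intro continuous_map_into_subtopology continuous_map_from_subtopology \<nu>_continuous) auto
  show "\<nu> (\<mu> S) = S" if "S \<in> topspace (subtopology (weakstar_op L) quotient_kernels)" for S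
    using that by (simp add: \<nu>_\<mu>)
  show "\<mu> (\<nu> T) = T" if "T \<in> topspace (subtopology (weakstar_op K) invariant_kernels)" for T
    using that by (simp add: \<mu>_\<nu>)
qed

theorem \<mu>_isomorphism: "wstar_isomorphism L quotient_kernels K invariant_kernels \<mu>"
  unfolding wstar_isomorphism_def
proof (intro conjI ballI)
  have inv_K: "T \<in> operators K" if "T \<in> invariant_kernels" for T using that by (simp add: invariant_kernels_def)
  show "bij_betw \<mu> quotient_kernels invariant_kernels"
    by (rule bij_betwI[where g = \<nu>]) (auto simp: \<mu>_invariant \<nu>_quotient_kernel \<nu>_\<mu> \<mu>_\<nu> inv_K)
  show "linear_maps_on quotient_kernels \<mu>"
    unfolding linear_maps_on_def by (auto simp: \<mu>_add \<mu>_scale quotient_kernelsD(1))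
  show "\<mu> (S \<circ> T) = \<mu> S \<circ> \<mu> T" if "S \<in> quotient_kernels" "T \<in> quotient_kernels" for S T
    using that by (rule \<mu>_comp)
  show "\<mu> (adj L S) = adj K (\<mu> S)" if "S \<in> quotient_kernels" for S
    by (rule \<mu>_adj[OF quotient_kernelsD(1)[OF that]])
  show "homeomorphic_map (subtopology (weakstar_op L) quotient_kernels) (subtopology (weakstar_op K) invariant_kernels) \<mu>"
    using \<mu>_homeomorphic homeomorphic_maps_map by blast
qed

end

section \<open>The reduced algebras\<close>

lemma linear_image_span:
  fixes f :: "'v::complex_vector \<Rightarrow> 'w::complex_vector"
  assumes f: "linear_maps_on A f" and A: "complex_vector.subspace A" and B: "B \<subseteq> A"
  shows "f ` complex_vector.span B = complex_vector.span (f ` B)"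
proof (rule equalityI)
  have add: "f (x + y) = f x + f y" if "x \<in> A" "y \<in> A" for x y using f that by (simp add: linear_maps_on_def)
  have scl: "f (c *\<^sub>C x) = c *\<^sub>C f x" if "x \<in> A" for c x using f that by (simp add: linear_maps_on_def)
  have A0: "0 \<in> A" by (rule complex_vector.subspace_0[OF A])
  have f0: "f 0 = 0" using scl[OF A0, of 0] by simp
  have "complex_vector.span B \<subseteq> {x \<in> A. f x \<in> complex_vector.span (f ` B)}"
  proof (rule complex_vector.span_minimal)
    show "B \<subseteq> {x \<in> A. f x \<in> complex_vector.span (f ` B)}"
      using B by (auto intro: complex_vector.span_base)
    show "complex_vector.subspace {x \<in> A. f x \<in> complex_vector.span (f ` B)}"
    proof (rule complex_vector.subspaceI)
      show "0 \<in> {x \<in> A. f x \<in> complex_vector.span (f ` B)}"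
        using A0 f0 complex_vector.span_zero[of "f ` B"] by simp
    qed (use A in \<open>auto simp: add scl complex_vector.subspace_add complex_vector.subspace_scale
        intro: complex_vector.span_add complex_vector.span_scale\<close>)
  qed
  then show "f ` complex_vector.span B \<subseteq> complex_vector.span (f ` B)" by blast
  have BA: "complex_vector.span B \<subseteq> A" by (rule complex_vector.span_minimal[OF B A])
  show "complex_vector.span (f ` B) \<subseteq> f ` complex_vector.span B"
  proof (rule complex_vector.span_minimal)
    show "f ` B \<subseteq> f ` complex_vector.span B" using complex_vector.span_superset by blast
    show "complex_vector.subspace (f ` complex_vector.span B)"
    proof (rule complex_vector.subspaceI)
      show "0 \<in> f ` complex_vector.span B" using f0 complex_vector.span_zero[of B] by force
      fix y z and c :: complex assume "y \<in> f ` complex_vector.span B"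
      then obtain x where x: "x \<in> complex_vector.span B" "y = f x" by blast
      show "c *\<^sub>C y \<in> f ` complex_vector.span B"
        using scl[of x c] x BA complex_vector.span_scale[OF x(1), of c] by (metis image_eqI subsetD)
      assume "z \<in> f ` complex_vector.span B"
      then obtain w where w: "w \<in> complex_vector.span B" "z = f w" by blast
      show "y + z \<in> f ` complex_vector.span B"
        using add[of x w] x w BA complex_vector.span_add[OF x(1) w(1)] by (metis image_eqI subsetD)
    qed
  qed
qed

context kernel_quotient
begin

lemma quotient_kernels_subspace: "complex_vector.subspace quotient_kernels"
proof (rule complex_vector.subspaceI)
  note sub = coset_algebra_subspace
  show "0 \<in> quotient_kernels"
    by (simp add: quotient_kernels_def complex_vector.subspace_0[OF sub])
  fix S T and c :: complex assume S: "S \<in> quotient_kernels"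
  then show "c *\<^sub>C S \<in> quotient_kernels"
    by (simp add: quotient_kernels_def L.op_scaleC_in K.mat_entry_scale complex_vector.subspace_scale[OF sub])
  assume T: "T \<in> quotient_kernels"
  with S show "S + T \<in> quotient_kernels"
    by (simp add: quotient_kernels_def L.op_plus_in K.mat_entry_add complex_vector.subspace_add[OF sub])
qed

lemma quotient_kernels_closed: "closedin (weakstar_op L) quotient_kernels"
proof -
  have "closedin (weakstar_op L) {S \<in> topspace (weakstar_op L). \<forall>u\<in>carrier Q. \<forall>v\<in>carrier Q.
      mat_entry K S u v \<in> coset_algebra (fiber (u \<otimes>\<^bsub>Q\<^esub> inv\<^bsub>Q\<^esub> v))}"
    by (intro closedin_ball closedin_continuous_map_preimage[OF K.mat_entry_continuous coset_algebra_closed])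
  then show ?thesis unfolding quotient_kernels_def by (simp only: L.topspace_weakstar)
qed

lemma invariant_kernels_closed: "closedin (weakstar_op K) invariant_kernels"
proof -
  have "closedin (weakstar_op K) {T \<in> topspace (weakstar_op K).
     (\<forall>r\<in>carrier G. \<forall>s\<in>carrier G. mat_entry X T r s \<in> N (r \<otimes> inv s)) \<and>
     (\<forall>h\<in>fiber \<one>\<^bsub>Q\<^esub>. \<forall>r\<in>carrier G. \<forall>s\<in>carrier G. mat_entry X T (r \<otimes> h) (s \<otimes> h) = mat_entry X T r s)}"
  proof (intro closedin_conj closedin_ball)
    fix r s assume r: "r \<in> carrier G" and s: "s \<in> carrier G"
    show "closedin (weakstar_op K) {T \<in> topspace (weakstar_op K). mat_entry X T r s \<in> N (r \<otimes> inv s)}"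
      by (rule closedin_continuous_map_preimage[OF mat_entry_continuous[OF r s] N_closed]) (simp add: r s)
    fix h assume "h \<in> fiber \<one>\<^bsub>Q\<^esub>"
    with r s show "closedin (weakstar_op K) {T \<in> topspace (weakstar_op K).
        mat_entry X T (r \<otimes> h) (s \<otimes> h) = mat_entry X T r s}"
      by (intro closedin_equalizer mat_entry_continuous) simp_all
  qed
  then show ?thesis unfolding invariant_kernels_def by (simp only: K.topspace_weakstar)
qed

lemma \<mu>_generator:
  assumes u: "u \<in> carrier Q" and a: "a \<in> coset_algebra (fiber u)"
  shows "tensor_lambda Q K a u \<in> quotient_kernels" and "\<mu> (tensor_lambda Q K a u) = a"
proof -
  interpret QK: group_hilbert Q K ..
  have aK: "a \<in> operators K" using a by (simp add: coset_algebra_def)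
  note g = QK.tensor_lambda_in[OF aK u]
  note e = QK.mat_entry_tensor_lambda[OF aK u]
  have "mat_entry K (tensor_lambda Q K a u) v w \<in> coset_algebra (fiber (v \<otimes>\<^bsub>Q\<^esub> inv\<^bsub>Q\<^esub> w))"
    if "v \<in> carrier Q" "w \<in> carrier Q" for v w
    using that u a complex_vector.subspace_0[OF coset_algebra_subspace] by (auto simp: e Q.m_assoc)
  then show "tensor_lambda Q K a u \<in> quotient_kernels" unfolding quotient_kernels_def using g by blast
  show "\<mu> (tensor_lambda Q K a u) = a"
  proof (rule op_entries_eqI[OF \<mu>_in[OF g] aK])
    fix r s assume rs: "r \<in> carrier G" "s \<in> carrier G"
    have "mat_entry X a r s = 0" if "q r \<noteq> u \<otimes>\<^bsub>Q\<^esub> q s"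
    proof -
      have "q r \<otimes>\<^bsub>Q\<^esub> inv\<^bsub>Q\<^esub> q s \<noteq> u" using that rs u by (metis Q.inv_solve_right q_closed)
      then have "r \<otimes> inv s \<notin> fiber u" using rs by simp
      then show ?thesis using a rs by (simp add: coset_algebra_def)
    qed
    then show "mat_entry X (\<mu> (tensor_lambda Q K a u)) r s = mat_entry X a r s"
      unfolding \<mu>_entry[OF g rs] using rs by (simp add: e)
  qed
qed

text \<open>Both algebras of kernels are weak$^*$-closed, so the closures may be taken inside them, where \<open>\<mu>\<close> is a
  homeomorphism.\<close>

theorem \<mu>_reduced:
  "\<mu> ` (weakstar_op L closure_of complex_vector.span {tensor_lambda Q K a u | u a. u \<in> carrier Q \<and> a \<in> coset_algebra (fiber u)})
    = weakstar_op K closure_of complex_vector.span (\<Union>u\<in>carrier Q. coset_algebra (fiber u))"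
proof -
  let ?B = "{tensor_lambda Q K a u | u a. u \<in> carrier Q \<and> a \<in> coset_algebra (fiber u)}"
  let ?S = "complex_vector.span ?B"
  let ?X = "subtopology (weakstar_op L) quotient_kernels" and ?Y = "subtopology (weakstar_op K) invariant_kernels"
  have B: "?B \<subseteq> quotient_kernels" using \<mu>_generator(1) by blast
  have S: "?S \<subseteq> quotient_kernels" by (rule complex_vector.span_minimal[OF B quotient_kernels_subspace])
  have hom: "homeomorphic_map ?X ?Y \<mu>" using \<mu>_homeomorphic homeomorphic_maps_map by blast
  have "linear_maps_on quotient_kernels \<mu>" using \<mu>_isomorphism by (simp add: wstar_isomorphism_def)
  then have "\<mu> ` ?S = complex_vector.span (\<mu> ` ?B)"
    by (rule linear_image_span[OF _ quotient_kernels_subspace B])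
  also have "\<mu> ` ?B = (\<Union>u\<in>carrier Q. coset_algebra (fiber u))"
  proof (rule equalityI; rule subsetI)
    fix a assume "a \<in> \<mu> ` ?B"
    then show "a \<in> (\<Union>u\<in>carrier Q. coset_algebra (fiber u))" using \<mu>_generator(2) by auto
  next
    fix a assume "a \<in> (\<Union>u\<in>carrier Q. coset_algebra (fiber u))"
    then obtain u where u: "u \<in> carrier Q" "a \<in> coset_algebra (fiber u)" by blast
    then have "tensor_lambda Q K a u \<in> ?B" by blast
    then show "a \<in> \<mu> ` ?B" by (rule rev_image_eqI) (rule \<mu>_generator(2)[OF u, symmetric])
  qed
  finally have \<mu>S: "\<mu> ` ?S = complex_vector.span (\<Union>u\<in>carrier Q. coset_algebra (fiber u))" .
  have \<mu>S_inv: "\<mu> ` ?S \<subseteq> invariant_kernels" using S \<mu>_invariant by blast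
  have clX: "?X closure_of ?S = weakstar_op L closure_of ?S"
    using closure_of_minimal[OF S quotient_kernels_closed] S by (simp add: closure_of_subtopology Int_absorb1 Int_absorb2)
  have clY: "?Y closure_of (\<mu> ` ?S) = weakstar_op K closure_of (\<mu> ` ?S)"
    using closure_of_minimal[OF \<mu>S_inv invariant_kernels_closed] \<mu>S_inv by (simp add: closure_of_subtopology Int_absorb1 Int_absorb2)
  have "?S \<subseteq> topspace ?X"
    using S quotient_kernelsD(1) by auto
  then have "?Y closure_of (\<mu> ` ?S) = \<mu> ` (?X closure_of ?S)"
    by (rule homeomorphic_map_closure_of[OF hom])
  then show ?thesis unfolding clX clY \<mu>S[symmetric] by simp
qed

end

context group_hilbert
begin

lemma one_tensor_rho_in:
  assumes t: "t \<in> carrier G"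
  shows "one_tensor_rho G X t \<in> operators K"
proof (rule K.operatorsI[where B = 1])
  fix f g and c :: complex assume f: "f \<in> carrier K"
  note h = bij_right_translation[OF t]
  show "one_tensor_rho G X t f \<in> carrier K"
    using ell2_permute[OF h f] f by (simp add: one_tensor_rho_def)
  show "nrm K (one_tensor_rho G X t f) \<le> 1 * nrm K f"
    using ell2_permute_nrm[OF h, of f] f by (simp add: one_tensor_rho_def)
  show "one_tensor_rho G X t (c *\<^sub>C f) = c *\<^sub>C one_tensor_rho G X t f"
    using f K.scale_in[OF f] by (simp add: one_tensor_rho_def fun_eq_iff)
  assume g: "g \<in> carrier K"
  show "one_tensor_rho G X t (f + g) = one_tensor_rho G X t f + one_tensor_rho G X t g"
    using f g K.add_in[OF f g] by (simp add: one_tensor_rho_def fun_eq_iff)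
qed (simp add: one_tensor_rho_def)

lemma one_tensor_rho_adj:
  assumes t: "t \<in> carrier G"
  shows "adj K (one_tensor_rho G X t) = one_tensor_rho G X (inv t)"
proof (rule K.adj_eqI)
  have it: "inv t \<in> carrier G" using t by simp
  show "one_tensor_rho G X (inv t) \<in> operators K" by (rule one_tensor_rho_in[OF it])
  fix f g assume f: "f \<in> carrier K" and g: "g \<in> carrier K"
  let ?g = "one_tensor_rho G X (inv t) g"
  have g': "?g \<in> carrier K" by (rule K.op_in[OF one_tensor_rho_in[OF it]])
  have "one_tensor_rho G X t ?g = g"
    using g g' ell2_outside[OF g] t by (auto simp: one_tensor_rho_def fun_eq_iff m_assoc)
  then show "cinner K (one_tensor_rho G X t f) g = cinner K f ?g"
    using ell2_permute_ip[OF bij_right_translation[OF t], of f ?g] f g'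
    by (simp add: one_tensor_rho_def[of G X t])
qed

lemma kernel_action_in:
  assumes "T \<in> operators K" "t \<in> carrier G"
  shows "kernel_action G X t T \<in> operators K"
  unfolding kernel_action_def one_tensor_rho_adj[OF assms(2)]
  using assms by (intro K.op_comp_in one_tensor_rho_in) simp_all

lemma kernel_action_entry:
  assumes T: "T \<in> operators K" and t: "t \<in> carrier G" and r: "r \<in> carrier G" and s: "s \<in> carrier G"
  shows "mat_entry X (kernel_action G X t T) r s = mat_entry X T (r \<otimes> t) (s \<otimes> t)"
proof
  fix x show "mat_entry X (kernel_action G X t T) r s x = mat_entry X T (r \<otimes> t) (s \<otimes> t) x"
  proof (cases "x \<in> carrier X")
    case True
    have "one_tensor_rho G X (inv t) (delta s x) = delta (s \<otimes> t) x"
      using one_tensor_rho_delta[OF group_axioms complex_hilbert_axioms _ s True, of "inv t"] t by simp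
    then show ?thesis
      using True K.op_in[OF T, of "delta (s \<otimes> t) x"] r
      by (simp add: mat_entry_apply kernel_action_def one_tensor_rho_adj[OF t])
        (simp add: one_tensor_rho_def)
  qed (simp add: mat_entry_def)
qed

lemma kernel_action_fixed_iff:
  assumes T: "T \<in> operators K" and t: "t \<in> carrier G"
  shows "kernel_action G X t T = T \<longleftrightarrow>
    (\<forall>r\<in>carrier G. \<forall>s\<in>carrier G. mat_entry X T (r \<otimes> t) (s \<otimes> t) = mat_entry X T r s)"
proof
  assume eq: "kernel_action G X t T = T"
  show "\<forall>r\<in>carrier G. \<forall>s\<in>carrier G. mat_entry X T (r \<otimes> t) (s \<otimes> t) = mat_entry X T r s"
    using kernel_action_entry[OF T t] unfolding eq by simp
next
  assume inv: "\<forall>r\<in>carrier G. \<forall>s\<in>carrier G. mat_entry X T (r \<otimes> t) (s \<otimes> t) = mat_entry X T r s"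
  show "kernel_action G X t T = T"
    by (rule op_entries_eqI[OF kernel_action_in[OF T t] T]) (simp add: kernel_action_entry[OF T t] inv)
qed

end

lemma (in wstar_representation) image_operator_bundle:
  "operator_bundle G X (\<lambda>t. \<pi> t ` fib M t)"
proof -
  have banach: "complex_banach (fibre M t)" if "t \<in> carrier G" for t by (rule fibre_banach[OF that])
  have closed: "closedin (weakstar_op X) (\<pi> t ` fib M t)" if t: "t \<in> carrier G" for t
  proof -
    interpret V: complex_banach "fibre M t" by (rule banach[OF t])
    interpret dual_embedding X "fibre M t" "F t" "p t" "\<pi> t"
      using fibre_dual[OF t] rep_operator[OF t] rep_linear[OF t] rep_isometric[OF t] rep_weakstar[OF t]
      by unfold_locales (simp_all add: weakstar_fibre_def)
    show ?thesis by (rule emb_range_closed)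
  qed
  have sub: "complex_vector.subspace (\<pi> t ` fib M t)" if t: "t \<in> carrier G" for t
  proof -
    have V: "complex_vector.subspace (fib M t)" using banach[OF t] by (rule complex_banach.subspace)
    then have span: "complex_vector.span (fib M t) = fib M t" by (rule complex_vector.span_eq_iff[THEN iffD2])
    have "\<pi> t ` fib M t = complex_vector.span (\<pi> t ` fib M t)"
      using linear_image_span[OF rep_linear[OF t] V subset_refl] unfolding span .
    then show ?thesis using complex_vector.subspace_span by metis
  qed
  show ?thesis
  proof
    show "closedin (weakstar_op X) (\<pi> t ` fib M t)" if "t \<in> carrier G" for t by (rule closed[OF that])
    show "complex_vector.subspace (\<pi> t ` fib M t)" if "t \<in> carrier G" for t by (rule sub[OF that])
    show "a \<circ> b \<in> \<pi> (s \<otimes> t) ` fib M (s \<otimes> t)"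
      if st: "s \<in> carrier G" "t \<in> carrier G" and ab: "a \<in> \<pi> s ` fib M s" "b \<in> \<pi> t ` fib M t" for s t a b
    proof -
      obtain m n where m: "m \<in> fib M s" "a = \<pi> s m" and n: "n \<in> fib M t" "b = \<pi> t n" using ab by blast
      show ?thesis
        by (rule rev_image_eqI[OF fmult_closed[OF st m(1) n(1)]]) (simp only: m n rep_mult[OF st m(1) n(1)])
    qed
    show "adj X a \<in> \<pi> (inv t) ` fib M (inv t)" if t: "t \<in> carrier G" and a: "a \<in> \<pi> t ` fib M t" for t a
    proof -
      obtain m where m: "m \<in> fib M t" "a = \<pi> t m" using a by blast
      show ?thesis
        by (rule rev_image_eqI[OF fstar_closed[OF t m(1)]]) (simp only: m rep_star[OF t m(1)])
    qed
    show "id_op X \<in> \<pi> \<one> ` fib M \<one>"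
    proof -
      obtain e where e: "e \<in> fib M \<one>" "\<pi> \<one> e = id_op X" using rep_unital by blast
      show ?thesis by (rule rev_image_eqI[OF e(1)]) (rule e(2)[symmetric])
    qed
  qed
qed

section \<open>The isomorphism\<close>

theorem (in wstar_representation) quotient_isomorphism:
  assumes H: "H \<lhd> G"
  defines "K \<equiv> ell2 (carrier G) X"
  shows "\<exists>\<mu>. wstar_isomorphism
      (ell2 (carrier (G Mod H)) K) (kernel_algebra (G Mod H) (quotient_bundle G M X \<pi>) K inclusion_rep)
      K (kernel_fixed_points G H M X \<pi>) \<mu>
    \<and> \<mu> ` reduced_wstar_algebra (G Mod H) (quotient_bundle G M X \<pi>) K inclusion_rep
      = reduced_wstar_algebra G M X \<pi>"
proof -
  interpret H: normal H G by (rule H)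
  have self: "H #> x = c" if c: "c \<in> rcosets H" and x: "x \<in> c" for x c
  proof -
    obtain g where g: "g \<in> carrier G" "c = H #> g" using c by (auto simp: RCOSETS_def)
    show ?thesis using repr_independence[OF _ g(1) H.subgroup_axioms, of x] x g by simp
  qed
  have HH: "H \<in> rcosets H" using rcosetsI[OF H.subset one_closed] H.subset by simp
  have cG: "c \<subseteq> carrier G" if "c \<in> rcosets H" for c by (rule rcoset_carrier[OF H that])
  define t where "t c = (if c = H then \<one> else SOME x. x \<in> c)" for c
  have t: "t c \<in> c" if c: "c \<in> rcosets H" for c
  proof (cases "c = H")
    case False
    obtain g where g: "g \<in> carrier G" "c = H #> g" using c by (auto simp: RCOSETS_def)
    then have "g \<in> c" using rcos_self[OF g(1) H.subgroup_axioms] by simp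
    then have "(SOME x. x \<in> c) \<in> c" by (rule someI)
    then show ?thesis using False by (simp add: t_def)
  qed (simp add: t_def)
  have Q: "carrier (G Mod H) = rcosets H" by (simp add: FactGroup_def)
  interpret B: kernel_quotient G X "\<lambda>t. \<pi> t ` fib M t" "G Mod H" "\<lambda>x. H #> x" t
  proof (intro kernel_quotient.intro kernel_quotient_axioms.intro)
    show "operator_bundle G X (\<lambda>t. \<pi> t ` fib M t)" by (rule image_operator_bundle)
    show "group (G Mod H)" by (rule H.factorgroup_is_group)
    show "H #> x \<in> carrier (G Mod H)" if "x \<in> carrier G" for x
      unfolding Q by (rule rcosetsI[OF H.subset that])
    show "H #> (x \<otimes> y) = (H #> x) \<otimes>\<^bsub>G Mod H\<^esub> (H #> y)" if "x \<in> carrier G" "y \<in> carrier G" for x y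
      using H.rcos_sum[OF that] by simp
    show "t c \<in> carrier G" if "c \<in> carrier (G Mod H)" for c
      using t[of c] cG[of c] that unfolding Q by blast
    show "H #> t c = c" if "c \<in> carrier (G Mod H)" for c
      using self[OF _ t] that unfolding Q by blast
    show "t \<one>\<^bsub>G Mod H\<^esub> = \<one>" by (simp add: t_def)
  qed
  have fiber: "B.fiber c = c" if c: "c \<in> carrier (G Mod H)" for c
  proof (rule equalityI; rule subsetI)
    fix x assume "x \<in> B.fiber c"
    then show "x \<in> c" using rcos_self[of x H] H.subgroup_axioms by auto
  next
    fix x assume "x \<in> c"
    then show "x \<in> B.fiber c" using self[of c x] cG[of c] c unfolding Q by blast
  qed
  have gens: "{tensor_lambda G X (\<pi> t m) t | t m. t \<in> A \<and> m \<in> fib M t} = B.gens A" for A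
    unfolding B.gens_def by blast
  have csc: "cross_section_closure G M X \<pi> c = B.coset_algebra (B.fiber c)" if c: "c \<in> carrier (G Mod H)" for c
    unfolding cross_section_closure_def gens fiber[OF c]
    by (rule B.coset_algebra_eq_closure[OF H]) (use c in \<open>simp add: Q\<close>)
  have ker: "kernel_algebra (G Mod H) (quotient_bundle G M X \<pi>) K inclusion_rep = B.quotient_kernels"
    unfolding kernel_algebra_def B.quotient_kernels_def K_def quotient_bundle_def
    by (auto simp: csc simp del: mult_FactGroup)
  have fixed: "kernel_fixed_points G H M X \<pi> = B.invariant_kernels"
  proof -
    have one: "B.fiber \<one>\<^bsub>G Mod H\<^esub> = H" using fiber[OF B.Q.one_closed] by simp
    have HG: "h \<in> carrier G" if "h \<in> H" for h using that H.subset by blast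
    have iff: "(\<forall>h\<in>H. kernel_action G X h T = T) \<longleftrightarrow>
        (\<forall>h\<in>H. \<forall>r\<in>carrier G. \<forall>s\<in>carrier G. mat_entry X T (r \<otimes> h) (s \<otimes> h) = mat_entry X T r s)"
      if T: "T \<in> operators B.K" for T
      using B.kernel_action_fixed_iff[OF T HG] by (rule ball_cong[OF refl])
    show ?thesis
      unfolding kernel_fixed_points_def kernel_algebra_def B.invariant_kernels_def one
    proof (rule Collect_cong)
      fix T
      show "(T \<in> {T \<in> operators B.K. \<forall>r\<in>carrier G. \<forall>s\<in>carrier G. mat_entry X T r s \<in> \<pi> (r \<otimes> inv s) ` fib M (r \<otimes> inv s)}
          \<and> (\<forall>t\<in>H. kernel_action G X t T = T)) \<longleftrightarrow>
        (T \<in> operators B.K \<and> (\<forall>r\<in>carrier G. \<forall>s\<in>carrier G. mat_entry X T r s \<in> \<pi> (r \<otimes> inv s) ` fib M (r \<otimes> inv s))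
          \<and> (\<forall>h\<in>H. \<forall>r\<in>carrier G. \<forall>s\<in>carrier G. mat_entry X T (r \<otimes> h) (s \<otimes> h) = mat_entry X T r s))"
        using iff[of T] by (cases "T \<in> operators B.K") simp_all
    qed
  qed
  have red_quot: "reduced_wstar_algebra (G Mod H) (quotient_bundle G M X \<pi>) K inclusion_rep =
      weakstar_op B.L closure_of complex_vector.span
        {tensor_lambda (G Mod H) B.K a u | u a. u \<in> carrier (G Mod H) \<and> a \<in> B.coset_algebra (B.fiber u)}"
  proof -
    have "{tensor_lambda (G Mod H) K a u | u a. u \<in> carrier (G Mod H) \<and> a \<in> cross_section_closure G M X \<pi> u}
        = {tensor_lambda (G Mod H) B.K a u | u a. u \<in> carrier (G Mod H) \<and> a \<in> B.coset_algebra (B.fiber u)}"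
      unfolding K_def using csc by blast
    then show ?thesis
      unfolding reduced_wstar_algebra_def cross_section_closure_def[of "G Mod H"] quotient_bundle_def K_def by simp
  qed
  have red: "reduced_wstar_algebra G M X \<pi> =
      weakstar_op B.K closure_of complex_vector.span (\<Union>u\<in>carrier (G Mod H). B.coset_algebra (B.fiber u))"
  proof -
    let ?U = "\<Union>u\<in>carrier (G Mod H). B.coset_algebra (B.fiber u)"
    have GG: "carrier G \<lhd> G" by (rule normal_invI[OF subgroup_self]) simp
    have "carrier G \<in> rcosets (carrier G)"
      using rcosetsI[OF subset_refl one_closed] by simp
    then have whole: "weakstar_op B.K closure_of B.lin (carrier G) = B.coset_algebra (carrier G)"
      by (rule B.coset_algebra_eq_closure[OF GG])
    have "?U \<subseteq> B.coset_algebra (carrier G)" by (auto simp: B.coset_algebra_def)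
    then have "complex_vector.span ?U \<subseteq> B.coset_algebra (carrier G)"
      by (rule complex_vector.span_minimal[OF _ B.coset_algebra_subspace])
    then have "weakstar_op B.K closure_of complex_vector.span ?U \<subseteq> B.coset_algebra (carrier G)"
      by (rule closure_of_minimal[OF _ B.coset_algebra_closed])
    moreover have "B.gens (carrier G) \<subseteq> ?U"
    proof
      fix T assume "T \<in> B.gens (carrier G)"
      then obtain s where s: "s \<in> carrier G" "T \<in> B.gens (B.fiber (H #> s))"
        unfolding B.gens_def by blast
      then have "T \<in> B.coset_algebra (B.fiber (H #> s))" using B.gens_coset_algebra[of "B.fiber (H #> s)"] by blast
      then show "T \<in> ?U" using B.q_closed[OF s(1)] by blast
    qed
    then have "weakstar_op B.K closure_of B.lin (carrier G) \<subseteq> weakstar_op B.K closure_of complex_vector.span ?U"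
      by (intro closure_of_mono complex_vector.span_mono)
    ultimately show ?thesis
      unfolding reduced_wstar_algebra_def cross_section_closure_def gens whole by blast
  qed
  show ?thesis
    unfolding ker fixed red_quot red unfolding K_def using B.\<mu>_isomorphism B.\<mu>_reduced by blast
qed

theorem theorem2p16:
  fixes G :: "('g, 'c) monoid_scheme"
    and M :: "('g, 'm::complex_vector) fell_data"
    and F :: "'g \<Rightarrow> 'f::complex_vector cnormed"
    and p :: "'g \<Rightarrow> 'm \<Rightarrow> 'f \<Rightarrow> complex"
    and X :: "'x::complex_vector chilb"
    and \<pi> :: "'g \<Rightarrow> 'm \<Rightarrow> 'x \<Rightarrow> 'x"
  assumes "wstar_fell_bundle G M F p"
    and "H \<lhd> G"
    and "wstar_representation G M F p X \<pi>"
  shows "\<exists>\<mu>. wstar_isomorphism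
              (ell2 (carrier (G Mod H)) (ell2 (carrier G) X))
              (kernel_algebra (G Mod H) (quotient_bundle G M X \<pi>) (ell2 (carrier G) X) inclusion_rep)
              (ell2 (carrier G) X)
              (kernel_fixed_points G H M X \<pi>)
              \<mu>
          \<and> \<mu> ` reduced_wstar_algebra (G Mod H) (quotient_bundle G M X \<pi>) (ell2 (carrier G) X) inclusion_rep
              = reduced_wstar_algebra G M X \<pi>"
  using wstar_representation.quotient_isomorphism[OF assms(3,2)] .

end
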